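(* Consider the nearest-neighbour discrete NLS lattice on the periodic ring $\mathcal J=\{-N,\dots,N\}$ with $6\le N\le 10$, i.e. $\mathrm i\dot\psi_j=\partial H/\partial\overline{\psi_j}$ with $$H=\sum_{j\in\mathcal J}|\psi_j|^2+\tfrac12\sum_{j\in\mathcal J}|\psi_j|^4+\varepsilon\sum_{j\in\mathcal J}|\psi_{j+1}-\psi_j|^2 .$$ Let $S=\{-1,1\}$, let $I^*>0$ be such that $\omega=1+I^*$ satisfies $k\omega\pm1\neq0$ and $k\omega\pm2\neq0$ for all $k\in\mathbb Z\setminus\{0\}$, and let $T=2\pi/\omega$. Write $q_2=\theta_1-\theta_{-1}$. Then: (i) the unperturbed periodic orbits on the resonant torus (excited sites $S$, common action $I^*$) with $q_2=0$ and with $q_2=\pi$ can both be continued to $\varepsilon>0$ small as $T$-periodic solutions; (ii) for $\varepsilon>0$ small the continuation of $q_2=0$ is linearly unstable and the continuation of $q_2=\pi$ is linearly stable; (iii) no other value of $q_2\in\mathbb R/2\pi\mathbb Z$ gives an unperturbed orbit which is a limit of $T$-periodic solutions: if $\varepsilon_n\to0^+$ and $\psi^{(n)}$ are $T$-periodic solutions of the system with $\varepsilon=\varepsilon_n$ converging uniformly in $t$ to the unperturbed orbit with phase difference $q_2$, then $q_2\in\{0,\pi\}$.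
   Context: Site indices are taken modulo $2N+1$ (periodic boundary conditions). At $\varepsilon=0$, the unperturbed periodic orbits on the resonant torus are $\psi^{(0)}_j(t)=\sqrt{I^*}\,e^{-\mathrm i(\omega t+\theta_j)}$ for $j\in S$ and $\psi^{(0)}_j(t)=0$ for $j\in\mathcal J\setminus S$; up to time translation they are labelled by the phase differences of the $\theta_j$. An unperturbed orbit "can be continued" if there is $\varepsilon^*>0$ such that for every $0<\varepsilon<\varepsilon^*$ the system has a $T$-periodic solution $\psi^{\varepsilon}$, with $\psi^\varepsilon\to\psi^{(0)}$ uniformly in $t$ as $\varepsilon\to0^+$. A periodic solution is linearly stable if all the Floquet multipliers of its monodromy matrix (over the period $T$, viewing the system as a real Hamiltonian system) lie on the unit circle, and linearly unstable if at least one Floquet multiplier lies outside the unit circle. *)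

theory Defs
  imports
    "HOL-Analysis.Analysis"
    "HOL-Library.Real_Mod"
    "Jordan_Normal_Form.Char_Poly"
begin

no_notation Finite_Cartesian_Product.vec_nth (infixl "$" 90)

text \<open>
  A configuration of the ring is a function from \<open>int\<close> to \<open>complex\<close> of which only the
  values on \<open>ring_sites N\<close> matter; \<open>ring_mod N k\<close> is the representative of \<open>k\<close> modulo
  \<open>2N+1\<close> in \<open>{-N..N}\<close>.
\<close>

definition ring_sites :: "nat \<Rightarrow> int set" where
  "ring_sites N = {- int N..int N}"

definition ring_mod :: "nat \<Rightarrow> int \<Rightarrow> int" where
  "ring_mod N k = (k + int N) mod (2 * int N + 1) - int N"

definition dnls_hamiltonian :: "nat \<Rightarrow> real \<Rightarrow> (int \<Rightarrow> complex) \<Rightarrow> real" where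
  "dnls_hamiltonian N \<epsilon> u =
     (\<Sum>j\<in>ring_sites N. cmod (u j) ^ 2) + 1 / 2 * (\<Sum>j\<in>ring_sites N. cmod (u j) ^ 4)
     + \<epsilon> * (\<Sum>j\<in>ring_sites N. cmod (u (ring_mod N (j + 1)) - u j) ^ 2)"

text \<open>
  The Wirtinger derivative of a real function with respect to the conjugate of the \<open>j\<close>-th
  variable, that is \<open>(\<partial>/\<partial>x + \<i> \<partial>/\<partial>y) / 2\<close> where \<open>u j = x + \<i> y\<close>.
\<close>

definition wirtinger_cnj :: "((int \<Rightarrow> complex) \<Rightarrow> real) \<Rightarrow> (int \<Rightarrow> complex) \<Rightarrow> int \<Rightarrow> complex" where
  "wirtinger_cnj F u j =
     (complex_of_real (deriv (\<lambda>s. F (u(j := u j + complex_of_real s))) 0)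
      + \<i> * complex_of_real (deriv (\<lambda>s. F (u(j := u j + \<i> * complex_of_real s))) 0)) / 2"

definition dnls_solution :: "nat \<Rightarrow> real \<Rightarrow> (real \<Rightarrow> int \<Rightarrow> complex) \<Rightarrow> bool" where
  "dnls_solution N \<epsilon> \<psi> \<longleftrightarrow>
     (\<forall>t. \<forall>j\<in>ring_sites N. \<exists>D. ((\<lambda>s. \<psi> s j) has_vector_derivative D) (at t) \<and>
        \<i> * D = wirtinger_cnj (dnls_hamiltonian N \<epsilon>) (\<psi> t) j)"

definition dnls_periodic_solution ::
    "nat \<Rightarrow> real \<Rightarrow> real \<Rightarrow> (real \<Rightarrow> int \<Rightarrow> complex) \<Rightarrow> bool" where
  "dnls_periodic_solution N \<epsilon> T \<psi> \<longleftrightarrow>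
     dnls_solution N \<epsilon> \<psi> \<and> (\<forall>t. \<forall>j\<in>ring_sites N. \<psi> (t + T) j = \<psi> t j)"

definition unperturbed_orbit ::
    "int set \<Rightarrow> real \<Rightarrow> (int \<Rightarrow> real) \<Rightarrow> real \<Rightarrow> int \<Rightarrow> complex" where
  "unperturbed_orbit S I \<theta> t j =
     (if j \<in> S then complex_of_real (sqrt I) * exp (- (\<i> * complex_of_real ((1 + I) * t + \<theta> j)))
      else 0)"

definition converges_to_orbit ::
    "nat \<Rightarrow> ('a \<Rightarrow> real \<Rightarrow> int \<Rightarrow> complex) \<Rightarrow> (real \<Rightarrow> int \<Rightarrow> complex) \<Rightarrow> 'a filter \<Rightarrow> bool" where
  "converges_to_orbit N \<Psi> \<psi>0 F \<longleftrightarrow>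
     (\<forall>j\<in>ring_sites N. uniform_limit UNIV (\<lambda>a t. \<Psi> a t j) (\<lambda>t. \<psi>0 t j) F)"

definition is_continuation ::
    "nat \<Rightarrow> real \<Rightarrow> (real \<Rightarrow> int \<Rightarrow> complex) \<Rightarrow> (real \<Rightarrow> real \<Rightarrow> int \<Rightarrow> complex) \<Rightarrow> bool" where
  "is_continuation N T \<psi>0 \<Psi> \<longleftrightarrow>
     (\<exists>\<epsilon>0>0. \<forall>\<epsilon>. 0 < \<epsilon> \<and> \<epsilon> < \<epsilon>0 \<longrightarrow> dnls_periodic_solution N \<epsilon> T (\<Psi> \<epsilon>)) \<and>
     converges_to_orbit N \<Psi> \<psi>0 (at_right 0)"

definition can_be_continued :: "nat \<Rightarrow> real \<Rightarrow> (real \<Rightarrow> int \<Rightarrow> complex) \<Rightarrow> bool" where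
  "can_be_continued N T \<psi>0 \<longleftrightarrow> (\<exists>\<Psi>. is_continuation N T \<psi>0 \<Psi>)"

text \<open>
  Canonical real coordinates \<open>(x, y)\<close> with \<open>u j = (x j + \<i> y j) / sqrt 2\<close>: in them the system
  is \<open>x' = \<partial>H/\<partial>y\<close>, \<open>y' = - \<partial>H/\<partial>x\<close>. The vectors have dimension \<open>2n\<close> with \<open>n = 2N+1\<close>, first
  the \<open>n\<close> values of \<open>x\<close>, then those of \<open>y\<close>, the site \<open>j\<close> being at position \<open>j + N\<close>.
\<close>

definition real_coords :: "nat \<Rightarrow> (int \<Rightarrow> complex) \<Rightarrow> real vec" where
  "real_coords N u = (let n = 2 * N + 1 in
     Matrix.vec (2 * n) (\<lambda>k. sqrt 2 *
       (if k < n then Re (u (int k - int N)) else Im (u (int (k - n) - int N)))))"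

definition of_real_coords :: "nat \<Rightarrow> real vec \<Rightarrow> int \<Rightarrow> complex" where
  "of_real_coords N z j = (let n = 2 * N + 1; k = nat (j + int N) in
     Complex (z $ k) (z $ (n + k)) / complex_of_real (sqrt 2))"

definition partial_deriv :: "nat \<Rightarrow> (real vec \<Rightarrow> real) \<Rightarrow> real vec \<Rightarrow> real" where
  "partial_deriv k F z = deriv (\<lambda>s. F (z + s \<cdot>\<^sub>v unit_vec (dim_vec z) k)) 0"

definition hessian_mat :: "(real vec \<Rightarrow> real) \<Rightarrow> real vec \<Rightarrow> real mat" where
  "hessian_mat F z =
     mat (dim_vec z) (dim_vec z) (\<lambda>(i, k). partial_deriv i (partial_deriv k F) z)"

definition symplectic_mat :: "nat \<Rightarrow> real mat" where
  "symplectic_mat n = four_block_mat (0\<^sub>m n n) (1\<^sub>m n) (- 1\<^sub>m n) (0\<^sub>m n n)"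

definition variational_mat :: "nat \<Rightarrow> real \<Rightarrow> (int \<Rightarrow> complex) \<Rightarrow> real mat" where
  "variational_mat N \<epsilon> u =
     symplectic_mat (2 * N + 1) *
     hessian_mat (\<lambda>z. dnls_hamiltonian N \<epsilon> (of_real_coords N z)) (real_coords N u)"

definition fundamental_mat ::
    "nat \<Rightarrow> real \<Rightarrow> (real \<Rightarrow> int \<Rightarrow> complex) \<Rightarrow> (real \<Rightarrow> real mat) \<Rightarrow> bool" where
  "fundamental_mat N \<epsilon> \<psi> \<Phi> \<longleftrightarrow> (let d = 2 * (2 * N + 1) in
     (\<forall>t. \<Phi> t \<in> carrier_mat d d) \<and> \<Phi> 0 = 1\<^sub>m d \<and>
     (\<forall>t. \<forall>i<d. \<forall>k<d. ((\<lambda>s. \<Phi> s $$ (i, k)) has_real_derivative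
        (variational_mat N \<epsilon> (\<psi> t) * \<Phi> t) $$ (i, k)) (at t)))"

definition monodromy_mat ::
    "nat \<Rightarrow> real \<Rightarrow> real \<Rightarrow> (real \<Rightarrow> int \<Rightarrow> complex) \<Rightarrow> real mat \<Rightarrow> bool" where
  "monodromy_mat N \<epsilon> T \<psi> M \<longleftrightarrow> (\<exists>\<Phi>. fundamental_mat N \<epsilon> \<psi> \<Phi> \<and> M = \<Phi> T)"

definition floquet_multiplier :: "real mat \<Rightarrow> complex \<Rightarrow> bool" where
  "floquet_multiplier M \<mu> \<longleftrightarrow> eigenvalue (map_mat complex_of_real M) \<mu>"

text \<open>
  The monodromy matrix along a solution exists and is unique; asserting its existence in both definitions
  keeps either of them from holding vacuously.
\<close>

definition linearly_stable ::
    "nat \<Rightarrow> real \<Rightarrow> real \<Rightarrow> (real \<Rightarrow> int \<Rightarrow> complex) \<Rightarrow> bool" where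
  "linearly_stable N \<epsilon> T \<psi> \<longleftrightarrow>
     (\<exists>M. monodromy_mat N \<epsilon> T \<psi> M \<and> (\<forall>\<mu>. floquet_multiplier M \<mu> \<longrightarrow> cmod \<mu> = 1))"

definition linearly_unstable ::
    "nat \<Rightarrow> real \<Rightarrow> real \<Rightarrow> (real \<Rightarrow> int \<Rightarrow> complex) \<Rightarrow> bool" where
  "linearly_unstable N \<epsilon> T \<psi> \<longleftrightarrow>
     (\<exists>M. monodromy_mat N \<epsilon> T \<psi> M \<and> (\<exists>\<mu>. floquet_multiplier M \<mu> \<and> cmod \<mu> > 1))"

end

theory Submission
  imports Defs "Jordan_Normal_Form.Schur_Decomposition"
begin

text \<open>
  The phase symmetry of the lattice reduces everything to equilibria. Let p be a T-periodic
  solution near the unperturbed orbit, seen in the frame rotating with frequency \<open>\<omega> = 1 + I\<close>.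
  Its velocity g is T-periodic, is the derivative of a periodic function, and solves the linearised
  equation. For \<open>\<epsilon> = 0\<close> this forces g = 0: an empty site rotates with frequency I, and I T is not a
  multiple of \<open>2 pi\<close>; at an excited site the amplitude part of g is constant, and then so is the phase
  part, and both have a zero by Rolle's theorem. Since the perturbation is small, a bound on g can be
  halved again and again, so g = 0 for small \<open>\<epsilon>\<close> too: every periodic solution near the orbit is a
  rotating wave \<open>exp (- \<i> \<omega> t) u\<close> (\<open>periodic_solution_is_rotating_wave\<close>), and u solves a
  stationary equation.

  The imaginary part of \<open>cnj (u 1) * u\<close> lies in the kernel of a real Jacobi operator on the ring and
  vanishes at the site 1. Such a kernel element is zero, because the path through the site 0 carries
  an amplitude of order \<open>\<epsilon>\<close> from the site -1 to the site 0 while the way around the ring carries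
  much less (\<open>ring_op_kernel_trivial\<close>). Hence u is a real profile times a constant phase. This leaves
  only the phase differences 0 and pi (\<open>limit_phase_difference\<close>); conversely, with I scaled to 1
  and \<open>e = \<epsilon> / I\<close>, a contraction produces the real profiles near (1, s) for \<open>s = 1\<close> and
  \<open>s = - 1\<close> (\<open>standing_wave_exists\<close>), and they are unique (\<open>standing_wave_unique\<close>).

  In the rotating frame the variational equation has constant coefficients, so the monodromy matrix
  is \<open>exp (T A)\<close> and its multipliers are the numbers \<open>exp (T x)\<close> with x an eigenvalue of A
  (\<open>monodromy_rotating_wave\<close>, \<open>eigenvalue_mat_exp\<close>). For a real profile \<open>\<phi>\<close> the eigenvalue
  problem splits: with \<open>x = I y\<close> it reads \<open>y U = L- V\<close>, \<open>y V = - L+ U\<close>, where \<open>L-\<close> and \<open>L+\<close> are the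
  symmetric operators with potentials \<open>\<phi>^2 - 1\<close> and \<open>3 \<phi>^2 - 1\<close>. For \<open>y \<noteq> 0\<close> this is \<open>L- v = \<mu> w\<close>,
  \<open>L+ w = - v\<close> with \<open>\<mu> = y^2\<close>, and \<open>\<mu>\<close> is real as a quotient of two real forms. Modes with
  \<open>|\<mu>| \<ge> 1/4\<close> are concentrated on the empty sites, where both operators are close to - 1, so that
  \<open>\<mu> < 0\<close> (\<open>large_mode\<close>). Modes with small \<open>\<mu> \<noteq> 0\<close> are concentrated on the two excited sites. There
  the operator \<open>L-\<close> degenerates to first order in e; its kernel element \<open>\<phi>\<close> gives a discrete Wronskian
  identity that yields the second order, \<open>\<mu> = 4 s e^2 + O(e^3)\<close> (\<open>small_mode_value\<close>). For \<open>s = - 1\<close>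
  all \<open>\<mu>\<close> are therefore nonpositive and the eigenvalues imaginary. For \<open>s = 1\<close> a small \<open>\<mu> \<noteq> 0\<close>
  does occur, found by a contraction on odd sequences (\<open>unstable_mode_exists\<close>), and it is positive.
\<close>

section \<open>A contraction principle\<close>

text \<open>
  The Banach fixed point theorem for the supremum norm, stated for a set of bounded functions that is
  closed under pointwise limits, so that no metric on the function space has to be set up. It is
  used for the profiles and for the unstable mode.
\<close>

lemma contraction_fixpoint:
  fixes F :: "('i \<Rightarrow> real) \<Rightarrow> 'i \<Rightarrow> real"
  assumes f0: "f0 \<in> X" and maps: "\<And>f. f \<in> X \<Longrightarrow> F f \<in> X"
    and bdd: "\<And>f j. f \<in> X \<Longrightarrow> \<bar>f j\<bar> \<le> B"
    and closed: "\<And>s f. (\<And>n::nat. s n \<in> X) \<Longrightarrow> (\<And>j. (\<lambda>n. s n j) \<longlonglongrightarrow> f j) \<Longrightarrow> f \<in> X"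
    and contr: "\<And>f g D j. f \<in> X \<Longrightarrow> g \<in> X \<Longrightarrow> (\<And>i. \<bar>f i - g i\<bar> \<le> D) \<Longrightarrow> \<bar>F f j - F g j\<bar> \<le> D / 2"
  shows "\<exists>f\<in>X. F f = f"
proof -
  define s where "s n = (F ^^ n) f0" for n
  have sX: "s n \<in> X" for n by (induction n) (auto simp: s_def f0 maps)
  have sS: "s (Suc n) = F (s n)" for n by (simp add: s_def)
  have step: "\<bar>s (n + p) j - s n j\<bar> \<le> 2 * B / 2 ^ n" for n p j
  proof (induction n arbitrary: j)
    case 0
    have "\<bar>s p j\<bar> \<le> B" "\<bar>s 0 j\<bar> \<le> B" using bdd sX by auto
    then show ?case by simp
  next
    case (Suc n)
    have "\<bar>F (s (n + p)) j - F (s n) j\<bar> \<le> (2 * B / 2 ^ n) / 2"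
      by (rule contr[OF sX sX]) (rule Suc.IH)
    then show ?case by (simp add: sS)
  qed
  have tends0: "(\<lambda>n. 2 * B / 2 ^ n) \<longlonglongrightarrow> 0"
    by (rule LIMSEQ_divide_realpow_zero) simp
  have "Cauchy (\<lambda>n. s n j)" for j
  proof (rule metric_CauchyI)
    fix e :: real assume "e > 0"
    then have "\<forall>\<^sub>F n in sequentially. 2 * B / 2 ^ n < e / 2"
      by (intro order_tendstoD(2)[OF tends0]) simp
    then obtain M where M: "2 * B / 2 ^ M < e / 2"
      by (auto simp: eventually_sequentially)
    have near: "\<bar>s m j - s M j\<bar> < e / 2" if "m \<ge> M" for m
      using step[of M "m - M" j] that M by simp
    show "\<exists>M. \<forall>m\<ge>M. \<forall>n\<ge>M. dist (s m j) (s n j) < e"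
    proof (intro exI[of _ M] allI impI)
      fix m n assume "m \<ge> M" "n \<ge> M"
      then show "dist (s m j) (s n j) < e"
        using near[of m] near[of n] unfolding dist_real_def by linarith
    qed
  qed
  then have "\<forall>j. \<exists>l. (\<lambda>n. s n j) \<longlonglongrightarrow> l"
    using Cauchy_convergent unfolding convergent_def by blast
  then obtain f where f: "\<And>j. (\<lambda>n. s n j) \<longlonglongrightarrow> f j" by metis
  have fX: "f \<in> X" by (rule closed[OF sX f])
  have tail: "\<bar>f j - s n j\<bar> \<le> 2 * B / 2 ^ n" for n j
  proof (rule LIMSEQ_le_const2)
    show "(\<lambda>p. \<bar>s (p + n) j - s n j\<bar>) \<longlonglongrightarrow> \<bar>f j - s n j\<bar>"
      by (intro tendsto_intros LIMSEQ_ignore_initial_segment f)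
    show "\<exists>M. \<forall>p\<ge>M. \<bar>s (p + n) j - s n j\<bar> \<le> 2 * B / 2 ^ n"
      using step[of n _ j] by (auto simp: add.commute)
  qed
  have "F f j = f j" for j
  proof -
    have near: "norm (F f j - s (Suc n) j) \<le> 2 * B / 2 ^ n / 2" for n
      unfolding sS real_norm_def by (rule contr[OF fX sX]) (rule tail)
    have "(\<lambda>n. 2 * B / 2 ^ n / 2) \<longlonglongrightarrow> 0 / 2"
      by (rule tendsto_divide[OF tends0 tendsto_const]) simp
    then have half: "(\<lambda>n. 2 * B / 2 ^ n / 2) \<longlonglongrightarrow> 0" by simp
    have "(\<lambda>n. F f j - s (Suc n) j) \<longlonglongrightarrow> 0"
      by (rule Lim_null_comparison[OF always_eventually half]) (use near in blast)
    then have "(\<lambda>n. F f j - (F f j - s (Suc n) j)) \<longlonglongrightarrow> F f j - 0"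
      by (intro tendsto_intros)
    then have "(\<lambda>n. s (Suc n) j) \<longlonglongrightarrow> F f j" by simp
    then show ?thesis using LIMSEQ_unique[OF _ LIMSEQ_Suc[OF f]] by blast
  qed
  then show ?thesis using fX by blast
qed

section \<open>The ring and its discrete Laplacian\<close>

definition nxt :: "nat \<Rightarrow> int \<Rightarrow> int" where "nxt N j = ring_mod N (j + 1)"
definition prv :: "nat \<Rightarrow> int \<Rightarrow> int" where "prv N j = ring_mod N (j - 1)"

lemma ring_mod_in_ring [simp]: "ring_mod N j \<in> ring_sites N"
  using pos_mod_bound[of "2 * int N + 1" "j + int N"] pos_mod_sign[of "2 * int N + 1" "j + int N"]
  unfolding ring_mod_def ring_sites_def by auto

lemma nxt_in_ring [simp]: "nxt N j \<in> ring_sites N" by (simp add: nxt_def)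
lemma prv_in_ring [simp]: "prv N j \<in> ring_sites N" by (simp add: prv_def)
lemma finite_ring [simp]: "finite (ring_sites N)" by (simp add: ring_sites_def)

lemma nxt_eq: "j \<in> ring_sites N \<Longrightarrow> nxt N j = (if j = int N then - int N else j + 1)"
  by (auto simp: nxt_def ring_mod_def ring_sites_def)

lemma prv_eq: "j \<in> ring_sites N \<Longrightarrow> prv N j = (if j = - int N then int N else j - 1)"
  by (auto simp: prv_def ring_mod_def ring_sites_def zmod_minus1)

lemma prv_nxt [simp]: "j \<in> ring_sites N \<Longrightarrow> prv N (nxt N j) = j"
  using nxt_in_ring[of N j] by (auto simp: prv_eq) (auto simp: nxt_eq ring_sites_def split: if_splits)

lemma nxt_prv [simp]: "j \<in> ring_sites N \<Longrightarrow> nxt N (prv N j) = j"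
  using prv_in_ring[of N j] by (auto simp: nxt_eq) (auto simp: prv_eq ring_sites_def split: if_splits)

lemma sum_nxt:
  fixes g :: "int \<Rightarrow> 'a::comm_monoid_add"
  shows "(\<Sum>j\<in>ring_sites N. g (nxt N j)) = (\<Sum>j\<in>ring_sites N. g j)"
  by (rule sum.reindex_bij_witness[of _ "prv N" "nxt N"]) auto

lemma sum_prv:
  fixes g :: "int \<Rightarrow> 'a::comm_monoid_add"
  shows "(\<Sum>j\<in>ring_sites N. g (prv N j)) = (\<Sum>j\<in>ring_sites N. g j)"
  by (rule sum.reindex_bij_witness[of _ "nxt N" "prv N"]) auto

lemma uminus_in_ring [simp]: "- j \<in> ring_sites N \<longleftrightarrow> j \<in> ring_sites N"
  by (auto simp: ring_sites_def)

lemma nxt_uminus: "j \<in> ring_sites N \<Longrightarrow> nxt N (- j) = - prv N j"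
  by (simp add: nxt_eq prv_eq)

lemma prv_uminus: "j \<in> ring_sites N \<Longrightarrow> prv N (- j) = - nxt N j"
  by (simp add: nxt_eq prv_eq)

text \<open>
  The sign is that of a nonnegative operator: \<open>lap\<close> is minus the usual discrete Laplacian.
\<close>

definition lap :: "nat \<Rightarrow> (int \<Rightarrow> 'a::comm_ring_1) \<Rightarrow> int \<Rightarrow> 'a" where
  "lap N f j = 2 * f j - f (nxt N j) - f (prv N j)"

lemma sum_lap_symmetric:
  fixes f g :: "int \<Rightarrow> 'a::comm_ring_1"
  shows "(\<Sum>j\<in>ring_sites N. g j * lap N f j) = (\<Sum>j\<in>ring_sites N. lap N g j * f j)"
proof -
  have a: "(\<Sum>j\<in>ring_sites N. g j * f (nxt N j)) = (\<Sum>j\<in>ring_sites N. g (prv N j) * f j)"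
    using sum_nxt[of "\<lambda>j. g (prv N j) * f j" N] by simp
  have b: "(\<Sum>j\<in>ring_sites N. g j * f (prv N j)) = (\<Sum>j\<in>ring_sites N. g (nxt N j) * f j)"
    using sum_prv[of "\<lambda>j. g (nxt N j) * f j" N] by simp
  show ?thesis
    by (simp add: lap_def algebra_simps sum.distrib sum_subtractf a b)
qed

text \<open>
  Summation by parts: the Dirichlet form of the coupling is the quadratic form of the Laplacian.
\<close>

lemma sum_nxt_diff_product:
  fixes f g :: "int \<Rightarrow> 'a::comm_ring_1"
  shows "(\<Sum>j\<in>ring_sites N. (g (nxt N j) - g j) * (f (nxt N j) - f j))
       = (\<Sum>j\<in>ring_sites N. g j * lap N f j)"
proof -
  have a: "(\<Sum>j\<in>ring_sites N. g (nxt N j) * f (nxt N j)) = (\<Sum>j\<in>ring_sites N. g j * f j)"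
    by (rule sum_nxt)
  have b: "(\<Sum>j\<in>ring_sites N. g (nxt N j) * f j) = (\<Sum>j\<in>ring_sites N. g j * f (prv N j))"
    using sum_nxt[of "\<lambda>j. g j * f (prv N j)" N] by simp
  have c: "g j * (2 * f j) = g j * f j + g j * f j" for j by (simp add: algebra_simps)
  show ?thesis
    unfolding lap_def left_diff_distrib right_diff_distrib sum_subtractf a b c sum.distrib
    by (simp add: algebra_simps)
qed

section \<open>The exponential of a matrix and its spectrum\<close>

text \<open>
  The exponential series of \<open>t A\<close>, taken entry by entry. The coefficients are embedded from the
  reals so that the definition serves a real matrix and its complexification alike.
\<close>

definition mat_exp :: "'a::{real_normed_field,banach} mat \<Rightarrow> real \<Rightarrow> 'a mat" where
  "mat_exp A t = Matrix.mat (dim_row A) (dim_row A)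
     (\<lambda>(i, k). \<Sum>m. of_real (t ^ m / fact m) * (A ^\<^sub>m m) $$ (i, k))"

lemma mat_exp_carrier [simp]: "A \<in> carrier_mat d d \<Longrightarrow> mat_exp A t \<in> carrier_mat d d"
  by (auto simp: mat_exp_def)

lemma index_mult_sum:
  fixes A B :: "'a::comm_ring_1 mat"
  assumes "A \<in> carrier_mat d d" "B \<in> carrier_mat d d" "i < d" "k < d"
  shows "(A * B) $$ (i, k) = (\<Sum>l<d. A $$ (i, l) * B $$ (l, k))"
  using assms by (simp add: scalar_prod_def atLeast0LessThan)

lemma pow_mat_Suc_left:
  fixes A :: "'a::comm_ring_1 mat"
  assumes A: "A \<in> carrier_mat d d"
  shows "A ^\<^sub>m Suc m = A * A ^\<^sub>m m"
proof (induction m)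
  case 0 then show ?case using A by simp
next
  case (Suc m)
  have "A ^\<^sub>m Suc (Suc m) = (A * A ^\<^sub>m m) * A" using Suc by simp
  also have "\<dots> = A * (A ^\<^sub>m m * A)" using A by (intro assoc_mult_mat[of _ d d _ d _ d]) auto
  finally show ?case by simp
qed

text \<open>
  The sum of the norms of all entries dominates each row sum, so its powers dominate the entries
  of the powers.
\<close>

lemma pow_mat_entry_bound:
  fixes A :: "'a::{real_normed_field,banach} mat"
  assumes A: "A \<in> carrier_mat d d" and "i < d" "k < d"
  shows "norm ((A ^\<^sub>m m) $$ (i, k)) \<le> (\<Sum>l<d. \<Sum>p<d. norm (A $$ (l, p))) ^ m"
  using assms(2,3)
proof (induction m arbitrary: k)
  case 0 then show ?case using A by simp
next
  case (Suc m)
  let ?K = "\<Sum>l<d. \<Sum>p<d. norm (A $$ (l, p))"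
  have "(A ^\<^sub>m Suc m) $$ (i, k) = (\<Sum>l<d. (A ^\<^sub>m m) $$ (i, l) * A $$ (l, k))"
    using A Suc.prems by (simp add: index_mult_sum del: index_mult_mat)
  also have "norm \<dots> \<le> (\<Sum>l<d. norm ((A ^\<^sub>m m) $$ (i, l)) * norm (A $$ (l, k)))"
    by (rule sum_norm_le) (simp add: norm_mult)
  also have "\<dots> \<le> (\<Sum>l<d. ?K ^ m * (\<Sum>p<d. norm (A $$ (l, p))))"
  proof (intro sum_mono mult_mono)
    fix l assume l: "l \<in> {..<d}"
    show "norm ((A ^\<^sub>m m) $$ (i, l)) \<le> ?K ^ m" using Suc l by auto
    show "norm (A $$ (l, k)) \<le> (\<Sum>p<d. norm (A $$ (l, p)))"
      using Suc.prems by (intro member_le_sum) auto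
  qed (auto intro!: zero_le_power sum_nonneg)
  also have "\<dots> = ?K ^ Suc m" by (simp only: sum_distrib_left[symmetric] power_Suc2)
  finally show ?case .
qed

lemma mat_exp_sums:
  fixes A :: "'a::{real_normed_field,banach} mat"
  assumes A: "A \<in> carrier_mat d d" and ik: "i < d" "k < d"
  shows "(\<lambda>m. of_real (t ^ m / fact m) * (A ^\<^sub>m m) $$ (i, k)) sums (mat_exp A t $$ (i, k))"
proof -
  let ?K = "\<Sum>l<d. \<Sum>p<d. norm (A $$ (l, p))"
  have "summable (\<lambda>m. of_real (t ^ m / fact m) * (A ^\<^sub>m m) $$ (i, k))"
  proof (rule summable_comparison_test')
    show "summable (\<lambda>m. inverse (fact m) * (\<bar>t\<bar> * ?K) ^ m)" by (rule summable_exp)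
    fix m :: nat assume "m \<ge> 0"
    have "norm (of_real (t ^ m / fact m) * (A ^\<^sub>m m) $$ (i, k)) \<le> \<bar>t\<bar> ^ m / fact m * ?K ^ m"
      unfolding norm_mult norm_of_real using pow_mat_entry_bound[OF A ik, of m]
      by (intro mult_mono) (auto simp: power_abs)
    then show "norm (of_real (t ^ m / fact m) * (A ^\<^sub>m m) $$ (i, k)) \<le> inverse (fact m) * (\<bar>t\<bar> * ?K) ^ m"
      by (simp add: power_mult_distrib field_simps)
  qed
  then show ?thesis using A ik by (simp add: mat_exp_def summable_sums)
qed

lemma mat_exp_0:
  fixes A :: "'a::{real_normed_field,banach} mat"
  assumes A: "A \<in> carrier_mat d d"
  shows "mat_exp A 0 = 1\<^sub>m d"
proof (rule eq_matI)
  fix i k assume "i < dim_row (1\<^sub>m d :: 'a mat)" "k < dim_col (1\<^sub>m d :: 'a mat)"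
  then have ik: "i < d" "k < d" by auto
  have "(\<lambda>m. of_real (0 ^ m / fact m) * (A ^\<^sub>m m) $$ (i, k)) sums
        (\<Sum>m\<in>{0}. of_real (0 ^ m / fact m) * (A ^\<^sub>m m) $$ (i, k))"
    by (rule sums_finite) (auto simp: power_0_left)
  from sums_unique2[OF mat_exp_sums[OF A ik, of 0] this] show "mat_exp A 0 $$ (i, k) = 1\<^sub>m d $$ (i, k)"
    using A ik by simp
qed (use A in \<open>auto simp: mat_exp_def\<close>)

lemma mat_exp_derivative:
  fixes A :: "real mat"
  assumes A: "A \<in> carrier_mat d d" and ik: "i < d" "k < d"
  shows "((\<lambda>t. mat_exp A t $$ (i, k)) has_real_derivative (A * mat_exp A t) $$ (i, k)) (at t)"
proof -
  define c where "c l m = (A ^\<^sub>m m) $$ (l, k) / fact m" for l m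
  have sums: "(\<lambda>m. c l m * t ^ m) sums (mat_exp A t $$ (l, k))" if "l < d" for l t
    using mat_exp_sums[OF A that ik(2), of t] by (simp add: c_def field_simps)
  have "((\<lambda>t. \<Sum>m. c i m * t ^ m) has_field_derivative (\<Sum>m. diffs (c i) m * t ^ m)) (at t)"
    using sums[OF ik(1)] by (intro termdiffs_strong_converges_everywhere) (auto simp: sums_iff)
  moreover have "(\<lambda>t. \<Sum>m. c i m * t ^ m) = (\<lambda>t. mat_exp A t $$ (i, k))"
    using sums[OF ik(1)] by (simp add: sums_iff)
  moreover have "(\<Sum>m. diffs (c i) m * t ^ m) = (A * mat_exp A t) $$ (i, k)"
  proof -
    have "diffs (c i) m = (\<Sum>l<d. A $$ (i, l) * c l m)" for m
    proof -
      have "(A ^\<^sub>m Suc m) $$ (i, k) = (\<Sum>l<d. A $$ (i, l) * (A ^\<^sub>m m) $$ (l, k))"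
        unfolding pow_mat_Suc_left[OF A] using A ik by (simp add: index_mult_sum del: index_mult_mat)
      then show ?thesis
        by (simp add: diffs_def c_def sum_divide_distrib del: pow_mat.simps)
    qed
    then have "(\<lambda>m. diffs (c i) m * t ^ m) = (\<lambda>m. \<Sum>l<d. A $$ (i, l) * (c l m * t ^ m))"
      by (auto simp: sum_distrib_right mult.assoc)
    moreover have "(\<lambda>m. \<Sum>l<d. A $$ (i, l) * (c l m * t ^ m)) sums
        (\<Sum>l<d. A $$ (i, l) * mat_exp A t $$ (l, k))"
      by (intro sums_sum sums_mult sums) auto
    ultimately show ?thesis using A ik
      by (simp add: sums_iff index_mult_sum del: index_mult_mat)
  qed
  ultimately show ?thesis by simp
qed

lemma map_mat_mat_exp:
  assumes A: "A \<in> carrier_mat d d"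
  shows "map_mat complex_of_real (mat_exp A t) = mat_exp (map_mat complex_of_real A) t"
proof (rule eq_matI)
  let ?A = "map_mat complex_of_real A"
  have A': "?A \<in> carrier_mat d d" using A by simp
  fix i k assume "i < dim_row (mat_exp ?A t)" "k < dim_col (mat_exp ?A t)"
  then have ik: "i < d" "k < d" using A by (auto simp: mat_exp_def)
  have "(?A ^\<^sub>m m) $$ (i, k) = of_real ((A ^\<^sub>m m) $$ (i, k))" for m
    using A ik by (subst of_real_hom.mat_hom_pow[OF A, symmetric]) auto
  moreover have "(\<lambda>m. complex_of_real (of_real (t ^ m / fact m) * (A ^\<^sub>m m) $$ (i, k))) sums
      complex_of_real (mat_exp A t $$ (i, k))"
    by (rule sums_of_real[OF mat_exp_sums[OF A ik]])
  ultimately have "(\<lambda>m. of_real (t ^ m / fact m) * (?A ^\<^sub>m m) $$ (i, k)) sums of_real (mat_exp A t $$ (i, k))"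
    by simp
  from sums_unique2[OF this mat_exp_sums[OF A' ik]]
  show "map_mat complex_of_real (mat_exp A t) $$ (i, k) = mat_exp ?A t $$ (i, k)"
    using A ik by (simp add: mat_exp_def)
qed (use A in \<open>auto simp: mat_exp_def\<close>)

lemma mat_exp_similar:
  fixes A B :: "'a::{real_normed_field,banach} mat"
  assumes A: "A \<in> carrier_mat d d" and sim: "similar_mat_wit A B P Q"
  shows "similar_mat_wit (mat_exp A t) (mat_exp B t) P Q"
proof -
  note w = similar_mat_witD2[OF A sim]
  have ent: "(P * X * Q) $$ (i, k) = (\<Sum>q<d. \<Sum>p<d. P $$ (i, p) * X $$ (p, q) * Q $$ (q, k))"
    if "X \<in> carrier_mat d d" "i < d" "k < d" for X i k
  proof -
    have "(P * X * Q) $$ (i, k) = (\<Sum>q<d. (P * X) $$ (i, q) * Q $$ (q, k))"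
      using that w(6,7) by (intro index_mult_sum) auto
    also have "\<dots> = (\<Sum>q<d. (\<Sum>p<d. P $$ (i, p) * X $$ (p, q)) * Q $$ (q, k))"
      using that w(6) by (intro sum.cong refl arg_cong2[where f="(*)"] index_mult_sum) auto
    finally show ?thesis by (simp add: sum_distrib_right)
  qed
  have "mat_exp A t = P * mat_exp B t * Q"
  proof (rule eq_matI)
    fix i k assume "i < dim_row (P * mat_exp B t * Q)" "k < dim_col (P * mat_exp B t * Q)"
    then have ik: "i < d" "k < d" using w by auto
    have "(\<lambda>m. \<Sum>q<d. \<Sum>p<d. P $$ (i, p) * (of_real (t ^ m / fact m) * (B ^\<^sub>m m) $$ (p, q)) * Q $$ (q, k)) sums
        (\<Sum>q<d. \<Sum>p<d. P $$ (i, p) * mat_exp B t $$ (p, q) * Q $$ (q, k))"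
      by (intro sums_sum sums_mult sums_mult2 mat_exp_sums[OF w(5)]) auto
    moreover have "(\<Sum>q<d. \<Sum>p<d. P $$ (i, p) * (of_real (t ^ m / fact m) * (B ^\<^sub>m m) $$ (p, q)) * Q $$ (q, k))
       = of_real (t ^ m / fact m) * (A ^\<^sub>m m) $$ (i, k)" for m
      unfolding similar_mat_wit_pow_id[OF sim] using w ik
      by (subst ent) (auto simp: sum_distrib_left ac_simps)
    ultimately have "(\<lambda>m. of_real (t ^ m / fact m) * (A ^\<^sub>m m) $$ (i, k)) sums (P * mat_exp B t * Q) $$ (i, k)"
      using w ik by (subst ent) auto
    from sums_unique2[OF mat_exp_sums[OF A ik] this]
    show "mat_exp A t $$ (i, k) = (P * mat_exp B t * Q) $$ (i, k)" .
  qed (use w in \<open>auto simp: mat_exp_def\<close>)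
  then show ?thesis using w by (intro similar_mat_witI[of _ _ d]) auto
qed

lemma upper_triangular_pow:
  fixes B :: "'a::comm_ring_1 mat"
  assumes B: "B \<in> carrier_mat d d" and ut: "upper_triangular B"
  shows "i < d \<Longrightarrow> k \<le> i \<Longrightarrow> (B ^\<^sub>m m) $$ (i, k) = (if i = k then (B $$ (i, i)) ^ m else 0)"
proof (induction m arbitrary: k)
  case 0 then show ?case using B by auto
next
  case (Suc m)
  have "(B ^\<^sub>m Suc m) $$ (i, k) = (\<Sum>l<d. (B ^\<^sub>m m) $$ (i, l) * B $$ (l, k))"
    using B Suc.prems by (simp add: index_mult_sum del: index_mult_mat)
  also have "\<dots> = (\<Sum>l<d. if l = i then (if i = k then (B $$ (i, i)) ^ Suc m else 0) else 0)"
  proof (rule sum.cong)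
    fix l assume l: "l \<in> {..<d}"
    have z: "B $$ (p, q) = 0" if "q < p" "p < d" for p q
      using upper_triangularD[OF ut that(1)] that B by simp
    show "(B ^\<^sub>m m) $$ (i, l) * B $$ (l, k) = (if l = i then (if i = k then (B $$ (i, i)) ^ Suc m else 0) else 0)"
      using Suc.IH[of l] Suc.prems l z[of k l] by (cases l i rule: linorder_cases) auto
  qed simp
  finally show ?case using Suc.prems by simp
qed

lemma eigenvalue_upper_triangular:
  fixes B :: "'a::field mat"
  assumes B: "B \<in> carrier_mat d d" and ut: "upper_triangular B"
  shows "eigenvalue B x \<longleftrightarrow> (\<exists>i<d. x = B $$ (i, i))"
proof -
  have "poly (\<Prod>a\<leftarrow>as. [:- a, 1:]) x = 0 \<longleftrightarrow> x \<in> set as" for as :: "'a list"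
    by (induction as) auto
  then have "eigenvalue B x \<longleftrightarrow> x \<in> set (diag_mat B)"
    unfolding eigenvalue_root_char_poly[OF B] char_poly_upper_triangular[OF B ut] by blast
  then show ?thesis using B by (auto simp: diag_mat_def)
qed

text \<open>
  Spectral mapping. By Schur's theorem the matrix is similar to a triangular one; the exponential
  respects similarity and triangularity and acts on the diagonal entrywise. Both inclusions are used
  below: one for instability, the other for stability.
\<close>

theorem eigenvalue_mat_exp:
  fixes A :: "complex mat"
  assumes A: "A \<in> carrier_mat d d"
  shows "eigenvalue (mat_exp A t) \<mu> \<longleftrightarrow> (\<exists>x. eigenvalue A x \<and> \<mu> = exp (of_real t * x))"
proof -
  obtain es where "char_poly A = (\<Prod>a\<leftarrow>es. [:- a, 1:])" using char_poly_factorized[OF A] by blast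
  from schur_decomposition_exists[OF A this] obtain B where
    B: "B \<in> carrier_mat d d" "upper_triangular B" "similar_mat A B" by blast
  then obtain P Q where wit: "similar_mat_wit A B P Q" unfolding similar_mat_def by blast
  have E: "mat_exp B t $$ (i, i) = exp (of_real t * B $$ (i, i))" if "i < d" for i
  proof -
    have "(\<lambda>m. of_real (t ^ m / fact m) * (B ^\<^sub>m m) $$ (i, i)) sums exp (of_real t * B $$ (i, i))"
      using exp_converges[of "of_real t * B $$ (i, i)"] upper_triangular_pow[OF B(1,2) that, of i]
      by (simp add: scaleR_conv_of_real power_mult_distrib field_simps)
    then show ?thesis using sums_unique2[OF mat_exp_sums[OF B(1) that that]] by blast
  qed
  have ut: "upper_triangular (mat_exp B t)"
  proof
    fix i j assume ij: "j < i" "i < dim_row (mat_exp B t)"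
    then have d: "i < d" "j < d" using B by (auto simp: mat_exp_def)
    have "(\<lambda>m. of_real (t ^ m / fact m) * (B ^\<^sub>m m) $$ (i, j)) sums 0"
      using upper_triangular_pow[OF B(1,2) d(1), of j] ij by simp
    then show "mat_exp B t $$ (i, j) = 0"
      using sums_unique2[OF mat_exp_sums[OF B(1) d]] by blast
  qed
  have "similar_mat (mat_exp A t) (mat_exp B t)"
    using mat_exp_similar[OF A wit] unfolding similar_mat_def by blast
  then have "eigenvalue (mat_exp A t) \<mu> \<longleftrightarrow> eigenvalue (mat_exp B t) \<mu>"
    using eigenvalue_root_char_poly mat_exp_carrier[OF A] mat_exp_carrier[OF B(1)] char_poly_similar by metis
  moreover have "eigenvalue A x \<longleftrightarrow> eigenvalue B x" for x
    using eigenvalue_root_char_poly A B char_poly_similar by metis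
  ultimately show ?thesis
    using E by (auto simp: eigenvalue_upper_triangular[OF B(1,2)]
      eigenvalue_upper_triangular[OF mat_exp_carrier[OF B(1)] ut])
qed

section \<open>The equations of motion and their linearisation\<close>

text \<open>
  The right-hand side of the equations of motion, \<open>\<i> \<psi>' = dnls_field \<psi>\<close>, and its real-linear derivative.
\<close>

definition dnls_field :: "nat \<Rightarrow> real \<Rightarrow> (int \<Rightarrow> complex) \<Rightarrow> int \<Rightarrow> complex" where
  "dnls_field N \<epsilon> u j = u j + of_real (cmod (u j) ^ 2) * u j + of_real \<epsilon> * lap N u j"

definition dnls_field_deriv ::
    "nat \<Rightarrow> real \<Rightarrow> (int \<Rightarrow> complex) \<Rightarrow> (int \<Rightarrow> complex) \<Rightarrow> int \<Rightarrow> complex" where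
  "dnls_field_deriv N \<epsilon> u h j =
     h j + 2 * of_real (cmod (u j) ^ 2) * h j + (u j) ^ 2 * cnj (h j) + of_real \<epsilon> * lap N h j"

lemma lap_cong:
  assumes "j \<in> ring_sites N" "\<And>i. i \<in> ring_sites N \<Longrightarrow> f i = g i"
  shows "lap N f j = lap N g j"
  using assms by (simp add: lap_def)

lemma dnls_field_cong:
  assumes "j \<in> ring_sites N" "\<And>i. i \<in> ring_sites N \<Longrightarrow> u i = v i"
  shows "dnls_field N \<epsilon> u j = dnls_field N \<epsilon> v j"
  using assms lap_cong[OF assms] by (simp add: dnls_field_def)

lemma dnls_field_deriv_cong:
  assumes "j \<in> ring_sites N" "\<And>i. i \<in> ring_sites N \<Longrightarrow> u i = v i"
    "\<And>i. i \<in> ring_sites N \<Longrightarrow> h i = g i"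
  shows "dnls_field_deriv N \<epsilon> u h j = dnls_field_deriv N \<epsilon> v g j"
  using assms lap_cong[OF assms(1,3)] by (simp add: dnls_field_deriv_def)

lemma dnls_hamiltonian_cong:
  assumes "\<And>i. i \<in> ring_sites N \<Longrightarrow> u i = v i"
  shows "dnls_hamiltonian N \<epsilon> u = dnls_hamiltonian N \<epsilon> v"
  unfolding dnls_hamiltonian_def using assms by (auto intro!: arg_cong2[where f="(+)"] sum.cong)

lemma cmod_sq_line:
  "((\<lambda>s. cmod (a + of_real s * b) ^ 2) has_real_derivative 2 * Re (cnj b * a)) (at 0)"
  unfolding cmod_power2 by (auto intro!: derivative_eq_intros)

text \<open>
  The field is the gradient of the Hamiltonian. The Wirtinger derivatives and the first partial
  derivatives in canonical coordinates are both instances of this directional derivative.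
\<close>

lemma dnls_hamiltonian_line:
  "((\<lambda>s. dnls_hamiltonian N \<epsilon> (\<lambda>j. u j + of_real s * h j)) has_real_derivative
     (\<Sum>j\<in>ring_sites N. 2 * Re (cnj (h j) * dnls_field N \<epsilon> u j))) (at 0)"
proof -
  have d4: "((\<lambda>s. cmod (u j + of_real s * h j) ^ 4) has_real_derivative
      4 * cmod (u j) ^ 2 * Re (cnj (h j) * u j)) (at 0)" for j
    using DERIV_power[OF cmod_sq_line[of "u j" "h j"], of 2] by (simp add: algebra_simps)
  have d2: "((\<lambda>s. cmod ((u (nxt N j) + of_real s * h (nxt N j)) - (u j + of_real s * h j)) ^ 2)
      has_real_derivative 2 * Re (cnj (h (nxt N j) - h j) * (u (nxt N j) - u j))) (at 0)" for j
    using cmod_sq_line[of "u (nxt N j) - u j" "h (nxt N j) - h j"] by (simp add: algebra_simps)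
  have "((\<lambda>s. dnls_hamiltonian N \<epsilon> (\<lambda>j. u j + of_real s * h j)) has_real_derivative
     (\<Sum>j\<in>ring_sites N. 2 * Re (cnj (h j) * u j))
     + 1 / 2 * (\<Sum>j\<in>ring_sites N. 4 * cmod (u j) ^ 2 * Re (cnj (h j) * u j))
     + \<epsilon> * (\<Sum>j\<in>ring_sites N. 2 * Re (cnj (h (nxt N j) - h j) * (u (nxt N j) - u j)))) (at 0)"
    unfolding dnls_hamiltonian_def nxt_def[symmetric]
    by (intro DERIV_add DERIV_cmult DERIV_sum cmod_sq_line d4 d2)
  moreover have "(\<Sum>j\<in>ring_sites N. 2 * Re (cnj (h (nxt N j) - h j) * (u (nxt N j) - u j)))
      = (\<Sum>j\<in>ring_sites N. 2 * Re (cnj (h j) * lap N u j))"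
    using arg_cong[OF sum_nxt_diff_product[of "\<lambda>j. cnj (h j)" N u], of "\<lambda>z. 2 * Re z"]
    by (simp add: sum_distrib_left del: times_complex.simps)
  moreover have "2 * Re (cnj (h j) * dnls_field N \<epsilon> u j) = 2 * Re (cnj (h j) * u j)
      + 1 / 2 * (4 * cmod (u j) ^ 2 * Re (cnj (h j) * u j)) + \<epsilon> * (2 * Re (cnj (h j) * lap N u j))" for j
    by (simp add: dnls_field_def algebra_simps del: Re_divide)
  ultimately show ?thesis by (simp only: sum.distrib sum_distrib_left)
qed

lemma wirtinger_cnj_hamiltonian:
  assumes "j \<in> ring_sites N"
  shows "wirtinger_cnj (dnls_hamiltonian N \<epsilon>) u j = dnls_field N \<epsilon> u j"
proof -
  have d: "deriv (\<lambda>s. dnls_hamiltonian N \<epsilon> (u(j := u j + c * of_real s))) 0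
      = 2 * Re (cnj c * dnls_field N \<epsilon> u j)" for c
  proof -
    have eq: "u(j := u j + c * of_real s) = (\<lambda>k. u k + of_real s * (if k = j then c else 0))" for s
      by auto
    have "(\<Sum>k\<in>ring_sites N. 2 * Re (cnj (if k = j then c else 0) * dnls_field N \<epsilon> u k))
        = (\<Sum>k\<in>ring_sites N. if k = j then 2 * Re (cnj c * dnls_field N \<epsilon> u j) else 0)"
      by (intro sum.cong) auto
    then show ?thesis unfolding eq
      using DERIV_imp_deriv[OF dnls_hamiltonian_line[of N \<epsilon> u "\<lambda>k. if k = j then c else 0"]] assms
      by simp
  qed
  show ?thesis
    unfolding wirtinger_cnj_def using d[of 1] d[of \<i>] by (simp add: complex_eq_iff)
qed

lemma dnls_solution_iff:
  "dnls_solution N \<epsilon> \<psi> \<longleftrightarrow>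
     (\<forall>t. \<forall>j\<in>ring_sites N.
        ((\<lambda>s. \<psi> s j) has_vector_derivative - \<i> * dnls_field N \<epsilon> (\<psi> t) j) (at t))"
proof -
  have "\<i> * D = w \<longleftrightarrow> D = - \<i> * w" for D w :: complex
    by (auto simp: complex_eq_iff)
  then show ?thesis by (simp add: dnls_solution_def wirtinger_cnj_hamiltonian)
qed

lemma has_vector_derivative_field:
  assumes "\<And>i. i \<in> ring_sites N \<Longrightarrow> ((\<lambda>s. u s i) has_vector_derivative h i) (at t)" "j \<in> ring_sites N"
  shows "((\<lambda>s. dnls_field N \<epsilon> (u s) j) has_vector_derivative dnls_field_deriv N \<epsilon> (u t) h j) (at t)"
proof -
  have sq: "of_real (cmod z ^ 2) * z = z * cnj z * z" for z by (simp only: complex_norm_square)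
  note d = assms(1)[OF assms(2)]
  have c: "((\<lambda>s. cnj (u s j)) has_vector_derivative cnj (h j)) (at t)"
    using d by (rule has_vector_derivative_cnj)
  have e1: "((\<lambda>s. u s j * cnj (u s j)) has_vector_derivative (u t j * cnj (h j) + h j * cnj (u t j))) (at t)"
    by (rule has_vector_derivative_mult[OF d c])
  have e2: "((\<lambda>s. u s j * cnj (u s j) * u s j) has_vector_derivative
     (u t j * cnj (u t j) * h j + (u t j * cnj (h j) + h j * cnj (u t j)) * u t j)) (at t)"
    by (rule has_vector_derivative_mult[OF e1 d])
  have e3: "((\<lambda>s. of_real \<epsilon> * (2 * u s j - u s (nxt N j) - u s (prv N j))) has_vector_derivative
     of_real \<epsilon> * (2 * h j - h (nxt N j) - h (prv N j))) (at t)"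
    by (intro has_vector_derivative_mult_right has_vector_derivative_diff d assms(1)) auto
  show ?thesis
    unfolding dnls_field_def lap_def sq
    by (rule has_vector_derivative_eq_rhs[OF has_vector_derivative_add[OF has_vector_derivative_add[OF d e2] e3]])
      (unfold dnls_field_deriv_def lap_def complex_norm_square, simp add: power2_eq_square algebra_simps)
qed

section \<open>The Hessian in canonical coordinates\<close>

text \<open>
  The k-th canonical coordinate is \<open>sqrt 2\<close> times the component of the configuration at the
  site \<open>coord_site N k\<close> in the direction \<open>coord_dir N k\<close>.
\<close>

definition coord_site :: "nat \<Rightarrow> nat \<Rightarrow> int" where
  "coord_site N k = int (if k < 2 * N + 1 then k else k - (2 * N + 1)) - int N"

definition coord_dir :: "nat \<Rightarrow> nat \<Rightarrow> complex" where
  "coord_dir N k = (if k < 2 * N + 1 then 1 else \<i>)"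

text \<open>
  A constant rather than an abbreviation, so that simplification does not rewrite the numeral
  expression and lose the carrier facts.
\<close>

definition phase_dim :: "nat \<Rightarrow> nat" where "phase_dim N = 2 * (2 * N + 1)"

lemma coord_site_in_ring: "k < phase_dim N \<Longrightarrow> coord_site N k \<in> ring_sites N"
  by (auto simp: coord_site_def ring_sites_def phase_dim_def)

lemma dim_real_coords [simp]: "dim_vec (real_coords N u) = phase_dim N"
  by (simp add: real_coords_def Let_def phase_dim_def)

lemma real_coords_carrier [simp]: "real_coords N u \<in> carrier_vec (phase_dim N)"
  by (rule carrier_vecI) simp

lemma real_coords_index:
  "k < phase_dim N \<Longrightarrow> real_coords N u $ k = sqrt 2 * Re (cnj (coord_dir N k) * u (coord_site N k))"
  by (auto simp: real_coords_def Let_def coord_dir_def coord_site_def phase_dim_def)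

lemma real_coords_cong:
  assumes "\<And>j. j \<in> ring_sites N \<Longrightarrow> u j = v j"
  shows "real_coords N u = real_coords N v"
  by (rule eq_vecI) (use assms in \<open>auto simp: real_coords_index coord_site_in_ring\<close>)

lemma of_real_coords_real_coords [simp]:
  "j \<in> ring_sites N \<Longrightarrow> of_real_coords N (real_coords N u) j = u j"
  by (auto simp: of_real_coords_def real_coords_def Let_def ring_sites_def complex_eq_iff)

lemma real_coords_of_real_coords [simp]:
  assumes "z \<in> carrier_vec (phase_dim N)"
  shows "real_coords N (of_real_coords N z) = z"
proof (rule eq_vecI)
  fix i assume "i < dim_vec z"
  then have i: "i < phase_dim N" using assms by simp
  show "real_coords N (of_real_coords N z) $ i = z $ i"
  proof (cases "i < 2 * N + 1")
    case True
    then show ?thesis using i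
      by (simp add: real_coords_def of_real_coords_def Let_def phase_dim_def)
  next
    case False
    define k where "k = i - (2 * N + 1)"
    have ik: "i = 2 * N + 1 + k" using False by (simp add: k_def)
    show ?thesis using i unfolding ik
      by (simp add: real_coords_def of_real_coords_def Let_def phase_dim_def)
  qed
qed (use assms in simp)

lemma of_real_coords_line:
  assumes "z \<in> carrier_vec (phase_dim N)" "w \<in> carrier_vec (phase_dim N)" "j \<in> ring_sites N"
  shows "of_real_coords N (z + s \<cdot>\<^sub>v w) j = of_real_coords N z j + of_real s * of_real_coords N w j"
proof -
  have "nat (j + int N) < 2 * N + 1" using assms(3) by (auto simp: ring_sites_def)
  then have "nat (j + int N) < phase_dim N" "2 * N + 1 + nat (j + int N) < phase_dim N"
    by (auto simp: phase_dim_def)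
  then show ?thesis using assms(1,2)
    by (simp add: of_real_coords_def Let_def complex_eq_iff add_divide_distrib)
qed

lemma of_real_coords_unit:
  assumes "k < phase_dim N" "j \<in> ring_sites N"
  shows "of_real_coords N (unit_vec (phase_dim N) k) j
    = (if j = coord_site N k then coord_dir N k / of_real (sqrt 2) else 0)"
proof -
  have a: "nat (j + int N) < 2 * N + 1" using assms(2) by (auto simp: ring_sites_def)
  then have b: "nat (j + int N) < phase_dim N" "2 * N + 1 + nat (j + int N) < phase_dim N"
    by (auto simp: phase_dim_def)
  show ?thesis
    unfolding of_real_coords_def Let_def coord_site_def coord_dir_def
      index_unit_vec(1)[OF assms(1) b(1)] index_unit_vec(1)[OF assms(1) b(2)]
    using assms a by (auto simp: ring_sites_def complex_eq_iff phase_dim_def)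
qed

lemma sum_coords:
  fixes f :: "nat \<Rightarrow> 'a::comm_monoid_add"
  shows "(\<Sum>k<phase_dim N. f k)
    = (\<Sum>j\<in>ring_sites N. f (nat (j + int N)) + f (2 * N + 1 + nat (j + int N)))"
proof -
  have split: "(\<Sum>k<m + n. g k) = (\<Sum>k<m. g k) + (\<Sum>k<n. g (m + k))" for m n and g :: "nat \<Rightarrow> 'a"
    by (induction n) (auto simp: algebra_simps)
  have "(\<Sum>k<phase_dim N. f k) = (\<Sum>k<2 * N + 1. f k + f (2 * N + 1 + k))"
    using split[of f "2 * N + 1" "2 * N + 1"] by (simp add: sum.distrib mult_2 phase_dim_def)
  also have "\<dots> = (\<Sum>j\<in>ring_sites N. f (nat (j + int N)) + f (2 * N + 1 + nat (j + int N)))"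
    by (rule sum.reindex_bij_witness[of _ "\<lambda>j. nat (j + int N)" "\<lambda>k. int k - int N"])
      (auto simp: ring_sites_def)
  finally show ?thesis .
qed

lemma real_coords_at_site:
  assumes "j \<in> ring_sites N"
  shows "real_coords N f $ nat (j + int N) = sqrt 2 * Re (f j)"
    "real_coords N f $ (2 * N + 1 + nat (j + int N)) = sqrt 2 * Im (f j)"
proof -
  have p: "nat (j + int N) < 2 * N + 1" "int (nat (j + int N)) - int N = j"
    using assms by (auto simp: ring_sites_def)
  show "real_coords N f $ nat (j + int N) = sqrt 2 * Re (f j)"
    "real_coords N f $ (2 * N + 1 + nat (j + int N)) = sqrt 2 * Im (f j)"
    using p by (simp_all add: real_coords_def Let_def)
qed

lemma sum_real_coords:
  "(\<Sum>k<phase_dim N. real_coords N f $ k * real_coords N g $ k)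
    = 2 * (\<Sum>j\<in>ring_sites N. Re (cnj (f j) * g j))"
  unfolding sum_coords sum_distrib_left
proof (rule sum.cong[OF refl])
  fix j assume j: "j \<in> ring_sites N"
  have r: "sqrt 2 * a * (sqrt 2 * b) = 2 * (a * b)" for a b :: real
  proof -
    have "sqrt 2 * a * (sqrt 2 * b) = (sqrt 2 * sqrt 2) * (a * b)" by (simp only: ac_simps)
    then show ?thesis by simp
  qed
  show "real_coords N f $ nat (j + int N) * real_coords N g $ nat (j + int N)
      + real_coords N f $ (2 * N + 1 + nat (j + int N)) * real_coords N g $ (2 * N + 1 + nat (j + int N))
      = 2 * Re (cnj (f j) * g j)"
    unfolding real_coords_at_site[OF j] r by simp
qed

text \<open>
  Symmetry of second derivatives. It is needed because the columns of the Hessian, not its rows,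
  are read off from the derivative of the field.
\<close>

lemma dnls_field_deriv_symmetric:
  "(\<Sum>j\<in>ring_sites N. Re (cnj (dnls_field_deriv N \<epsilon> u h j) * g j))
    = (\<Sum>j\<in>ring_sites N. Re (cnj (h j) * dnls_field_deriv N \<epsilon> u g j))"
proof -
  have lapc: "cnj (lap N h j) = lap N (\<lambda>j. cnj (h j)) j" for j by (simp add: lap_def)
  have "Re (\<Sum>j\<in>ring_sites N. cnj (lap N h j) * g j) = Re (\<Sum>j\<in>ring_sites N. cnj (h j) * lap N g j)"
    unfolding lapc by (simp only: sum_lap_symmetric)
  then have l: "(\<Sum>j\<in>ring_sites N. \<epsilon> * Re (cnj (lap N h j) * g j))
      = (\<Sum>j\<in>ring_sites N. \<epsilon> * Re (cnj (h j) * lap N g j))"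
    by (simp only: Re_sum sum_distrib_left[symmetric])
  have e1: "Re (cnj (dnls_field_deriv N \<epsilon> u h j) * g j)
     = Re (cnj (h j) * g j) * (1 + 2 * cmod (u j) ^ 2) + Re (cnj (u j) ^ 2 * h j * g j)
       + \<epsilon> * Re (cnj (lap N h j) * g j)" for j
    by (simp add: dnls_field_deriv_def algebra_simps power2_eq_square)
  have e2: "Re (cnj (h j) * dnls_field_deriv N \<epsilon> u g j)
     = Re (cnj (h j) * g j) * (1 + 2 * cmod (u j) ^ 2) + Re (cnj (u j) ^ 2 * h j * g j)
       + \<epsilon> * Re (cnj (h j) * lap N g j)" for j
    by (simp add: dnls_field_deriv_def algebra_simps power2_eq_square)
  show ?thesis unfolding e1 e2 sum.distrib l ..
qed

abbreviation (input) hamiltonian_coords :: "nat \<Rightarrow> real \<Rightarrow> real vec \<Rightarrow> real" where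
  "hamiltonian_coords N \<epsilon> \<equiv> \<lambda>z. dnls_hamiltonian N \<epsilon> (of_real_coords N z)"

lemma partial_deriv_hamiltonian:
  assumes z: "z \<in> carrier_vec (phase_dim N)" and k: "k < phase_dim N"
  shows "partial_deriv k (hamiltonian_coords N \<epsilon>) z
    = real_coords N (dnls_field N \<epsilon> (of_real_coords N z)) $ k"
proof -
  let ?e = "unit_vec (phase_dim N) k :: real vec"
  let ?u = "of_real_coords N z" and ?h = "of_real_coords N ?e"
  have "(\<lambda>s. hamiltonian_coords N \<epsilon> (z + s \<cdot>\<^sub>v ?e))
      = (\<lambda>s. dnls_hamiltonian N \<epsilon> (\<lambda>j. ?u j + of_real s * ?h j))"
    by (intro ext dnls_hamiltonian_cong of_real_coords_line z) auto
  then have "partial_deriv k (hamiltonian_coords N \<epsilon>) z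
      = (\<Sum>j\<in>ring_sites N. 2 * Re (cnj (?h j) * dnls_field N \<epsilon> ?u j))"
    using DERIV_imp_deriv[OF dnls_hamiltonian_line[of N \<epsilon> ?u ?h]] z
    by (simp add: partial_deriv_def)
  also have "\<dots> = (\<Sum>j\<in>ring_sites N. if j = coord_site N k then
      2 * Re (cnj (coord_dir N k / of_real (sqrt 2)) * dnls_field N \<epsilon> ?u (coord_site N k)) else 0)"
    by (intro sum.cong) (simp_all only: of_real_coords_unit[OF k] if_True if_False complex_cnj_zero
        mult_zero_left zero_complex.sel mult_zero_right split: if_split, simp_all)
  also have "\<dots> = real_coords N (dnls_field N \<epsilon> ?u) $ k"
  proof -
    have "2 * Re (cnj (coord_dir N k / of_real (sqrt 2)) * x) = sqrt 2 * Re (cnj (coord_dir N k) * x)" for x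
    proof -
      have "cnj (coord_dir N k / of_real (sqrt 2)) * x = (cnj (coord_dir N k) * x) / of_real (sqrt 2)" by simp
      then have "2 * Re (cnj (coord_dir N k / of_real (sqrt 2)) * x) = (2 / sqrt 2) * Re (cnj (coord_dir N k) * x)"
        by (simp only: Re_divide_of_real times_divide_eq_left times_divide_eq_right)
      then show ?thesis by (simp only: real_div_sqrt[of 2, simplified])
    qed
    then show ?thesis
      using coord_site_in_ring[OF k] by (simp only: real_coords_index[OF k] sum.delta finite_ring if_True)
  qed
  finally show ?thesis .
qed

lemma hessian_hamiltonian:
  assumes i: "i < phase_dim N" and k: "k < phase_dim N"
  shows "hessian_mat (hamiltonian_coords N \<epsilon>) (real_coords N u) $$ (i, k)
    = real_coords N (dnls_field_deriv N \<epsilon> u (of_real_coords N (unit_vec (phase_dim N) i))) $ k"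
proof -
  let ?e = "unit_vec (phase_dim N) i :: real vec"
  let ?z = "real_coords N u" and ?h = "of_real_coords N ?e"
  have ring: "coord_site N k \<in> ring_sites N" by (rule coord_site_in_ring[OF k])
  have eq: "partial_deriv k (hamiltonian_coords N \<epsilon>) (?z + s \<cdot>\<^sub>v ?e)
      = sqrt 2 * Re (cnj (coord_dir N k) * dnls_field N \<epsilon> (\<lambda>j. u j + of_real s * ?h j) (coord_site N k))" for s
  proof -
    have "dnls_field N \<epsilon> (of_real_coords N (?z + s \<cdot>\<^sub>v ?e)) (coord_site N k)
        = dnls_field N \<epsilon> (\<lambda>j. u j + of_real s * ?h j) (coord_site N k)"
      by (intro dnls_field_cong ring) (subst of_real_coords_line, auto)
    then show ?thesis
      by (subst partial_deriv_hamiltonian) (auto simp: k real_coords_index)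
  qed
  have d: "((\<lambda>s. dnls_field N \<epsilon> (\<lambda>j. u j + of_real s * ?h j) (coord_site N k)) has_vector_derivative
      dnls_field_deriv N \<epsilon> (\<lambda>j. u j + of_real 0 * ?h j) ?h (coord_site N k)) (at 0)"
    by (rule has_vector_derivative_field[OF _ ring])
      (auto intro!: derivative_eq_intros simp: has_vector_derivative_def scaleR_conv_of_real)
  have "((\<lambda>s. sqrt 2 * Re (cnj (coord_dir N k) * dnls_field N \<epsilon> (\<lambda>j. u j + of_real s * ?h j) (coord_site N k)))
      has_real_derivative
      sqrt 2 * Re (cnj (coord_dir N k) * dnls_field_deriv N \<epsilon> (\<lambda>j. u j + of_real 0 * ?h j) ?h (coord_site N k))) (at 0)"
    by (intro DERIV_cmult has_field_derivative_Re has_vector_derivative_mult_right d)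
  from DERIV_imp_deriv[OF this] show ?thesis
    unfolding hessian_mat_def using i k
    by (simp add: partial_deriv_def[of i] eq real_coords_index)
qed

lemma symplectic_mat_index:
  assumes "i < 2 * n" "k < 2 * n"
  shows "symplectic_mat n $$ (i, k) = (if i < n then (if k = i + n then 1 else 0)
      else (if k = i - n then - 1 else 0))"
proof -
  have J: "symplectic_mat n $$ (i, k) = (if i < n then if k < n then 0 else (1\<^sub>m n :: real mat) $$ (i, k - n)
      else if k < n then (- 1\<^sub>m n :: real mat) $$ (i - n, k) else 0)"
    using assms unfolding symplectic_mat_def by (subst index_mat_four_block) auto
  show ?thesis
    using assms unfolding J
    by (cases "i < n"; cases "k < n") (auto simp del: One_nat_def)
qed

lemma symplectic_mat_carrier [simp]:
  "symplectic_mat (2 * N + 1) \<in> carrier_mat (phase_dim N) (phase_dim N)"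
  by (rule carrier_matI) (simp_all add: symplectic_mat_def phase_dim_def)

lemma symplectic_mat_action:
  "symplectic_mat (2 * N + 1) *\<^sub>v real_coords N g = real_coords N (\<lambda>j. - \<i> * g j)"
proof (rule eq_vecI)
  define n where "n = 2 * N + 1"
  have d: "phase_dim N = 2 * n" by (simp add: phase_dim_def n_def)
  have J: "symplectic_mat n \<in> carrier_mat (2 * n) (2 * n)"
    using symplectic_mat_carrier[of N] unfolding d n_def[symmetric] .
  fix i assume "i < dim_vec (real_coords N (\<lambda>j. - \<i> * g j))"
  then have i: "i < 2 * n" by (simp add: d)
  have "(symplectic_mat n *\<^sub>v real_coords N g) $ i
      = (\<Sum>k<2 * n. symplectic_mat n $$ (i, k) * real_coords N g $ k)"
    using i carrier_matD[OF J] by (simp add: scalar_prod_def atLeast0LessThan d)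
  also have "\<dots> = (\<Sum>k<2 * n. if k = (if i < n then i + n else i - n)
      then (if i < n then 1 else - 1) * real_coords N g $ k else 0)"
    by (rule sum.cong) (auto simp: symplectic_mat_index[OF i])
  also have "\<dots> = real_coords N (\<lambda>j. - \<i> * g j) $ i"
    using i d by (auto simp: real_coords_index coord_dir_def coord_site_def n_def[symmetric] simp del: One_nat_def)
  finally show "(symplectic_mat (2 * N + 1) *\<^sub>v real_coords N g) $ i = real_coords N (\<lambda>j. - \<i> * g j) $ i"
    unfolding n_def .
qed (use carrier_matD[OF symplectic_mat_carrier[of N]] in simp)

lemma hessian_action:
  assumes w: "w \<in> carrier_vec (phase_dim N)"
  shows "hessian_mat (hamiltonian_coords N \<epsilon>) (real_coords N u) *\<^sub>v w
    = real_coords N (dnls_field_deriv N \<epsilon> u (of_real_coords N w))"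
proof (rule eq_vecI)
  let ?H = "hessian_mat (hamiltonian_coords N \<epsilon>) (real_coords N u)"
  fix i assume "i < dim_vec (real_coords N (dnls_field_deriv N \<epsilon> u (of_real_coords N w)))"
  then have i: "i < phase_dim N" by simp
  let ?e = "unit_vec (phase_dim N) i :: real vec"
  let ?h = "of_real_coords N ?e" and ?g = "of_real_coords N w"
  have "(?H *\<^sub>v w) $ i = (\<Sum>k<phase_dim N. ?H $$ (i, k) * w $ k)"
    using i w by (simp add: scalar_prod_def atLeast0LessThan hessian_mat_def)
  also have "\<dots> = (\<Sum>k<phase_dim N. real_coords N (dnls_field_deriv N \<epsilon> u ?h) $ k * real_coords N ?g $ k)"
    using w by (intro sum.cong) (auto simp: hessian_hamiltonian[OF i])
  also have "\<dots> = (\<Sum>k<phase_dim N. real_coords N ?h $ k * real_coords N (dnls_field_deriv N \<epsilon> u ?g) $ k)"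
    by (simp only: sum_real_coords dnls_field_deriv_symmetric)
  also have "\<dots> = (\<Sum>k<phase_dim N. if k = i then real_coords N (dnls_field_deriv N \<epsilon> u ?g) $ i else 0)"
    using i by (intro sum.cong) auto
  finally show "(?H *\<^sub>v w) $ i = real_coords N (dnls_field_deriv N \<epsilon> u ?g) $ i" using i by simp
qed (simp add: hessian_mat_def)

lemma variational_mat_carrier [simp]:
  "variational_mat N \<epsilon> u \<in> carrier_mat (phase_dim N) (phase_dim N)"
  unfolding variational_mat_def
  by (rule mult_carrier_mat[OF symplectic_mat_carrier], rule carrier_matI) (simp_all add: hessian_mat_def)

text \<open>
  The variational matrix is the linearised vector field in real coordinates: multiplication by the
  symplectic matrix is multiplication by \<open>- \<i>\<close>.
\<close>

lemma variational_mat_action: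
  assumes w: "w \<in> carrier_vec (phase_dim N)"
  shows "variational_mat N \<epsilon> u *\<^sub>v w
    = real_coords N (\<lambda>j. - \<i> * dnls_field_deriv N \<epsilon> u (of_real_coords N w) j)"
proof -
  have "hessian_mat (hamiltonian_coords N \<epsilon>) (real_coords N u) \<in> carrier_mat (phase_dim N) (phase_dim N)"
    by (intro carrier_matI) (simp_all add: hessian_mat_def)
  from assoc_mult_mat_vec[OF symplectic_mat_carrier this w] show ?thesis
    unfolding variational_mat_def by (simp only: hessian_action[OF w] symplectic_mat_action)
qed

section \<open>The monodromy matrix of a rotating wave\<close>

text \<open>
  The generator of the variational equation at an equilibrium of the rotating frame: the change of
  frame adds \<open>\<i> \<omega>\<close>, that is minus \<open>\<omega>\<close> times the symplectic matrix.
\<close>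

definition rotating_mat :: "nat \<Rightarrow> real \<Rightarrow> real \<Rightarrow> (int \<Rightarrow> complex) \<Rightarrow> real mat" where
  "rotating_mat N \<epsilon> \<omega> \<phi> = variational_mat N \<epsilon> \<phi> - \<omega> \<cdot>\<^sub>m symplectic_mat (2 * N + 1)"

lemma rotating_mat_carrier [simp]: "rotating_mat N \<epsilon> \<omega> \<phi> \<in> carrier_mat (phase_dim N) (phase_dim N)"
  unfolding rotating_mat_def by (intro minus_carrier_mat smult_carrier_mat symplectic_mat_carrier)

lemma smult_mat_mult_vec:
  fixes c :: "'a::comm_ring_1"
  assumes "A \<in> carrier_mat m n" "v \<in> carrier_vec n"
  shows "(c \<cdot>\<^sub>m A) *\<^sub>v v = c \<cdot>\<^sub>v (A *\<^sub>v v)"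
  by (rule eq_vecI) (use assms in \<open>auto simp: scalar_prod_def sum_distrib_left mult.assoc\<close>)

lemma exp_rotation_derivative:
  fixes c :: complex
  shows "((\<lambda>s. exp (c * of_real (w * s))) has_vector_derivative c * of_real w * exp (c * of_real (w * t))) (at t)"
proof -
  have "((\<lambda>z. exp (c * (of_real w * z))) has_field_derivative
      c * of_real w * exp (c * (of_real w * of_real t))) (at (of_real t))"
    by (auto intro!: derivative_eq_intros)
  from has_vector_derivative_real_field[OF this] show ?thesis by simp
qed

lemma rotating_mat_action:
  assumes w: "w \<in> carrier_vec (phase_dim N)"
  shows "rotating_mat N \<epsilon> \<omega> \<phi> *\<^sub>v w = real_coords N
    (\<lambda>j. - \<i> * (dnls_field_deriv N \<epsilon> \<phi> (of_real_coords N w) j - of_real \<omega> * of_real_coords N w j))"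
proof -
  have "rotating_mat N \<epsilon> \<omega> \<phi> *\<^sub>v w
      = variational_mat N \<epsilon> \<phi> *\<^sub>v w - \<omega> \<cdot>\<^sub>v (symplectic_mat (2 * N + 1) *\<^sub>v real_coords N (of_real_coords N w))"
    unfolding rotating_mat_def real_coords_of_real_coords[OF w]
      minus_mult_distrib_mat_vec[OF variational_mat_carrier smult_carrier_mat[OF symplectic_mat_carrier] w]
      smult_mat_mult_vec[OF symplectic_mat_carrier w] ..
  also have "\<dots> = real_coords N
    (\<lambda>j. - \<i> * (dnls_field_deriv N \<epsilon> \<phi> (of_real_coords N w) j - of_real \<omega> * of_real_coords N w j))"
    unfolding variational_mat_action[OF w] symplectic_mat_action
    by (rule eq_vecI) (auto simp: real_coords_index algebra_simps)
  finally show ?thesis .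
qed

text \<open>
  Phase covariance. This is what makes the variational equation along a rotating wave autonomous.
\<close>

lemma dnls_field_deriv_rotate:
  assumes "cmod e = 1"
  shows "dnls_field_deriv N \<epsilon> (\<lambda>j. e * u j) (\<lambda>j. e * h j) j = e * dnls_field_deriv N \<epsilon> u h j"
proof -
  have "e * cnj e = 1" using assms complex_norm_square[of e] by simp
  then have "(e * u j)\<^sup>2 * cnj (e * h j) = e * ((u j)\<^sup>2 * cnj (h j))"
    by (simp add: power2_eq_square algebra_simps)
  then show ?thesis using assms
    by (simp add: dnls_field_deriv_def lap_def norm_mult algebra_simps)
qed

text \<open>
  The columns of the fundamental matrix are the columns of \<open>exp (t A)\<close>, rotated back into the
  original frame. After a period the rotation is the identity.
\<close>

theorem monodromy_rotating_wave:
  assumes \<psi>: "\<And>t j. j \<in> ring_sites N \<Longrightarrow> \<psi> t j = exp (- \<i> * of_real (\<omega> * t)) * \<phi> j"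
    and T: "exp (- \<i> * of_real (\<omega> * T)) = 1"
  shows "monodromy_mat N \<epsilon> T \<psi> (mat_exp (rotating_mat N \<epsilon> \<omega> \<phi>) T)"
proof -
  let ?d = "phase_dim N"
  define A where "A = rotating_mat N \<epsilon> \<omega> \<phi>"
  have A: "A \<in> carrier_mat ?d ?d" by (simp add: A_def)
  define e where "e t = exp (- \<i> * of_real (\<omega> * t))" for t
  have e1: "cmod (e t) = 1" for t by (simp add: e_def norm_exp_eq_Re)
  define c where "c t k = col (mat_exp A t) k" for t k
  have c: "c t k \<in> carrier_vec ?d" for t k
    unfolding c_def by (rule carrier_vecI) (use mat_exp_carrier[OF A, of t] in simp)
  define \<eta> where "\<eta> t k = of_real_coords N (c t k)" for t k
  define \<Phi> where "\<Phi> t = Matrix.mat ?d ?d (\<lambda>(i, k). real_coords N (\<lambda>j. e t * \<eta> t k j) $ i)" for t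
  have \<Phi>c: "\<Phi> t \<in> carrier_mat ?d ?d" for t by (simp add: \<Phi>_def)
  have \<Phi>_exp: "\<Phi> t = mat_exp A t" if "e t = 1" for t
  proof (rule eq_matI)
    fix i k assume "i < dim_row (mat_exp A t)" "k < dim_col (mat_exp A t)"
    then have ik: "i < ?d" "k < ?d" using A by (auto simp: mat_exp_def)
    then have "\<Phi> t $$ (i, k) = real_coords N (of_real_coords N (c t k)) $ i"
      by (simp add: \<Phi>_def that \<eta>_def)
    also have "\<dots> = mat_exp A t $$ (i, k)"
      unfolding real_coords_of_real_coords[OF c] using ik mat_exp_carrier[OF A, of t]
      by (simp add: c_def)
    finally show "\<Phi> t $$ (i, k) = mat_exp A t $$ (i, k)" .
  qed (use mat_exp_carrier[OF A, of t] \<Phi>c[of t] in auto)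
  have d\<eta>: "((\<lambda>s. \<eta> s k j) has_vector_derivative
      - \<i> * (dnls_field_deriv N \<epsilon> \<phi> (\<eta> t k) j - of_real \<omega> * \<eta> t k j)) (at t)"
    if k: "k < ?d" and j: "j \<in> ring_sites N" for k j t
  proof -
    let ?p = "nat (j + int N)"
    have p: "?p < ?d" "2 * N + 1 + ?p < ?d" using j by (auto simp: ring_sites_def phase_dim_def)
    have ent: "c s k $ i = mat_exp A s $$ (i, k)" if "i < ?d" for s i
      using that k mat_exp_carrier[OF A, of s] by (simp add: c_def)
    have Aent: "(A * mat_exp A t) $$ (i, k) = (A *\<^sub>v c t k) $ i" if "i < ?d" for i
      using that k carrier_matD[OF A] carrier_matD[OF mat_exp_carrier[OF A, of t]] by (simp add: c_def)
    have "((\<lambda>s. \<eta> s k j) has_vector_derivative of_real_coords N (A *\<^sub>v c t k) j) (at t)"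
      unfolding \<eta>_def of_real_coords_def Let_def ent[OF p(1)] ent[OF p(2)]
        Aent[OF p(1), symmetric] Aent[OF p(2), symmetric] Complex_eq
      by (intro has_vector_derivative_divide has_vector_derivative_add has_vector_derivative_mult_right
         has_vector_derivative_of_real mat_exp_derivative[OF A] p k)
    also have "of_real_coords N (A *\<^sub>v c t k) j
        = - \<i> * (dnls_field_deriv N \<epsilon> \<phi> (\<eta> t k) j - of_real \<omega> * \<eta> t k j)"
      unfolding A_def rotating_mat_action[OF c] \<eta>_def[symmetric] by (rule of_real_coords_real_coords[OF j])
    finally show ?thesis .
  qed
  have de: "(e has_vector_derivative - \<i> * of_real \<omega> * e t) (at t)" for t
    unfolding e_def by (rule exp_rotation_derivative)
  have "fundamental_mat N \<epsilon> \<psi> \<Phi>"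
    unfolding fundamental_mat_def Let_def phase_dim_def[symmetric]
  proof (intro conjI allI impI)
    show "\<Phi> 0 = 1\<^sub>m ?d" using \<Phi>_exp[of 0] mat_exp_0[OF A] by (simp add: e_def)
    fix t i k assume i: "i < ?d" and k: "k < ?d"
    have site: "coord_site N i \<in> ring_sites N" by (rule coord_site_in_ring[OF i])
    have col: "col (\<Phi> t) k = real_coords N (\<lambda>j. e t * \<eta> t k j)"
      by (rule eq_vecI) (use k in \<open>auto simp: \<Phi>_def\<close>)
    have "((\<lambda>s. e s * \<eta> s k (coord_site N i)) has_vector_derivative
       - \<i> * (e t * dnls_field_deriv N \<epsilon> \<phi> (\<eta> t k) (coord_site N i))) (at t)"
      by (rule has_vector_derivative_eq_rhs[OF has_vector_derivative_mult[OF de d\<eta>[OF k site]]])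
        (simp add: algebra_simps)
    then have "((\<lambda>s. sqrt 2 * Re (cnj (coord_dir N i) * (e s * \<eta> s k (coord_site N i)))) has_real_derivative
       sqrt 2 * Re (cnj (coord_dir N i) * (- \<i> * (e t * dnls_field_deriv N \<epsilon> \<phi> (\<eta> t k) (coord_site N i))))) (at t)"
      by (intro DERIV_cmult has_field_derivative_Re has_vector_derivative_mult_right)
    moreover have "(variational_mat N \<epsilon> (\<psi> t) * \<Phi> t) $$ (i, k)
       = sqrt 2 * Re (cnj (coord_dir N i) * (- \<i> * (e t * dnls_field_deriv N \<epsilon> \<phi> (\<eta> t k) (coord_site N i))))"
    proof -
      have "(variational_mat N \<epsilon> (\<psi> t) * \<Phi> t) $$ (i, k) = (variational_mat N \<epsilon> (\<psi> t) *\<^sub>v col (\<Phi> t) k) $ i"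
        using i k \<Phi>c[of t] carrier_matD[OF variational_mat_carrier[of N \<epsilon> "\<psi> t"]] by simp
      also have "\<dots> = sqrt 2 * Re (cnj (coord_dir N i) *
          (- \<i> * dnls_field_deriv N \<epsilon> (\<psi> t) (of_real_coords N (col (\<Phi> t) k)) (coord_site N i)))"
        unfolding col by (simp only: variational_mat_action[OF real_coords_carrier] real_coords_index[OF i])
      also have "dnls_field_deriv N \<epsilon> (\<psi> t) (of_real_coords N (col (\<Phi> t) k)) (coord_site N i)
          = dnls_field_deriv N \<epsilon> (\<lambda>j. e t * \<phi> j) (\<lambda>j. e t * \<eta> t k j) (coord_site N i)"
        unfolding col by (rule dnls_field_deriv_cong[OF site]) (auto simp: \<psi> e_def)
      finally show ?thesis unfolding dnls_field_deriv_rotate[OF e1] .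
    qed
    ultimately show "((\<lambda>s. \<Phi> s $$ (i, k)) has_real_derivative
        (variational_mat N \<epsilon> (\<psi> t) * \<Phi> t) $$ (i, k)) (at t)"
      using i k by (simp add: \<Phi>_def real_coords_index)
  qed (rule \<Phi>c)
  moreover have "\<Phi> T = mat_exp A T" using \<Phi>_exp[of T] T by (simp add: e_def)
  ultimately show ?thesis unfolding monodromy_mat_def A_def by metis
qed

section \<open>Periodic solutions near the orbit are rotating waves\<close>

lemma norm_increment_le:
  fixes f :: "real \<Rightarrow> complex"
  assumes f: "\<And>t. (f has_vector_derivative f' t) (at t)" and bound: "\<And>t. norm (f' t) \<le> C" and "h > 0"
  shows "norm (f (t + h) - f t) \<le> h * C"
proof -
  have d: "(f has_derivative (\<lambda>x. x *\<^sub>R f' s)) (at s)" for s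
    using f[of s] by (simp add: has_vector_derivative_def)
  have "continuous_on {t..t + h} f"
    using f by (meson continuous_at_imp_continuous_on has_vector_derivative_continuous)
  then obtain s where "norm (f (t + h) - f t) \<le> norm ((t + h - t) *\<^sub>R f' s)"
    using mvt_general[of t "t + h" f "\<lambda>s x. x *\<^sub>R f' s"] d \<open>h > 0\<close> by auto
  also have "\<dots> = h * norm (f' s)" using \<open>h > 0\<close> by simp
  also have "\<dots> \<le> h * C" using bound[of s] \<open>h > 0\<close> by simp
  finally show ?thesis .
qed

text \<open>
  By Rolle's theorem the derivative of a periodic function vanishes somewhere in each period, and
  from there it can grow by at most \<open>T * C\<close>.
\<close>

lemma periodic_derivative_le:
  fixes u a a' :: "real \<Rightarrow> real"
  assumes u: "\<And>t. (u has_real_derivative a t) (at t)" and a: "\<And>t. (a has_real_derivative a' t) (at t)"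
    and periodic: "\<And>t. u (t + T) = u t" and bound: "\<And>t. \<bar>a' t\<bar> \<le> C" and "T > 0"
  shows "\<bar>a t\<bar> \<le> T * C"
proof -
  have "\<exists>z>t. z < t + T \<and> u (t + T) - u t = (t + T - t) * a z"
    by (rule MVT2) (use u \<open>T > 0\<close> in auto)
  then obtain z where z: "t < z" "z < t + T" "a z = 0"
    using periodic[of t] \<open>T > 0\<close> by auto
  have "\<exists>y>t. y < z \<and> a z - a t = (z - t) * a' y"
    by (rule MVT2) (use a z in auto)
  then obtain y where "a z - a t = (z - t) * a' y" by blast
  then have "\<bar>a t\<bar> = (z - t) * \<bar>a' y\<bar>"
    using z by (metis abs_minus_cancel abs_mult abs_of_pos diff_0 diff_gt_0_iff_gt)
  also have "\<dots> \<le> T * C" using z bound[of y] by (intro mult_mono) auto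
  finally show ?thesis .
qed

lemma lap_norm_le:
  fixes f :: "int \<Rightarrow> 'a::real_normed_field"
  assumes "j \<in> ring_sites N" "\<And>i. i \<in> ring_sites N \<Longrightarrow> norm (f i) \<le> B"
  shows "norm (lap N f j) \<le> 4 * B"
proof -
  have "norm (lap N f j) \<le> norm (2 * f j) + norm (f (nxt N j)) + norm (f (prv N j))"
    unfolding lap_def by norm
  then show ?thesis
    using assms(2)[OF assms(1)] assms(2)[of "nxt N j"] assms(2)[of "prv N j"] by (simp add: norm_mult)
qed

lemma linear_error_bound:
  fixes p p0 g :: complex
  assumes "cmod (p - p0) \<le> \<delta>" "cmod p0 \<le> r" "cmod g \<le> B" "\<delta> \<le> 1"
  shows "cmod (2 * of_real (cmod p ^ 2 - cmod p0 ^ 2) * g + (p ^ 2 - p0 ^ 2) * cnj g) \<le> 3 * \<delta> * (2 * r + 1) * B"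
proof -
  have n: "0 \<le> \<delta>" "0 \<le> r" "0 \<le> B" using assms norm_ge_zero order_trans by metis+
  have p: "cmod p \<le> r + \<delta>" using assms norm_triangle_sub[of p p0] by linarith
  have d: "\<bar>cmod p - cmod p0\<bar> \<le> \<delta>" using norm_triangle_ineq3[of p p0] assms by linarith
  have s: "cmod p + cmod p0 \<le> 2 * r + 1" using p assms by linarith
  have "cmod p ^ 2 - cmod p0 ^ 2 = (cmod p - cmod p0) * (cmod p + cmod p0)"
    by (simp add: power2_eq_square algebra_simps)
  then have "\<bar>cmod p ^ 2 - cmod p0 ^ 2\<bar> \<le> \<delta> * (2 * r + 1)"
    using d s n by (simp add: abs_mult) (intro mult_mono, auto)
  moreover have "cmod (p ^ 2 - p0 ^ 2) \<le> \<delta> * (2 * r + 1)"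
  proof -
    have "p ^ 2 - p0 ^ 2 = (p - p0) * (p + p0)" by (simp add: power2_eq_square algebra_simps)
    moreover have "cmod (p + p0) \<le> 2 * r + 1" using s norm_triangle_ineq[of p p0] by linarith
    ultimately show ?thesis using assms n by (simp add: norm_mult mult_mono)
  qed
  ultimately have "cmod (2 * of_real (cmod p ^ 2 - cmod p0 ^ 2) * g) \<le> 2 * (\<delta> * (2 * r + 1)) * B"
    "cmod ((p ^ 2 - p0 ^ 2) * cnj g) \<le> \<delta> * (2 * r + 1) * B"
    using assms(3) n
    by (auto simp only: norm_mult norm_of_real complex_mod_cnj norm_numeral norm_ge_zero
      intro!: mult_mono mult_nonneg_nonneg)
  then show ?thesis
    using norm_triangle_ineq[of "2 * of_real (cmod p ^ 2 - cmod p0 ^ 2) * g" "(p ^ 2 - p0 ^ 2) * cnj g"]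
    by (simp add: algebra_simps)
qed

lemma dnls_field_rotate:
  assumes "cmod e = 1"
  shows "dnls_field N \<epsilon> (\<lambda>j. e * u j) j = e * dnls_field N \<epsilon> u j"
  using assms by (simp add: dnls_field_def lap_def norm_mult algebra_simps)

text \<open>
  The step of the rigidity argument. Freezing the coefficients at p0 leaves an error of size
  \<open>\<eta> * B\<close>. At an empty site the frozen equation is a rotation with frequency I; comparing g over
  one period costs the factor \<open>\<kappa>\<close>, the distance of the rotation over a period from the identity. At an excited
  site g / p0 = a + \<open>\<i>\<close> b satisfies a' = 0 and b' = - 2 I a up to the error, and a and b are themselves
  derivatives of periodic functions, so that Rolle's theorem bounds first a and then b.
\<close>

lemma rotating_derivative_contracts:
  fixes N :: nat and I T \<delta> \<epsilon> \<eta> \<kappa> B :: real and p g :: "real \<Rightarrow> int \<Rightarrow> complex" and p0 :: "int \<Rightarrow> complex"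
  assumes I: "I > 0" and T: "T > 0" and \<epsilon>: "\<epsilon> > 0" and \<delta>: "\<delta> \<le> 1"
    and \<eta>: "\<eta> = 3 * \<delta> * (2 * sqrt I + 1) + 4 * \<epsilon>"
    and \<kappa>: "\<kappa> = cmod (exp (- \<i> * of_real (I * T)) - 1)"
    and small: "T * \<eta> \<le> \<kappa> / 2" "T * (2 * I * T + 2) * \<eta> \<le> 1 / 2" and "\<kappa> > 0"
    and p: "\<And>t j. j \<in> ring_sites N \<Longrightarrow> ((\<lambda>s. p s j) has_vector_derivative g t j) (at t)"
    and g: "\<And>t j. j \<in> ring_sites N \<Longrightarrow> ((\<lambda>s. g s j) has_vector_derivative
        - \<i> * (dnls_field_deriv N \<epsilon> (p t) (g t) j - of_real (1 + I) * g t j)) (at t)"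
    and periodic: "\<And>t j. j \<in> ring_sites N \<Longrightarrow> p (t + T) j = p t j"
       "\<And>t j. j \<in> ring_sites N \<Longrightarrow> g (t + T) j = g t j"
    and near: "\<And>t j. j \<in> ring_sites N \<Longrightarrow> cmod (p t j - p0 j) \<le> \<delta>"
    and p0: "\<And>j. p0 j = 0 \<or> cmod (p0 j) = sqrt I"
    and B: "\<And>t j. j \<in> ring_sites N \<Longrightarrow> cmod (g t j) \<le> B"
    and j: "j \<in> ring_sites N"
  shows "cmod (g t j) \<le> B / 2"
proof -
  have B0: "B \<ge> 0" using B[OF j, of 0] norm_ge_zero order_trans by blast
  have "\<delta> \<ge> 0" using near[OF j, of 0] norm_ge_zero order_trans by blast
  then have \<eta>0: "\<eta> \<ge> 0" unfolding \<eta> using \<epsilon> I by (intro add_nonneg_nonneg mult_nonneg_nonneg) auto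
  define R where "R s = - \<i> * (2 * of_real (cmod (p s j) ^ 2 - cmod (p0 j) ^ 2) * g s j
      + (p s j ^ 2 - p0 j ^ 2) * cnj (g s j) + of_real \<epsilon> * lap N (g s) j)" for s
  have R: "cmod (R s) \<le> \<eta> * B" for s
  proof -
    have "cmod (p0 j) \<le> sqrt I" using p0[of j] I by auto
    from linear_error_bound[OF near[OF j] this B[OF j] \<delta>, of s s]
    have "cmod (2 * of_real (cmod (p s j) ^ 2 - cmod (p0 j) ^ 2) * g s j
      + (p s j ^ 2 - p0 j ^ 2) * cnj (g s j)) \<le> 3 * \<delta> * (2 * sqrt I + 1) * B" .
    moreover have "cmod (of_real \<epsilon> * lap N (g s) j) \<le> \<epsilon> * (4 * B)"
      unfolding norm_mult norm_of_real using \<epsilon> lap_norm_le[OF j B] by (simp add: mult_left_mono)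
    ultimately show ?thesis
      unfolding R_def \<eta> norm_mult[of "- \<i>"] norm_minus_cancel norm_ii mult_1 distrib_right
      using norm_triangle_ineq[of "2 * of_real (cmod (p s j) ^ 2 - cmod (p0 j) ^ 2) * g s j
        + (p s j ^ 2 - p0 j ^ 2) * cnj (g s j)" "of_real \<epsilon> * lap N (g s) j"]
      by linarith
  qed
  have split: "- \<i> * (dnls_field_deriv N \<epsilon> (p s) (g s) j - of_real (1 + I) * g s j)
      = - \<i> * ((2 * of_real (cmod (p0 j) ^ 2) - of_real I) * g s j + p0 j ^ 2 * cnj (g s j)) + R s" for s
    unfolding R_def dnls_field_deriv_def by (simp add: algebra_simps)
  note g' = g[OF j, unfolded split]
  consider "p0 j = 0" | "cmod (p0 j) = sqrt I" "p0 j \<noteq> 0" using p0[of j] by blast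
  then show ?thesis
  proof cases
    case 1
    define e where "e s = exp (- \<i> * of_real (I * s))" for s
    have e1: "cmod (e s) = 1" for s by (simp add: e_def norm_exp_eq_Re)
    have de: "(e has_vector_derivative - \<i> * of_real I * e s) (at s)" for s
      unfolding e_def by (rule exp_rotation_derivative)
    have "((\<lambda>s. e s * g s j) has_vector_derivative e s * R s) (at s)" for s
      by (rule has_vector_derivative_eq_rhs[OF has_vector_derivative_mult[OF de g']])
        (simp add: 1 algebra_simps)
    then have "cmod (e (t + T) * g (t + T) j - e t * g t j) \<le> T * (\<eta> * B)"
      by (rule norm_increment_le) (use R e1 T in \<open>auto simp: norm_mult\<close>)
    moreover have "e (t + T) * g (t + T) j - e t * g t j = e t * ((e T - 1) * g t j)"
      unfolding periodic(2)[OF j] by (simp add: e_def exp_add[symmetric] algebra_simps)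
    moreover have "cmod (e T - 1) = \<kappa>" by (simp add: \<kappa> e_def)
    ultimately have "\<kappa> * cmod (g t j) \<le> T * (\<eta> * B)" by (simp add: norm_mult e1)
    also have "\<dots> \<le> \<kappa> / 2 * B" using mult_right_mono[OF small(1) B0] by (simp add: mult.assoc)
    finally show ?thesis using \<open>\<kappa> > 0\<close> by (simp add: field_simps)
  next
    case 2
    define a where "a s = Re (g s j / p0 j)" for s
    define b where "b s = Im (g s j / p0 j)" for s
    define C where "C = \<eta> * B / sqrt I"
    have C0: "C \<ge> 0" using B0 \<eta>0 I by (simp add: C_def)
    have Rp: "cmod (R s / p0 j) \<le> C" for s
      unfolding C_def norm_divide 2(1) using R[of s] I by (simp add: divide_right_mono)
    have ReR: "\<bar>Re (R s / p0 j)\<bar> \<le> C" and ImR: "\<bar>Im (R s / p0 j)\<bar> \<le> C" for s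
      using Rp[of s] abs_Re_le_cmod[of "R s / p0 j"] abs_Im_le_cmod[of "R s / p0 j"] by linarith+
    have sq: "of_real (cmod (p0 j) ^ 2) = complex_of_real I" using I 2 by simp
    have pp: "p0 j * cnj (p0 j) = of_real I" using complex_norm_square[of "p0 j"] sq by simp
    have dg: "((\<lambda>s. g s j / p0 j) has_vector_derivative
        - \<i> * of_real (2 * I * a s) + R s / p0 j) (at s)" for s
    proof (rule has_vector_derivative_eq_rhs[OF has_vector_derivative_divide[OF g'[of s]]])
      define z where "z = g s j / p0 j"
      have gz: "g s j = p0 j * z" using 2(2) by (simp add: z_def)
      have "p0 j ^ 2 * cnj (g s j) = p0 j * (p0 j * cnj (p0 j)) * cnj z"
        unfolding gz by (simp add: power2_eq_square)
      then have "(2 * of_real (cmod (p0 j) ^ 2) - of_real I) * g s j + p0 j ^ 2 * cnj (g s j)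
          = p0 j * (of_real I * (z + cnj z))"
        unfolding sq pp gz by (simp add: algebra_simps)
      also have "z + cnj z = of_real (2 * Re z)" by (simp add: complex_eq_iff)
      finally show "(- \<i> * ((2 * of_real (cmod (p0 j) ^ 2) - of_real I) * g s j + p0 j ^ 2 * cnj (g s j)) + R s) / p0 j
          = - \<i> * of_real (2 * I * a s) + R s / p0 j"
        using 2(2) by (simp add: a_def z_def add_divide_distrib diff_divide_distrib)
    qed
    have da: "(a has_real_derivative Re (R s / p0 j)) (at s)" for s
      using has_field_derivative_Re[OF dg[of s]] by (simp add: a_def[abs_def])
    have db: "(b has_real_derivative (- 2 * I * a s + Im (R s / p0 j))) (at s)" for s
      using has_field_derivative_Im[OF dg[of s]] by (simp add: b_def[abs_def])
    have dp: "((\<lambda>s. p s j / p0 j) has_vector_derivative g s j / p0 j) (at s)" for s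
      by (rule has_vector_derivative_divide[OF p[OF j]])
    have a: "\<bar>a s\<bar> \<le> T * C" for s
      by (rule periodic_derivative_le[where u = "\<lambda>s. Re (p s j / p0 j)", OF _ da _ ReR T])
        (use has_field_derivative_Re[OF dp] periodic(1)[OF j] in \<open>auto simp: a_def\<close>)
    have db': "\<bar>- 2 * I * a s + Im (R s / p0 j)\<bar> \<le> 2 * I * (T * C) + C" for s
    proof -
      have "\<bar>- 2 * I * a s\<bar> \<le> 2 * I * (T * C)" using a[of s] I by (simp add: abs_mult)
      then show ?thesis using ImR[of s] by linarith
    qed
    have b: "\<bar>b s\<bar> \<le> T * (2 * I * (T * C) + C)" for s
      by (rule periodic_derivative_le[where u = "\<lambda>s. Im (p s j / p0 j)", OF _ db _ db' T])
        (use has_field_derivative_Im[OF dp] periodic(1)[OF j] in \<open>auto simp: b_def\<close>)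
    have "cmod (g t j / p0 j) \<le> \<bar>a t\<bar> + \<bar>b t\<bar>" unfolding a_def b_def by (rule cmod_le)
    also have "\<dots> \<le> T * C + T * (2 * I * (T * C) + C)" using a[of t] b[of t] by linarith
    also have "\<dots> = T * (2 * I * T + 2) * C" by (simp add: algebra_simps)
    finally have "cmod (g t j) \<le> T * (2 * I * T + 2) * (\<eta> * B)"
      unfolding norm_divide 2(1) C_def using I by (simp add: field_simps)
    also have "\<dots> \<le> 1 / 2 * B" using mult_right_mono[OF small(2) B0] by (simp add: mult.assoc)
    finally show ?thesis by simp
  qed
qed

text \<open>
  I T equals \<open>2 pi\<close> minus \<open>2 pi / (1 + I)\<close>, and 1 / (1 + I) lies strictly between 0 and 1.
\<close>

lemma nonresonant:
  fixes I :: real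
  assumes "I > 0" "T = 2 * pi / (1 + I)"
  shows "exp (- \<i> * of_real (I * T)) \<noteq> (1 :: complex)"
proof
  assume "exp (- \<i> * of_real (I * T)) = (1 :: complex)"
  then obtain n :: int where "- (I * T) = of_int (2 * n) * pi" by (auto simp: exp_eq_1)
  then have "pi * (- I) = pi * (of_int n * (1 + I))" using assms by (simp add: field_simps)
  then have n: "- I = of_int n * (1 + I)" by (simp only: mult_cancel_left pi_neq_zero simp_thms)
  then have one: "of_int (n + 1) * (1 + I) = 1" by (simp add: algebra_simps)
  then have "0 < of_int (n + 1) * (1 + I)" by simp
  then have "(0 :: real) < of_int (n + 1)" using assms(1) by (simp only: zero_less_mult_iff) linarith
  then have "n + 1 \<ge> 1" by simp
  then have "(of_int (n + 1) :: real) \<ge> 1" by (simp only: of_int_1_le_iff)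
  then have "1 * (1 + I) \<le> of_int (n + 1) * (1 + I)"
    using assms(1) by (intro mult_right_mono) auto
  then show False unfolding one using assms(1) by simp
qed

definition orbit_profile :: "real \<Rightarrow> (int \<Rightarrow> real) \<Rightarrow> int \<Rightarrow> complex" where
  "orbit_profile I \<theta> j = (if j \<in> {-1, 1} then of_real (sqrt I) * exp (- \<i> * of_real (\<theta> j)) else 0)"

lemma unperturbed_orbit_eq:
  "unperturbed_orbit {-1, 1} I \<theta> t j = exp (- \<i> * of_real ((1 + I) * t)) * orbit_profile I \<theta> j"
  by (simp add: unperturbed_orbit_def orbit_profile_def exp_add[symmetric] algebra_simps exp_minus[symmetric]
    exp_diff[symmetric])

text \<open>
  Halving the bound on the velocity in the rotating frame infinitely often shows that the velocity
  vanishes. Because the constants depend on I only, the result applies to all continuations and all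
  sequences of periodic solutions at once.
\<close>

theorem periodic_solution_is_rotating_wave:
  fixes I T :: real
  assumes I: "I > 0" and T: "T = 2 * pi / (1 + I)"
  shows "\<exists>\<delta>>0. \<exists>\<epsilon>0>0. \<forall>N \<theta> \<epsilon> \<psi>. 0 < \<epsilon> \<longrightarrow> \<epsilon> < \<epsilon>0 \<longrightarrow> dnls_periodic_solution N \<epsilon> T \<psi> \<longrightarrow>
    (\<forall>j\<in>ring_sites N. \<forall>t. cmod (\<psi> t j - unperturbed_orbit {-1, 1} I \<theta> t j) \<le> \<delta>) \<longrightarrow>
    (\<forall>j\<in>ring_sites N. dnls_field N \<epsilon> (\<psi> 0) j = of_real (1 + I) * \<psi> 0 j \<and>
      (\<forall>t. \<psi> t j = exp (- \<i> * of_real ((1 + I) * t)) * \<psi> 0 j))"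
proof -
  define \<omega> where "\<omega> = 1 + I"
  have \<omega>: "\<omega> > 0" using I by (simp add: \<omega>_def)
  have T0: "T > 0" using T I by simp
  define \<kappa> where "\<kappa> = cmod (exp (- \<i> * of_real (I * T)) - 1)"
  have \<kappa>: "\<kappa> > 0" using nonresonant[OF I T] by (simp add: \<kappa>_def)
  define K where "K = 1 / (T * (2 * I * T + 2))"
  have K: "K > 0" using I T0 by (simp add: K_def add_pos_pos)
  define c where "c = min (\<kappa> / T) K / 2"
  have c: "c > 0" using \<kappa> K T0 by (simp add: c_def)
  define \<delta> where "\<delta> = min 1 (c / (6 * (2 * sqrt I + 1)))"
  define \<epsilon>0 where "\<epsilon>0 = c / 8"
  have r: "2 * sqrt I + 1 > 0" using I by (simp add: add_pos_pos)
  have pos: "\<delta> > 0" "\<epsilon>0 > 0" "\<delta> \<le> 1" using c r by (auto simp: \<delta>_def \<epsilon>0_def)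
  have main: "\<psi> t j = exp (- \<i> * of_real ((1 + I) * t)) * \<psi> 0 j
      \<and> dnls_field N \<epsilon> (\<psi> 0) j = of_real (1 + I) * \<psi> 0 j"
    if \<epsilon>: "0 < \<epsilon>" "\<epsilon> < \<epsilon>0" and sol: "dnls_periodic_solution N \<epsilon> T \<psi>"
      and near: "\<And>t j. j \<in> ring_sites N \<Longrightarrow> cmod (\<psi> t j - unperturbed_orbit {-1, 1} I \<theta> t j) \<le> \<delta>"
      and j: "j \<in> ring_sites N" for N \<theta> \<epsilon> \<psi> t j
  proof -
    define \<eta> where "\<eta> = 3 * \<delta> * (2 * sqrt I + 1) + 4 * \<epsilon>"
    have "\<delta> * (6 * (2 * sqrt I + 1)) \<le> c" using r by (simp add: \<delta>_def pos_le_divide_eq[symmetric])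
    then have "\<eta> \<le> c" using \<epsilon> unfolding \<eta>_def \<epsilon>0_def by (simp add: algebra_simps)
    then have "\<eta> \<le> \<kappa> / T / 2" "\<eta> \<le> K / 2" by (auto simp: c_def)
    moreover have "T * (2 * I * T + 2) > 0" using T0 I by (simp add: add_pos_pos)
    ultimately have small: "T * \<eta> \<le> \<kappa> / 2" "T * (2 * I * T + 2) * \<eta> \<le> 1 / 2"
      using T0 unfolding K_def by (simp_all only: field_simps)
    define e where "e s = exp (\<i> * of_real (\<omega> * s))" for s
    have e1: "cmod (e s) = 1" for s by (simp add: e_def norm_exp_eq_Re)
    have eT: "e (s + T) = e s" for s
    proof -
      have "\<omega> * T = 2 * pi" using T \<omega> by (simp add: \<omega>_def)
      then have "e (s + T) = e s * exp (2 * of_real pi * \<i>)"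
        by (simp add: e_def distrib_left exp_add mult.commute)
      then show ?thesis by simp
    qed
    have ee: "e s * exp (- \<i> * of_real (\<omega> * s)) = 1" for s
      by (simp add: e_def exp_minus)
    have de: "(e has_vector_derivative \<i> * of_real \<omega> * e s) (at s)" for s
      unfolding e_def by (rule exp_rotation_derivative)
    define p where "p s i = e s * \<psi> s i" for s i
    define g where "g s i = - \<i> * (dnls_field N \<epsilon> (p s) i - of_real \<omega> * p s i)" for s i
    have d\<psi>: "((\<lambda>s. \<psi> s i) has_vector_derivative - \<i> * dnls_field N \<epsilon> (\<psi> s) i) (at s)"
      if "i \<in> ring_sites N" for s i
      using sol that by (simp add: dnls_periodic_solution_def dnls_solution_iff)
    have dp: "((\<lambda>s. p s i) has_vector_derivative g s i) (at s)" if "i \<in> ring_sites N" for s i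
      unfolding p_def
      by (rule has_vector_derivative_eq_rhs[OF has_vector_derivative_mult[OF de d\<psi>[OF that]]])
        (use dnls_field_rotate[OF e1[of s], of N \<epsilon> "\<psi> s" i] in \<open>simp add: g_def p_def[abs_def] algebra_simps\<close>)
    have dg: "((\<lambda>s. g s i) has_vector_derivative
        - \<i> * (dnls_field_deriv N \<epsilon> (p s) (g s) i - of_real (1 + I) * g s i)) (at s)"
      if "i \<in> ring_sites N" for s i
      unfolding g_def[of _ i] \<omega>_def[symmetric]
      by (rule has_vector_derivative_eq_rhs[OF has_vector_derivative_mult_right[OF
          has_vector_derivative_diff[OF has_vector_derivative_field[OF dp that]
            has_vector_derivative_mult_right[OF dp[OF that]]]]])
        (simp_all add: g_def[of _ i])
    have pT: "p (s + T) i = p s i" if "i \<in> ring_sites N" for s i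
      using sol that by (simp add: p_def eT dnls_periodic_solution_def)
    have gT: "g (s + T) i = g s i" if "i \<in> ring_sites N" for s i
      unfolding g_def using dnls_field_cong[OF that, of "p (s + T)" "p s"] pT that by simp
    have nearp: "cmod (p s i - orbit_profile I \<theta> i) \<le> \<delta>" if "i \<in> ring_sites N" for s i
    proof -
      have "p s i - orbit_profile I \<theta> i = e s * (\<psi> s i - unperturbed_orbit {-1, 1} I \<theta> s i)"
        unfolding p_def unperturbed_orbit_eq \<omega>_def[symmetric] right_diff_distrib mult.assoc[symmetric] ee by simp
      then show ?thesis using near[OF that, of s] by (simp add: norm_mult e1)
    qed
    have p0: "orbit_profile I \<theta> i = 0 \<or> cmod (orbit_profile I \<theta> i) = sqrt I" for i
      using I by (simp add: orbit_profile_def norm_mult norm_exp_eq_Re)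
    define M where "M = sqrt I + 1"
    have M: "cmod (p s i) \<le> M" if "i \<in> ring_sites N" for s i
    proof -
      have "cmod (orbit_profile I \<theta> i) \<le> sqrt I" using p0[of i] I by auto
      then show ?thesis using nearp[OF that, of s] pos norm_triangle_sub[of "p s i" "orbit_profile I \<theta> i"]
        by (simp add: M_def)
    qed
    define B0 where "B0 = M + M ^ 2 * M + \<epsilon> * (4 * M) + \<omega> * M"
    have B0: "cmod (g s i) \<le> B0" if "i \<in> ring_sites N" for s i
    proof -
      have M0: "0 \<le> M" using I by (simp add: M_def)
      have "cmod (of_real (cmod (p s i) ^ 2) * p s i) \<le> M ^ 2 * M"
        unfolding norm_mult norm_of_real using M[OF that, of s] by (intro mult_mono) (auto simp: M0 power_mono)
      moreover have "cmod (of_real \<epsilon> * lap N (p s) i) \<le> \<epsilon> * (4 * M)"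
        unfolding norm_mult norm_of_real using \<epsilon> lap_norm_le[OF that M] by (simp add: mult_left_mono)
      moreover have "cmod (of_real \<omega> * p s i) \<le> \<omega> * M"
        unfolding norm_mult norm_of_real using \<omega> M[OF that] by (simp add: mult_left_mono)
      moreover have "cmod (g s i) \<le> cmod (p s i) + cmod (of_real (cmod (p s i) ^ 2) * p s i)
          + cmod (of_real \<epsilon> * lap N (p s) i) + cmod (of_real \<omega> * p s i)"
      proof -
        have "cmod (g s i) = cmod (dnls_field N \<epsilon> (p s) i - of_real \<omega> * p s i)"
          by (simp add: g_def norm_mult)
        moreover have "cmod (a + b + c - d) \<le> cmod a + cmod b + cmod c + cmod d" for a b c d
          using norm_triangle_ineq4[of "a + b + c" d] norm_triangle_ineq[of "a + b" c] norm_triangle_ineq[of a b]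
          by linarith
        ultimately show ?thesis unfolding dnls_field_def by metis
      qed
      ultimately show ?thesis using M[OF that, of s] unfolding B0_def by linarith
    qed
    \<comment> \<open>The lemma above halves any bound that is valid at all sites and times.\<close>
    have Bn: "cmod (g s i) \<le> B0 / 2 ^ n" if "i \<in> ring_sites N" for s i n
      using that
    proof (induction n arbitrary: s i)
      case 0 then show ?case using B0 by simp
    next
      case (Suc n)
      have "cmod (g s i) \<le> (B0 / 2 ^ n) / 2"
        by (rule rotating_derivative_contracts[OF I T0 \<epsilon>(1) pos(3) \<eta>_def \<kappa>_def small \<kappa> dp dg pT gT nearp p0 Suc.IH Suc.prems])
      then show ?case by simp
    qed
    have g0: "g s i = 0" if "i \<in> ring_sites N" for s i
    proof -
      have "(\<lambda>n. B0 / 2 ^ n) \<longlonglongrightarrow> 0" by (rule LIMSEQ_divide_realpow_zero) simp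
      then have "cmod (g s i) \<le> 0"
        by (rule LIMSEQ_le_const) (use Bn[OF that] in blast)
      then show ?thesis by simp
    qed
    obtain c where "\<And>s. s \<in> UNIV \<Longrightarrow> p s j = c"
      by (rule has_vector_derivative_zero_constant[of UNIV "\<lambda>s. p s j"]) (use dp[OF j] g0[OF j] in auto)
    then have "p t j = p 0 j" by auto
    then have "e t * \<psi> t j = \<psi> 0 j" by (simp add: p_def e_def)
    moreover have "exp (- \<i> * of_real (\<omega> * t)) * (e t * \<psi> t j) = (e t * exp (- \<i> * of_real (\<omega> * t))) * \<psi> t j"
      by (simp only: ac_simps)
    ultimately have one: "\<psi> t j = exp (- \<i> * of_real (\<omega> * t)) * \<psi> 0 j"
      by (simp only: ee mult_1)
    have "p 0 = \<psi> 0" by (auto simp: p_def e_def)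
    then have "dnls_field N \<epsilon> (\<psi> 0) j = of_real \<omega> * \<psi> 0 j"
      using g0[OF j, of 0] by (simp add: g_def)
    then show ?thesis using one by (simp add: \<omega>_def)
  qed
  show ?thesis
  proof (intro exI conjI allI impI ballI)
    show "\<delta> > 0" "\<epsilon>0 > 0" by (rule pos)+
    fix N \<theta> \<epsilon> \<psi> j t
    assume "0 < \<epsilon>" "\<epsilon> < \<epsilon>0" "dnls_periodic_solution N \<epsilon> T \<psi>" "j \<in> ring_sites N"
      and "\<forall>j\<in>ring_sites N. \<forall>t. cmod (\<psi> t j - unperturbed_orbit {-1, 1} I \<theta> t j) \<le> \<delta>"
    then show "dnls_field N \<epsilon> (\<psi> 0) j = of_real (1 + I) * \<psi> 0 j"
      "\<psi> t j = exp (- \<i> * of_real ((1 + I) * t)) * \<psi> 0 j"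
      using main[of \<epsilon> N \<psi> \<theta> j t] by auto
  qed
qed

section \<open>Real standing waves\<close>

text \<open>
  A Jacobi operator on the ring with potential \<open>a - 1\<close>. The action I is scaled to 1, which turns
  \<open>\<epsilon>\<close> into \<open>e = \<epsilon> / I\<close> and makes all later constants numerical. With \<open>a = \<phi>^2\<close> the stationary
  equation for a real profile is \<open>ring_op N e a \<phi> = 0\<close>.
\<close>

definition ring_op :: "nat \<Rightarrow> real \<Rightarrow> (int \<Rightarrow> real) \<Rightarrow> (int \<Rightarrow> 'a::real_normed_field) \<Rightarrow> int \<Rightarrow> 'a" where
  "ring_op N e a f j = of_real (a j - 1) * f j + of_real e * lap N f j"

lemma near_sites:
  assumes "6 \<le> N"
  shows "nxt N 0 = 1" "prv N 0 = -1" "nxt N 1 = 2" "prv N 1 = 0" "nxt N 2 = 3" "prv N 2 = 1"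
    "nxt N 3 = 4" "prv N 3 = 2" "0 \<in> ring_sites N" "1 \<in> ring_sites N" "2 \<in> ring_sites N" "3 \<in> ring_sites N"
    "4 \<in> ring_sites N" "-1 \<in> ring_sites N"
  using assms by (auto simp: nxt_eq prv_eq ring_sites_def)

lemma finite_argmax:
  fixes f :: "'b \<Rightarrow> real"
  assumes "finite A" "A \<noteq> {}"
  obtains m where "m \<in> A" "\<And>j. j \<in> A \<Longrightarrow> f j \<le> f m"
proof -
  have "Max (f ` A) \<in> f ` A" using assms by simp
  then obtain m where "m \<in> A" "f m = Max (f ` A)" by auto
  then show thesis using that[of m] assms by auto
qed

lemma le_divide_of_mult_le:
  fixes a b c d :: real
  assumes "a * b \<le> c" "d \<le> b" "0 < d" "0 \<le> a"
  shows "a \<le> c / d"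
proof -
  have "a * d \<le> a * b" using assms by (intro mult_left_mono) auto
  then show ?thesis using assms by (simp add: pos_le_divide_eq)
qed

lemma abs_add_le: "\<bar>x\<bar> \<le> a \<Longrightarrow> \<bar>y\<bar> \<le> b \<Longrightarrow> \<bar>x + y\<bar> \<le> a + (b :: real)"
  by linarith

text \<open>
  If v vanishes at the site 1, everything is driven by b = |v (-1)|. All empty sites are of order
  e b, hence \<open>v 2\<close>, whose neighbours are the site 1 and an empty site, is of order \<open>e^2 b\<close>,
  whereas \<open>v 0\<close> is of exact order e b. But the row at the site 1 says \<open>v 0 + v 2 = 0\<close>.
\<close>

lemma ring_op_kernel_trivial:
  fixes v :: "int \<Rightarrow> real"
  assumes N: "6 \<le> N" and e: "0 < e" "e \<le> 1 / 100"
    and small: "\<And>j. j \<in> ring_sites N \<Longrightarrow> j \<noteq> 1 \<Longrightarrow> j \<noteq> -1 \<Longrightarrow> \<bar>a j\<bar> \<le> 1 / 100"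
    and ker: "\<And>j. j \<in> ring_sites N \<Longrightarrow> ring_op N e a v j = 0"
    and v1: "v 1 = 0" and j: "j \<in> ring_sites N"
  shows "v j = 0"
proof -
  note ns = near_sites[OF N]
  define b where "b = \<bar>v (-1)\<bar>"
  define Off where "Off = ring_sites N - {1, -1}"
  have row: "(1 - 2 * e - a i) * v i = - e * (v (nxt N i) + v (prv N i))" if "i \<in> ring_sites N" for i
    using ker[OF that] by (simp add: ring_op_def lap_def algebra_simps)
  have "0 \<in> Off" using ns by (simp add: Off_def)
  then obtain m where m: "m \<in> Off" and max: "\<And>i. i \<in> Off \<Longrightarrow> \<bar>v i\<bar> \<le> \<bar>v m\<bar>"
    using finite_argmax[of Off "\<lambda>i. \<bar>v i\<bar>"] by (metis Off_def empty_iff finite_Diff finite_ring)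
  have any: "\<bar>v i\<bar> \<le> \<bar>v m\<bar> + b" if "i \<in> ring_sites N" for i
    using max[of i] that v1 by (cases "i \<in> Off") (auto simp: Off_def b_def)
  have mr: "m \<in> ring_sites N" "\<bar>a m\<bar> \<le> 1 / 100" using m small by (auto simp: Off_def)
  have "97 / 100 * \<bar>v m\<bar> \<le> \<bar>1 - 2 * e - a m\<bar> * \<bar>v m\<bar>"
    using mr e by (intro mult_right_mono) auto
  also have "\<dots> = e * \<bar>v (nxt N m) + v (prv N m)\<bar>"
    using arg_cong[OF row[OF mr(1)], of abs] e by (simp add: abs_mult)
  also have "\<dots> \<le> e * (2 * (\<bar>v m\<bar> + b))"
    using any[of "nxt N m"] any[of "prv N m"] e by (intro mult_left_mono) auto
  finally have "97 / 100 * \<bar>v m\<bar> \<le> 2 * (e * \<bar>v m\<bar>) + 2 * (e * b)" by (simp add: algebra_simps)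
  moreover have "e * \<bar>v m\<bar> \<le> 1 / 100 * \<bar>v m\<bar>" using e by (intro mult_right_mono) auto
  ultimately have M: "\<bar>v m\<bar> \<le> 3 * (e * b)" by linarith
  have v20: "v 2 = - v 0" using row[OF ns(10)] v1 ns e by simp
  have a0: "\<bar>a 0\<bar> \<le> 1 / 100" "\<bar>a 2\<bar> \<le> 1 / 100" using small ns by auto
  have "e * b = \<bar>1 - 2 * e - a 0\<bar> * \<bar>v 0\<bar>"
    using arg_cong[OF row[OF ns(9)], of abs] ns v1 e by (simp add: abs_mult b_def)
  also have "\<dots> \<le> 102 / 100 * \<bar>v 0\<bar>" using a0 e by (intro mult_right_mono) auto
  finally have lower: "e * b \<le> 102 / 100 * \<bar>v 0\<bar>" .
  have "97 / 100 * \<bar>v 2\<bar> \<le> \<bar>1 - 2 * e - a 2\<bar> * \<bar>v 2\<bar>" using a0 e by (intro mult_right_mono) auto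
  also have "\<dots> = e * \<bar>v 3\<bar>"
    using arg_cong[OF row[OF ns(11)], of abs] ns v1 e by (simp add: abs_mult)
  also have "\<dots> \<le> 1 / 100 * (3 * (e * b))"
    using max[of 3] M ns e by (intro mult_mono) (auto simp: Off_def)
  finally have upper: "97 / 100 * \<bar>v 2\<bar> \<le> 3 / 100 * (e * b)" by simp
  have "e * b \<ge> 0" using e by (simp add: b_def)
  then have eb: "e * b = 0" using lower upper v20 by linarith
  then have "b = 0" using e by simp
  then show ?thesis using any[OF j] M eb by simp
qed

text \<open>
  The profile at \<open>e = 0\<close>: s is 1 for equal phases of the excited sites and -1 for opposite phases.
\<close>

definition anchor :: "real \<Rightarrow> int \<Rightarrow> real" where
  "anchor s j = (if j = 1 then 1 else if j = -1 then s else 0)"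

text \<open>
  A simplified Newton iteration for the stationary equation. At \<open>e = 0\<close> its derivative is 2 at the
  excited sites and -1 at the empty ones, which explains the two weights in the map. The equation is
  solved at all integers; off the ring this is harmless, since neighbours always lie on the ring.
\<close>

lemma standing_wave_exists:
  assumes e: "0 < e" "e \<le> 1 / 1000" and s: "s = 1 \<or> s = -1"
  shows "\<exists>\<phi>. (\<forall>j. ring_op N e (\<lambda>j. \<phi> j ^ 2) \<phi> j = 0) \<and> (\<forall>j. \<bar>\<phi> j - anchor s j\<bar> \<le> 10 * e)"
proof -
  define R where "R \<phi> j = ring_op N e (\<lambda>j. \<phi> j ^ 2) \<phi> j" for \<phi> j
  define F where "F \<phi> j = (if j = 1 \<or> j = -1 then \<phi> j - R \<phi> j / 2 else \<phi> j + R \<phi> j)" for \<phi> j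
  define X where "X = {\<phi>. \<forall>j. \<bar>\<phi> j - anchor s j\<bar> \<le> 10 * e}"
  have anchor1: "\<bar>anchor s j\<bar> \<le> 1" for j using s by (auto simp: anchor_def)
  have e2: "e * e \<le> e / 1000" using e mult_left_mono[of e "1/1000" e] by simp
  have lapb: "\<bar>lap N f j\<bar> \<le> 4 * B" if "\<And>i. \<bar>f i\<bar> \<le> B" for f :: "int \<Rightarrow> real" and B j
    unfolding lap_def using that[of j] that[of "nxt N j"] that[of "prv N j"] by linarith
  have lapdiff: "lap N f j - lap N g j = lap N (\<lambda>i. f i - g i) j" for f g :: "int \<Rightarrow> real" and j
    by (simp add: lap_def)
  have on: "F \<phi> j = anchor s j - (3 * anchor s j * (\<phi> j - anchor s j) ^ 2 + (\<phi> j - anchor s j) ^ 3) / 2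
      - e * lap N \<phi> j / 2" if "j = 1 \<or> j = -1" for \<phi> j
  proof -
    define \<sigma> where "\<sigma> = anchor s j"
    define x where "x = \<phi> j - \<sigma>"
    have p: "\<phi> j = \<sigma> + x" by (simp add: x_def)
    have "\<sigma> ^ 2 = 1" using s that by (auto simp: \<sigma>_def anchor_def)
    then have "(\<sigma> + x) ^ 2 = 1 + 2 * \<sigma> * x + x ^ 2" by (simp add: power2_sum)
    then have "((\<sigma> + x) ^ 2 - 1) * (\<sigma> + x) = (2 * \<sigma> * x + x ^ 2) * (\<sigma> + x)" by simp
    also have "\<dots> = 2 * \<sigma> ^ 2 * x + 3 * \<sigma> * x ^ 2 + x ^ 3"
      by (simp add: power2_eq_square power3_eq_cube algebra_simps)
    finally have "((\<sigma> + x) ^ 2 - 1) * (\<sigma> + x) = 2 * x + 3 * \<sigma> * x ^ 2 + x ^ 3"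
      using \<open>\<sigma> ^ 2 = 1\<close> by simp
    then show ?thesis using that
      unfolding F_def R_def ring_op_def \<sigma>_def[symmetric] x_def[symmetric] p by (simp add: field_simps)
  qed
  have off: "F \<phi> j = \<phi> j ^ 3 + e * lap N \<phi> j" "anchor s j = 0" if "\<not> (j = 1 \<or> j = -1)" for \<phi> j
    using that unfolding F_def R_def ring_op_def anchor_def
    by (auto simp: power2_eq_square power3_eq_cube algebra_simps)
  have maps: "F \<phi> \<in> X" if "\<phi> \<in> X" for \<phi>
    unfolding X_def mem_Collect_eq
  proof
    fix j
    define x where "x = \<phi> j - anchor s j"
    have x: "\<bar>x\<bar> \<le> 10 * e" using that by (simp add: X_def x_def)
    have "\<bar>\<phi> i\<bar> \<le> 11 / 10" for i
    proof -
      have "\<bar>\<phi> i - anchor s i\<bar> \<le> 10 * e" using that by (simp add: X_def)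
      then show ?thesis using anchor1[of i] e by linarith
    qed
    from lapb[OF this] have "\<bar>lap N \<phi> j\<bar> \<le> 5" by (rule order_trans) simp
    then have l: "\<bar>e * lap N \<phi> j\<bar> \<le> 5 * e" using e by (simp add: abs_mult)
    have xx: "x ^ 2 \<le> e / 10"
    proof -
      have "\<bar>x\<bar> * \<bar>x\<bar> \<le> (10 * e) * (10 * e)" using x by (intro mult_mono) auto
      then show ?thesis using e2 by (simp add: power2_eq_square)
    qed
    have "\<bar>x\<bar> * x ^ 2 \<le> 1 * x ^ 2" using x e by (intro mult_right_mono) auto
    then have xxx: "\<bar>x ^ 3\<bar> \<le> e / 10" using xx by (simp add: power3_eq_cube power2_eq_square abs_mult)
    show "\<bar>F \<phi> j - anchor s j\<bar> \<le> 10 * e"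
    proof (cases "j = 1 \<or> j = -1")
      case True
      have "\<bar>3 * anchor s j * x ^ 2\<bar> \<le> 3 * x ^ 2"
        using anchor1[of j] by (simp add: abs_mult mult_left_le_one_le)
      then have A: "\<bar>3 * anchor s j * x ^ 2\<bar> \<le> e" using xx e by linarith
      have "F \<phi> j - anchor s j = - ((3 * anchor s j * x ^ 2 + x ^ 3 + e * lap N \<phi> j) / 2)"
        unfolding on[OF True] x_def[symmetric] by (simp add: field_simps)
      then have "\<bar>F \<phi> j - anchor s j\<bar> = \<bar>3 * anchor s j * x ^ 2 + x ^ 3 + e * lap N \<phi> j\<bar> / 2" by simp
      also have "\<dots> \<le> (e + e / 10 + 5 * e) / 2"
        using abs_add_le[OF abs_add_le[OF A xxx] l] by simp
      finally show ?thesis using e by simp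
    next
      case False
      then show ?thesis using l xxx e unfolding off[OF False] x_def by (simp add: off(2)[OF False])
    qed
  qed
  have contr: "\<bar>F f j - F g j\<bar> \<le> D / 2"
    if f: "f \<in> X" and g: "g \<in> X" and D: "\<And>i. \<bar>f i - g i\<bar> \<le> D" for f g D j
  proof -
    define x where "x = f j - anchor s j"
    define y where "y = g j - anchor s j"
    have xy: "\<bar>x\<bar> \<le> 10 * e" "\<bar>y\<bar> \<le> 10 * e" using f g by (auto simp: X_def x_def y_def)
    have d: "\<bar>x - y\<bar> \<le> D" using D[of j] by (simp add: x_def y_def)
    then have D0: "D \<ge> 0" by linarith
    have "\<bar>e * lap N f j - e * lap N g j\<bar> = e * \<bar>lap N (\<lambda>i. f i - g i) j\<bar>"
      unfolding lapdiff[symmetric] right_diff_distrib[symmetric] using e by (simp add: abs_mult)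
    also have "\<dots> \<le> 1 / 1000 * (4 * D)" using lapb[OF D] e by (intro mult_mono) auto
    finally have l: "\<bar>e * lap N f j - e * lap N g j\<bar> \<le> D / 250" by simp
    have "\<bar>x ^ 2 - y ^ 2\<bar> = \<bar>x + y\<bar> * \<bar>x - y\<bar>"
      by (simp add: abs_mult[symmetric] power2_eq_square algebra_simps)
    also have "\<dots> \<le> (1 / 50) * D" using abs_add_le[OF xy] d e by (intro mult_mono) auto
    finally have q: "\<bar>x ^ 2 - y ^ 2\<bar> \<le> D / 50" by simp
    have "\<bar>x ^ 3 - y ^ 3\<bar> = \<bar>x * x + x * y + y * y\<bar> * \<bar>x - y\<bar>"
      by (simp add: abs_mult[symmetric] power3_eq_cube algebra_simps)
    also have "\<dots> \<le> (3 / 10000) * D"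
    proof (intro mult_mono d)
      have b: "\<bar>a\<bar> * \<bar>b\<bar> \<le> 1 / 100 * (1 / 100)" if "\<bar>a\<bar> \<le> 10 * e" "\<bar>b\<bar> \<le> 10 * e" for a b
        using that e by (intro mult_mono) auto
      have "\<bar>x * x + x * y + y * y\<bar> \<le> \<bar>x\<bar> * \<bar>x\<bar> + \<bar>x\<bar> * \<bar>y\<bar> + \<bar>y\<bar> * \<bar>y\<bar>"
        by (simp only: abs_mult[symmetric])
      then show "\<bar>x * x + x * y + y * y\<bar> \<le> 3 / 10000"
        using b[OF xy(1) xy(1)] b[OF xy] b[OF xy(2) xy(2)] by linarith
    qed auto
    finally have c: "\<bar>x ^ 3 - y ^ 3\<bar> \<le> 3 / 10000 * D" .
    show ?thesis
    proof (cases "j = 1 \<or> j = -1")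
      case True
      have "3 * anchor s j * x ^ 2 - 3 * anchor s j * y ^ 2 = 3 * (anchor s j * (x ^ 2 - y ^ 2))"
        by (simp add: algebra_simps)
      then have "\<bar>3 * anchor s j * x ^ 2 - 3 * anchor s j * y ^ 2\<bar> = 3 * (\<bar>anchor s j\<bar> * \<bar>x ^ 2 - y ^ 2\<bar>)"
        by (simp only: abs_mult abs_numeral)
      also have "\<dots> \<le> 3 * (1 * (D / 50))" using anchor1[of j] q D0 by (intro mult_left_mono mult_mono) auto
      finally have A: "\<bar>3 * anchor s j * x ^ 2 - 3 * anchor s j * y ^ 2\<bar> \<le> 3 * D / 50" by simp
      have "F f j - F g j = - ((3 * anchor s j * x ^ 2 - 3 * anchor s j * y ^ 2) + (x ^ 3 - y ^ 3)
          + (e * lap N f j - e * lap N g j)) / 2"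
        unfolding on[OF True] x_def[symmetric] y_def[symmetric] by (simp add: field_simps)
      then have "\<bar>F f j - F g j\<bar> = \<bar>(3 * anchor s j * x ^ 2 - 3 * anchor s j * y ^ 2) + (x ^ 3 - y ^ 3)
          + (e * lap N f j - e * lap N g j)\<bar> / 2"
        by (simp only: abs_divide abs_minus_cancel abs_numeral)
      also have "\<dots> \<le> (3 * D / 50 + 3 / 10000 * D + D / 250) / 2"
        using abs_add_le[OF abs_add_le[OF A c] l] by simp
      finally show ?thesis using D0 by simp
    next
      case False
      have "x = f j" "y = g j" by (auto simp: x_def y_def off(2)[OF False])
      then have "F f j - F g j = (x ^ 3 - y ^ 3) + (e * lap N f j - e * lap N g j)"
        unfolding off(1)[OF False] by simp
      then show ?thesis using abs_add_le[OF c l] D0 by simp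
    qed
  qed
  have "\<exists>\<phi>\<in>X. F \<phi> = \<phi>"
  proof (rule contraction_fixpoint[of "anchor s" X F 2])
    show "anchor s \<in> X" using e by (simp add: X_def)
    show "\<bar>f j\<bar> \<le> 2" if "f \<in> X" for f j
    proof -
      have "\<bar>f j - anchor s j\<bar> \<le> 10 * e" using that by (simp add: X_def)
      then show ?thesis using anchor1[of j] e by linarith
    qed
    show "f \<in> X" if u: "\<And>n::nat. u n \<in> X" and lim: "\<And>j. (\<lambda>n. u n j) \<longlonglongrightarrow> f j" for u f
      unfolding X_def mem_Collect_eq
    proof
      fix j
      have "(\<lambda>n. \<bar>u n j - anchor s j\<bar>) \<longlonglongrightarrow> \<bar>f j - anchor s j\<bar>" by (intro tendsto_intros lim)
      then show "\<bar>f j - anchor s j\<bar> \<le> 10 * e"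
        by (rule LIMSEQ_le_const2) (use u in \<open>auto simp: X_def\<close>)
    qed
  qed (use maps contr in auto)
  then obtain \<phi> where \<phi>: "\<phi> \<in> X" "F \<phi> = \<phi>" by blast
  have "R \<phi> j = 0" for j using fun_cong[OF \<phi>(2), of j] by (auto simp: F_def split: if_splits)
  then show ?thesis using \<phi>(1) unfolding R_def X_def by blast
qed

text \<open>
  The bound on e is far from sharp. It leaves room for every numerical error constant below, the
  largest of which is about 7700.
\<close>

locale standing_wave =
  fixes N :: nat and e s :: real and \<phi> :: "int \<Rightarrow> real"
  assumes N: "6 \<le> N" "N \<le> 10" and e: "0 < e" "e \<le> 1 / 1000000" and s: "s = 1 \<or> s = -1"
    and wave: "\<And>j. j \<in> ring_sites N \<Longrightarrow> ring_op N e (\<lambda>j. \<phi> j ^ 2) \<phi> j = 0"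
    and near: "\<And>j. j \<in> ring_sites N \<Longrightarrow> \<bar>\<phi> j - anchor s j\<bar> \<le> 1 / 10"
begin

lemma stationary_row:
  assumes "j \<in> ring_sites N"
  shows "(1 - 2 * e - \<phi> j ^ 2) * \<phi> j = - e * (\<phi> (nxt N j) + \<phi> (prv N j))"
  using wave[OF assms] by (simp add: ring_op_def lap_def algebra_simps)

lemma anchor_le: "\<bar>anchor s j\<bar> \<le> 1"
  using s by (auto simp: anchor_def)

lemma anchor_on: "j = 1 \<or> j = -1 \<Longrightarrow> anchor s j = 1 \<or> anchor s j = -1"
  using s by (auto simp: anchor_def)

lemma \<phi>_le: "j \<in> ring_sites N \<Longrightarrow> \<bar>\<phi> j\<bar> \<le> 11 / 10"
  using near[of j] anchor_le[of j] by linarith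

lemma \<phi>_off:
  assumes j: "j \<in> ring_sites N" "j \<noteq> 1" "j \<noteq> -1"
  shows "\<bar>\<phi> j\<bar> \<le> 3 * e"
proof -
  have a: "\<bar>\<phi> j\<bar> \<le> 1 / 10" using near[of j] j by (simp add: anchor_def)
  have "\<bar>\<phi> j\<bar> * \<bar>\<phi> j\<bar> \<le> 1 / 10 * (1 / 10)" using a by (intro mult_mono) auto
  then have "\<phi> j ^ 2 \<le> 1 / 100" by (simp add: power2_eq_square)
  then have "98 / 100 * \<bar>\<phi> j\<bar> \<le> \<bar>1 - 2 * e - \<phi> j ^ 2\<bar> * \<bar>\<phi> j\<bar>"
    using e zero_le_power2[of "\<phi> j"] by (intro mult_right_mono) linarith+
  also have "\<dots> = e * \<bar>\<phi> (nxt N j) + \<phi> (prv N j)\<bar>"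
    using arg_cong[OF stationary_row[OF j(1)], of abs] e by (simp add: abs_mult)
  also have "\<dots> \<le> e * (22 / 10)"
    using abs_add_le[OF \<phi>_le \<phi>_le, of "nxt N j" "prv N j"] e by (intro mult_left_mono) auto
  finally show ?thesis using e by linarith
qed

lemma sq_off:
  assumes j: "j \<in> ring_sites N" "j \<noteq> 1" "j \<noteq> -1"
  shows "\<phi> j ^ 2 \<le> e / 100000"
proof -
  have "\<bar>\<phi> j\<bar> * \<bar>\<phi> j\<bar> \<le> (3 * e) * (3 / 1000000)" using \<phi>_off[OF j] e by (intro mult_mono) auto
  then show ?thesis using e by (simp add: power2_eq_square)
qed

lemma sq_on:
  assumes j: "j = 1 \<or> j = -1"
  shows "\<bar>\<phi> j ^ 2 - 1\<bar> \<le> 3 * e"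
proof -
  have jr: "j \<in> ring_sites N" and ne: "nxt N j \<noteq> 1" "nxt N j \<noteq> -1" "prv N j \<noteq> 1" "prv N j \<noteq> -1"
    using j N by (auto simp: nxt_eq prv_eq ring_sites_def)
  have a: "\<bar>\<phi> j\<bar> \<ge> 9 / 10" using near[OF jr] anchor_on[OF j] by linarith
  have nb: "\<bar>\<phi> (nxt N j)\<bar> \<le> 3 * e" "\<bar>\<phi> (prv N j)\<bar> \<le> 3 * e" using \<phi>_off ne by auto
  have "(\<phi> j ^ 2 - 1) * \<phi> j = - e * (2 * \<phi> j - \<phi> (nxt N j) - \<phi> (prv N j))"
    using stationary_row[OF jr] by (simp add: algebra_simps)
  then have "\<bar>\<phi> j ^ 2 - 1\<bar> * \<bar>\<phi> j\<bar> = e * \<bar>2 * \<phi> j - \<phi> (nxt N j) - \<phi> (prv N j)\<bar>"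
    using e by (simp only: abs_mult[symmetric]) (simp add: abs_mult)
  also have "\<dots> \<le> e * (23 / 10)"
    using nb \<phi>_le[OF jr] e by (intro mult_left_mono) linarith+
  finally have "\<bar>\<phi> j ^ 2 - 1\<bar> * \<bar>\<phi> j\<bar> \<le> e * (23 / 10)" .
  from le_divide_of_mult_le[OF this a] show ?thesis using e by simp
qed

lemma \<phi>_on:
  assumes j: "j = 1 \<or> j = -1"
  shows "\<bar>\<phi> j - anchor s j\<bar> \<le> 2 * e"
proof -
  have jr: "j \<in> ring_sites N" using j N by (auto simp: ring_sites_def)
  note \<sigma> = anchor_on[OF j]
  then have a: "\<bar>\<phi> j + anchor s j\<bar> \<ge> 19 / 10" using near[OF jr] by linarith
  have "\<bar>\<phi> j - anchor s j\<bar> * \<bar>\<phi> j + anchor s j\<bar> = \<bar>\<phi> j ^ 2 - 1\<bar>"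
    using \<sigma> by (auto simp: abs_mult[symmetric] power2_eq_square algebra_simps)
  also have "\<dots> \<le> 3 * e" by (rule sq_on[OF j])
  finally have "\<bar>\<phi> j - anchor s j\<bar> * \<bar>\<phi> j + anchor s j\<bar> \<le> 3 * e" .
  from le_divide_of_mult_le[OF this a] show ?thesis using e by simp
qed

text \<open>
  At a site where the difference of two profiles is largest, the difference quotient of the cubic term
  is bounded away from zero, while the coupling contributes only 4 e times the difference.
\<close>

lemma standing_wave_unique:
  assumes other: "standing_wave N e s \<phi>'" and j: "j \<in> ring_sites N"
  shows "\<phi>' j = \<phi> j"
proof -
  interpret o: standing_wave N e s \<phi>' by (rule other)
  have "ring_sites N \<noteq> {}" using j by blast
  then obtain m where m: "m \<in> ring_sites N" and max: "\<And>i. i \<in> ring_sites N \<Longrightarrow> \<bar>\<phi> i - \<phi>' i\<bar> \<le> \<bar>\<phi> m - \<phi>' m\<bar>"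
    using finite_argmax[of "ring_sites N" "\<lambda>i. \<bar>\<phi> i - \<phi>' i\<bar>"] finite_ring by metis
  define D where "D = \<bar>\<phi> m - \<phi>' m\<bar>"
  define q where "q = \<phi> m ^ 2 + \<phi> m * \<phi>' m + \<phi>' m ^ 2 - 1"
  have "q * (\<phi> m - \<phi>' m) = - e * (lap N \<phi> m - lap N \<phi>' m)"
    using wave[OF m] o.wave[OF m] unfolding ring_op_def q_def
    by (simp add: power2_eq_square algebra_simps)
  also have "lap N \<phi> m - lap N \<phi>' m
      = 2 * (\<phi> m - \<phi>' m) - (\<phi> (nxt N m) - \<phi>' (nxt N m)) - (\<phi> (prv N m) - \<phi>' (prv N m))"
    by (simp add: lap_def)
  finally have "\<bar>q\<bar> * D = e * \<bar>2 * (\<phi> m - \<phi>' m) - (\<phi> (nxt N m) - \<phi>' (nxt N m)) - (\<phi> (prv N m) - \<phi>' (prv N m))\<bar>"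
    unfolding D_def using e by (simp only: abs_mult[symmetric]) (simp add: abs_mult)
  also have "\<dots> \<le> 1 / 1000000 * (4 * D)"
  proof (intro mult_mono)
    have "\<bar>2 * x - y - z\<bar> \<le> 4 * d" if "\<bar>x\<bar> \<le> d" "\<bar>y\<bar> \<le> d" "\<bar>z\<bar> \<le> d" for x y z d :: real
      using that by linarith
    then show "\<bar>2 * (\<phi> m - \<phi>' m) - (\<phi> (nxt N m) - \<phi>' (nxt N m)) - (\<phi> (prv N m) - \<phi>' (prv N m))\<bar> \<le> 4 * D"
      unfolding D_def using max[OF nxt_in_ring[of N m]] max[OF prv_in_ring[of N m]] order_refl by blast
  qed (use e in auto)
  finally have upper: "\<bar>q\<bar> * D \<le> 1 / 250000 * D" by simp
  have "\<bar>q\<bar> \<ge> 9 / 10"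
  proof (cases "m = 1 \<or> m = -1")
    case True
    note \<sigma> = anchor_on[OF True]
    have nn: "9 / 10 \<le> anchor s m * x" if "\<bar>x - anchor s m\<bar> \<le> 1 / 10" for x
      using \<sigma> that unfolding abs_le_iff by auto
    have "\<phi> m * \<phi>' m = anchor s m * \<phi> m * (anchor s m * \<phi>' m)" using \<sigma> by auto
    also have "\<dots> \<ge> 9 / 10 * (9 / 10)"
      using nn[OF near[OF m]] nn[OF o.near[OF m]] by (intro mult_mono) auto
    finally have "\<phi> m * \<phi>' m \<ge> 81 / 100" by simp
    then show ?thesis using sq_on[OF True] o.sq_on[OF True] e unfolding q_def by linarith
  next
    case False
    then have off: "m \<in> ring_sites N" "m \<noteq> 1" "m \<noteq> -1" using m by auto
    have "\<bar>\<phi> m\<bar> * \<bar>\<phi>' m\<bar> \<le> 1 / 1000 * (1 / 1000)"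
      using \<phi>_off[OF off] o.\<phi>_off[OF off] e by (intro mult_mono) auto
    then have "\<bar>\<phi> m * \<phi>' m\<bar> \<le> 1 / 1000000" by (simp add: abs_mult)
    then show ?thesis using sq_off[OF off] o.sq_off[OF off] e unfolding q_def by linarith
  qed
  then have "9 / 10 * D \<le> \<bar>q\<bar> * D" by (intro mult_right_mono) (auto simp: D_def)
  then have "D \<le> 0" using upper by simp
  then show ?thesis using max[OF j] by (simp add: D_def)
qed

text \<open>
  The reflected profile is a profile with the same signs, so uniqueness applies.
\<close>

lemma \<phi>_even:
  assumes "s = 1" "j \<in> ring_sites N"
  shows "\<phi> (- j) = \<phi> j"
proof (rule standing_wave_unique[OF _ assms(2)])
  show "standing_wave N e s (\<lambda>j. \<phi> (- j))"
  proof
    fix j assume j: "j \<in> ring_sites N"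
    have "lap N (\<lambda>j. \<phi> (- j)) j = lap N \<phi> (- j)"
      using nxt_uminus[OF j] prv_uminus[OF j] by (simp add: lap_def)
    then show "ring_op N e (\<lambda>j. \<phi> (- j) ^ 2) (\<lambda>j. \<phi> (- j)) j = 0"
      using wave[of "- j"] j by (simp add: ring_op_def)
    show "\<bar>\<phi> (- j) - anchor s j\<bar> \<le> 1 / 10"
      using near[of "- j"] j assms(1) by (auto simp: anchor_def split: if_splits)
  qed (use N e s in auto)
qed

end

section \<open>The spectrum of the linearisation at a standing wave\<close>

lemma ring_op_of_real:
  "ring_op N e a (\<lambda>j. complex_of_real (f j)) j = of_real (ring_op N e a f j)"
  by (simp add: ring_op_def lap_def)

lemma ring_op_symmetric:
  "(\<Sum>j\<in>ring_sites N. g j * ring_op N e a f j) = (\<Sum>j\<in>ring_sites N. ring_op N e a g j * f j)"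
proof -
  have "(\<Sum>j\<in>ring_sites N. of_real e * (g j * lap N f j)) = (\<Sum>j\<in>ring_sites N. of_real e * (lap N g j * f j))"
    unfolding sum_distrib_left[symmetric] sum_lap_symmetric ..
  then show ?thesis by (simp add: ring_op_def distrib_left distrib_right sum.distrib ac_simps)
qed

lemma ring_op_cnj: "ring_op N e a (\<lambda>j. cnj (f j)) j = cnj (ring_op N e a f j)"
  by (simp add: ring_op_def lap_def)

text \<open>
  A real symmetric operator has a real quadratic form; this is the source of the reality of \<open>\<mu>\<close>.
\<close>

lemma ring_op_form_real: "Im (\<Sum>j\<in>ring_sites N. cnj (f j) * ring_op N e a f j) = 0"
proof -
  let ?S = "\<Sum>j\<in>ring_sites N. cnj (f j) * ring_op N e a f j"
  have "?S = (\<Sum>j\<in>ring_sites N. cnj (ring_op N e a f j) * f j)"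
    unfolding ring_op_symmetric[of "\<lambda>j. cnj (f j)"] ring_op_cnj ..
  also have "\<dots> = cnj ?S" by (simp add: mult.commute)
  finally show ?thesis using Reals_cnj_iff complex_is_Real_iff by metis
qed

lemma ring_op_diff: "ring_op N e a (\<lambda>j. f j - g j) j = ring_op N e a f j - ring_op N e a g j"
  by (simp add: ring_op_def lap_def algebra_simps)

lemma ring_op_scale: "ring_op N e a (\<lambda>j. c * f j) j = c * ring_op N e a f j"
  by (simp add: ring_op_def lap_def algebra_simps)

lemma norm_affine_le:
  fixes x y :: "'a::real_normed_field"
  assumes "\<bar>c\<bar> \<le> C" "norm x \<le> X" "norm y \<le> Y" "0 \<le> e"
  shows "norm (of_real c * x + of_real e * y) \<le> C * X + e * Y"
proof -
  have "norm (of_real c * x) \<le> C * X" unfolding norm_mult norm_of_real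
    using assms by (intro mult_mono) auto
  moreover have "norm (of_real e * y) \<le> e * Y" unfolding norm_mult norm_of_real
    using assms by (simp add: mult_left_mono)
  ultimately show ?thesis using norm_triangle_ineq order_trans add_mono by metis
qed

context standing_wave
begin

text \<open>
  The operators \<open>L-\<close> and \<open>L+\<close> act on the phase part and on the amplitude part of a perturbation. At
  the empty sites both are close to -1; at the excited sites they are close to 0 and to 2.
\<close>

abbreviation Lm :: "(int \<Rightarrow> 'a::real_normed_field) \<Rightarrow> int \<Rightarrow> 'a" where
  "Lm \<equiv> ring_op N e (\<lambda>j. \<phi> j ^ 2)"
abbreviation Lp :: "(int \<Rightarrow> 'a::real_normed_field) \<Rightarrow> int \<Rightarrow> 'a" where
  "Lp \<equiv> ring_op N e (\<lambda>j. 3 * \<phi> j ^ 2)"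

lemma Lp_off:
  assumes j: "j \<in> ring_sites N" "j \<noteq> 1" "j \<noteq> -1" and f: "\<And>i. i \<in> ring_sites N \<Longrightarrow> norm (f i) \<le> B"
  shows "norm (Lp f j + f j) \<le> 5 * e * B"
proof -
  have B: "B \<ge> 0" using f[OF j(1)] norm_ge_zero order_trans by blast
  have "norm (of_real (3 * \<phi> j ^ 2) * f j + of_real e * lap N f j) \<le> e * B + e * (4 * B)"
    using sq_off[OF j] e by (intro norm_affine_le f j lap_norm_le) auto
  then show ?thesis by (simp add: ring_op_def algebra_simps)
qed

lemma Lp_on:
  assumes j: "j = 1 \<or> j = -1" and f: "\<And>i. i \<in> ring_sites N \<Longrightarrow> norm (f i) \<le> B"
  shows "norm (Lp f j - 2 * f j) \<le> 13 * e * B"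
proof -
  have jr: "j \<in> ring_sites N" using j N by (auto simp: ring_sites_def)
  have "norm (of_real (3 * (\<phi> j ^ 2 - 1)) * f j + of_real e * lap N f j) \<le> (9 * e) * B + e * (4 * B)"
    using sq_on[OF j] e by (intro norm_affine_le f jr lap_norm_le) (auto simp: abs_mult)
  then show ?thesis by (simp add: ring_op_def algebra_simps)
qed

lemma Lp_le:
  assumes j: "j \<in> ring_sites N" and f: "\<And>i. i \<in> ring_sites N \<Longrightarrow> norm (f i) \<le> B"
  shows "norm (Lp f j) \<le> 3 * B"
proof -
  have B: "B \<ge> 0" using f[OF j(1)] norm_ge_zero order_trans by blast
  have eB: "e * B \<le> 1 / 1000000 * B" using e B by (intro mult_right_mono) auto
  show ?thesis
  proof (cases "j = 1 \<or> j = -1")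
    case True
    have "norm (Lp f j) \<le> norm (Lp f j - 2 * f j) + norm (2 * f j)"
      using norm_triangle_sub[of "Lp f j" "2 * f j"] by (simp add: add.commute)
    then show ?thesis using Lp_on[of j f B, OF True f] f[OF j] eB B by (simp add: norm_mult)
  next
    case False
    have "norm (Lp f j) \<le> norm (Lp f j + f j) + norm (f j)"
      using norm_triangle_ineq4[of "Lp f j + f j" "f j"] by simp
    then show ?thesis using Lp_off[of j f B, OF j _ _ f] False f[OF j] eB B by auto
  qed
qed

lemma Lm_off:
  assumes j: "j \<in> ring_sites N" "j \<noteq> 1" "j \<noteq> -1" and f: "\<And>i. i \<in> ring_sites N \<Longrightarrow> norm (f i) \<le> 3 * B"
  shows "norm (Lm f j + f j) \<le> 13 * e * B"
proof -
  have "norm (of_real (\<phi> j ^ 2) * f j + of_real e * lap N f j) \<le> (e / 3) * (3 * B) + e * (4 * (3 * B))"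
    using sq_off[OF j] e by (intro norm_affine_le f j lap_norm_le) auto
  then show ?thesis by (simp add: ring_op_def algebra_simps)
qed

lemma Lm_on:
  assumes j: "j = 1 \<or> j = -1" and f: "\<And>i. i \<in> ring_sites N \<Longrightarrow> norm (f i) \<le> 3 * B"
  shows "norm (Lm f j) \<le> 21 * e * B"
proof -
  have jr: "j \<in> ring_sites N" using j N by (auto simp: ring_sites_def)
  have "norm (of_real (\<phi> j ^ 2 - 1) * f j + of_real e * lap N f j) \<le> (3 * e) * (3 * B) + e * (4 * (3 * B))"
    using sq_on[OF j] e by (intro norm_affine_le f jr lap_norm_le) auto
  then show ?thesis by (simp add: ring_op_def algebra_simps)
qed

end

text \<open>
  An eigenvector of \<open>L- L+\<close> with eigenvalue \<open>- \<mu>\<close>, written as a first order system. All estimates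
  are relative to W, the maximum of w.
\<close>

locale wave_mode = standing_wave +
  fixes v w :: "int \<Rightarrow> complex" and \<mu> :: complex
  assumes Lm_v: "\<And>j. j \<in> ring_sites N \<Longrightarrow> Lm v j = \<mu> * w j"
    and Lp_w: "\<And>j. j \<in> ring_sites N \<Longrightarrow> Lp w j = - v j"
    and nontrivial: "\<exists>j\<in>ring_sites N. w j \<noteq> 0"
begin

definition W :: real where "W = Max ((\<lambda>j. cmod (w j)) ` ring_sites N)"

lemma w_le: "j \<in> ring_sites N \<Longrightarrow> cmod (w j) \<le> W"
  by (simp add: W_def)

lemma W_pos: "W > 0"
  using nontrivial w_le zero_less_norm_iff order_less_le_trans by metis

lemma W_attained: obtains m where "m \<in> ring_sites N" "cmod (w m) = W"
proof -
  have "W \<in> (\<lambda>j. cmod (w j)) ` ring_sites N"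
    unfolding W_def using nontrivial by (intro Max_in) auto
  then show thesis using that by auto
qed

lemma small_powers: "0 < e * W" "e * W \<le> W / 1000000" "0 < e * (e * W)" "e * (e * W) \<le> e * W / 1000000"
  "0 < e * (e * (e * W))" "e * (e * (e * W)) \<le> e * (e * W) / 1000000"
proof -
  show a: "0 < e * W" "0 < e * (e * W)" "0 < e * (e * (e * W))" using e W_pos by auto
  have le: "e * x \<le> x / 1000000" if "0 < x" for x
    using mult_right_mono[OF e(2), of x] that by simp
  then show "e * W \<le> W / 1000000" "e * (e * W) \<le> e * W / 1000000"
    "e * (e * (e * W)) \<le> e * (e * W) / 1000000" using le[OF W_pos] le[OF a(1)] le[OF a(2)] by auto
qed

lemma v_le: "j \<in> ring_sites N \<Longrightarrow> cmod (v j) \<le> 3 * W"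
  using Lp_le[of j w W] w_le Lp_w[of j] by simp

lemma v_off:
  assumes "j \<in> ring_sites N" "j \<noteq> 1" "j \<noteq> -1"
  shows "cmod (v j - w j) \<le> 5 * (e * W)"
proof -
  have "v j - w j = - (Lp w j + w j)" using Lp_w[OF assms(1)] by simp
  then have "cmod (v j - w j) = cmod (Lp w j + w j)" by (simp only: norm_minus_cancel)
  then show ?thesis using Lp_off[of j w W, OF assms w_le] by (simp add: mult.assoc)
qed

lemma v_on:
  assumes "j = 1 \<or> j = -1"
  shows "cmod (v j + 2 * w j) \<le> 13 * (e * W)"
proof -
  have "j \<in> ring_sites N" using assms N by (auto simp: ring_sites_def)
  then have "v j + 2 * w j = - (Lp w j - 2 * w j)" using Lp_w by simp
  then show ?thesis using Lp_on[of j w W, OF assms w_le] by (simp add: mult.assoc norm_minus_commute)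
qed

lemma \<mu>_off:
  assumes "j \<in> ring_sites N" "j \<noteq> 1" "j \<noteq> -1"
  shows "cmod ((1 + \<mu>) * w j) \<le> 18 * (e * W)"
proof -
  have "cmod (\<mu> * w j + v j) \<le> 13 * (e * W)"
    using Lm_off[of j v W, OF assms v_le] Lm_v[OF assms(1)] by (simp add: mult.assoc)
  moreover have "(1 + \<mu>) * w j = (\<mu> * w j + v j) - (v j - w j)" by (simp add: algebra_simps)
  ultimately show ?thesis
    using v_off[OF assms] norm_triangle_ineq4[of "\<mu> * w j + v j" "v j - w j"] by simp
qed

lemma \<mu>_on:
  assumes "j = 1 \<or> j = -1"
  shows "cmod \<mu> * cmod (w j) \<le> 21 * (e * W)"
proof -
  have jr: "j \<in> ring_sites N" using assms N by (auto simp: ring_sites_def)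
  show ?thesis using Lm_on[of j v W, OF assms v_le] Lm_v[OF jr] by (simp add: mult.assoc norm_mult)
qed

lemma card_ring: "real (card (ring_sites N)) \<le> 21"
  using N by (simp add: ring_sites_def)

lemma Re_sum_le_with_peak:
  assumes "\<And>j. j \<in> ring_sites N \<Longrightarrow> Re (f j) \<le> c - (if j = m then d else 0)" "m \<in> ring_sites N" "0 \<le> c"
  shows "Re (\<Sum>j\<in>ring_sites N. f j) \<le> 21 * c - d"
proof -
  have "Re (\<Sum>j\<in>ring_sites N. f j) \<le> (\<Sum>j\<in>ring_sites N. c - (if j = m then d else 0))"
    unfolding Re_sum by (rule sum_mono) (rule assms(1))
  also have "\<dots> = real (card (ring_sites N)) * c - d" using assms(2) by (simp add: sum_subtractf)
  also have "\<dots> \<le> 21 * c - d" using mult_right_mono[OF card_ring assms(3)] by simp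
  finally show ?thesis .
qed

lemma Re_cnj_mult_le:
  assumes "cmod x \<le> a" "cmod y \<le> b"
  shows "Re (cnj x * y) \<le> a * b"
proof -
  have "Re (cnj x * y) \<le> cmod x * cmod y"
    using complex_Re_le_cmod[of "cnj x * y"] by (simp only: norm_mult complex_mod_cnj)
  also have "\<dots> \<le> a * b"
    using assms order_trans[OF norm_ge_zero assms(1)] by (intro mult_mono) auto
  finally show ?thesis .
qed

lemma Re_cnj_self: "Re (cnj x * x) = cmod x ^ 2"
  unfolding cmod_power2 by (simp add: power2_eq_square)

lemma pairing_real: "Im (\<Sum>j\<in>ring_sites N. cnj (v j) * w j) = 0"
proof -
  have "(\<Sum>j\<in>ring_sites N. cnj (v j) * w j) = - cnj (\<Sum>j\<in>ring_sites N. cnj (w j) * Lp w j)"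
    by (simp add: Lp_w sum_negf mult.commute)
  then show ?thesis by (simp only: uminus_complex.sel cnj.sel ring_op_form_real minus_zero)
qed

lemma pairing_\<mu>: "\<mu> * (\<Sum>j\<in>ring_sites N. cnj (v j) * w j) = (\<Sum>j\<in>ring_sites N. cnj (v j) * Lm v j)"
  by (simp add: Lm_v sum_distrib_left ac_simps)

text \<open>
  Pairing \<open>L- v = \<mu> w\<close> with v gives \<open>\<mu>\<close> times a real number on one side and a real number on the
  other.
\<close>

lemma \<mu>_real_if: "Re (\<Sum>j\<in>ring_sites N. cnj (v j) * w j) \<noteq> 0 \<Longrightarrow> Im \<mu> = 0"
  using arg_cong[OF pairing_\<mu>, of Im] pairing_real ring_op_form_real[where f = v] by simp

text \<open>
  For large \<open>\<mu>\<close> the excited sites carry almost nothing. On the empty sites v is close to w and \<open>L-\<close>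
  close to -1, so that the pairing of v with w is positive and the form of \<open>L-\<close> at v is negative;
  \<open>\<mu>\<close> is the quotient.
\<close>

lemma large_mode:
  assumes large: "cmod \<mu> \<ge> 1 / 4"
  shows "Im \<mu> = 0" "Re \<mu> < 0"
proof -
  have on: "cmod (w j) \<le> 84 * (e * W)" if "j = 1 \<or> j = -1" for j
    using mult_right_mono[OF large norm_ge_zero, of "w j"] \<mu>_on[OF that] by simp
  obtain m where m: "m \<in> ring_sites N" "cmod (w m) = W" by (rule W_attained)
  have moff: "m \<noteq> 1" "m \<noteq> -1" using on[of m] m small_powers W_pos by auto
  have WW: "e * W * W \<ge> 0" "e * W * W \<le> W ^ 2 / 1000000"
    using small_powers W_pos mult_right_mono[OF small_powers(2), of W] by (auto simp: power2_eq_square)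
  have "Re (\<Sum>j\<in>ring_sites N. - (cnj (v j) * w j)) \<le> 21 * (252 * (e * W * W)) - W ^ 2"
  proof (rule Re_sum_le_with_peak[OF _ m(1)])
    fix j assume j: "j \<in> ring_sites N"
    show "Re (- (cnj (v j) * w j)) \<le> 252 * (e * W * W) - (if j = m then W\<^sup>2 else 0)"
    proof (cases "j = 1 \<or> j = -1")
      case True
      have "Re (cnj (- v j) * w j) \<le> (3 * W) * (84 * (e * W))"
        using v_le[OF j] on[OF True] by (intro Re_cnj_mult_le) auto
      then show ?thesis using True moff by (auto simp: algebra_simps)
    next
      case False
      then have j': "j \<in> ring_sites N" "j \<noteq> 1" "j \<noteq> -1" using j by auto
      have "Re (cnj (w j - v j) * w j) \<le> (5 * (e * W)) * W"
        using v_off[OF j'] w_le[OF j] by (intro Re_cnj_mult_le) (auto simp: norm_minus_commute)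
      moreover have "Re (- (cnj (v j) * w j)) = Re (cnj (w j - v j) * w j) - cmod (w j) ^ 2"
        unfolding Re_cnj_self[symmetric] by (simp add: algebra_simps)
      ultimately have "Re (- (cnj (v j) * w j)) \<le> 5 * (e * W * W) - cmod (w j) ^ 2"
        by (simp only: mult.assoc)
      moreover have "(if j = m then W\<^sup>2 else 0) \<le> cmod (w j) ^ 2" using m(2) by auto
      ultimately show ?thesis using WW by linarith
    qed
  qed (use WW in simp)
  then have P: "Re (\<Sum>j\<in>ring_sites N. cnj (v j) * w j) > 0"
    using WW zero_less_power[OF W_pos, of 2] unfolding sum_negf uminus_complex.sel by linarith
  have "Re (\<Sum>j\<in>ring_sites N. cnj (v j) * Lm v j) \<le> 21 * (63 * (e * W * W)) - W ^ 2 / 2"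
  proof (rule Re_sum_le_with_peak[OF _ m(1)])
    fix j assume j: "j \<in> ring_sites N"
    have l: "Re (cnj (v j) * lap N v j) \<le> (3 * W) * (4 * (3 * W))"
      by (intro Re_cnj_mult_le v_le j lap_norm_le)
    have "Re (cnj (v j) * Lm v j) = (\<phi> j ^ 2 - 1) * cmod (v j) ^ 2 + e * Re (cnj (v j) * lap N v j)"
      unfolding ring_op_def Re_cnj_self[symmetric] by (simp add: algebra_simps)
    also have "\<dots> \<le> (\<phi> j ^ 2 - 1) * cmod (v j) ^ 2 + 36 * (e * W * W)"
      using mult_left_mono[OF l, of e] e by (simp add: algebra_simps)
    finally have r: "Re (cnj (v j) * Lm v j) \<le> (\<phi> j ^ 2 - 1) * cmod (v j) ^ 2 + 36 * (e * W * W)" .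
    show "Re (cnj (v j) * Lm v j) \<le> 63 * (e * W * W) - (if j = m then W\<^sup>2 / 2 else 0)"
    proof (cases "j = 1 \<or> j = -1")
      case True
      have "(\<phi> j ^ 2 - 1) * cmod (v j) ^ 2 \<le> (3 * e) * (3 * W) ^ 2"
        using sq_on[OF True] e v_le[OF j] by (intro mult_mono power_mono) auto
      then show ?thesis using r True moff by (auto simp: power2_eq_square algebra_simps)
    next
      case False
      then have j': "j \<in> ring_sites N" "j \<noteq> 1" "j \<noteq> -1" using j by auto
      have a: "\<phi> j ^ 2 - 1 \<le> - 9 / 10" using sq_off[OF j'] e by linarith
      have "(\<phi> j ^ 2 - 1) * cmod (v j) ^ 2 \<le> - 9 / 10 * cmod (v j) ^ 2"
        using a by (intro mult_right_mono) auto
      moreover have peak_size: "cmod (v j) ^ 2 \<ge> 81 / 100 * W ^ 2" if "j = m"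
      proof -
        have "cmod (v j) \<ge> 9 / 10 * W"
          using v_off[OF j'] m(2)[folded that] norm_triangle_ineq2[of "w j" "v j"] small_powers(2) W_pos
            norm_minus_commute[of "w j" "v j"] by linarith
        then have "(9 / 10 * W) ^ 2 \<le> cmod (v j) ^ 2" using W_pos by (intro power_mono) auto
        then show ?thesis by (simp add: power_mult_distrib power2_eq_square)
      qed
      moreover have "(if j = m then W\<^sup>2 / 2 else 0) \<le> 9 / 10 * cmod (v j) ^ 2"
      proof (cases "j = m")
        case True
        show ?thesis unfolding if_P[OF True] using peak_size[OF True] zero_le_power2[of W] by linarith
      qed simp
      ultimately show ?thesis using r WW by linarith
    qed
  qed (use WW in simp)
  then have Q: "Re (\<Sum>j\<in>ring_sites N. cnj (v j) * Lm v j) < 0"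
    using WW W_pos zero_less_power[OF W_pos, of 2] by linarith
  show "Im \<mu> = 0" using \<mu>_real_if P by simp
  then have "Re \<mu> * Re (\<Sum>j\<in>ring_sites N. cnj (v j) * w j) < 0"
    using arg_cong[OF pairing_\<mu>, of Re] Q pairing_real by simp
  then show "Re \<mu> < 0" using P by (simp add: mult_less_0_iff)
qed

context
  assumes small: "cmod \<mu> < 1 / 4"
begin

lemma w_off_small:
  assumes "j \<in> ring_sites N" "j \<noteq> 1" "j \<noteq> -1"
  shows "cmod (w j) \<le> 24 * (e * W)"
proof -
  have "cmod (1 + \<mu>) \<ge> 3 / 4" using small norm_triangle_ineq2[of 1 "- \<mu>"] by simp
  then have "3 / 4 * cmod (w j) \<le> cmod ((1 + \<mu>) * w j)"
    using mult_right_mono[OF _ norm_ge_zero[of "w j"]] by (simp only: norm_mult)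
  then show ?thesis using \<mu>_off[OF assms] by simp
qed

lemma v_off_small:
  assumes "j \<in> ring_sites N" "j \<noteq> 1" "j \<noteq> -1"
  shows "cmod (v j) \<le> 29 * (e * W)"
  using w_off_small[OF assms] v_off[OF assms] norm_triangle_sub[of "v j" "w j"] by simp

lemma small_peak: obtains m where "m = 1 \<or> m = -1" "cmod (w m) = W"
proof -
  obtain m where m: "m \<in> ring_sites N" "cmod (w m) = W" by (rule W_attained)
  have "m = 1 \<or> m = -1" using w_off_small[of m] m small_powers W_pos by fastforce
  then show thesis using that m by blast
qed

lemma \<mu>_le: "cmod \<mu> \<le> 21 * e"
proof -
  obtain m where m: "m = 1 \<or> m = -1" "cmod (w m) = W" by (rule small_peak)
  have "cmod \<mu> * W \<le> (21 * e) * W" using \<mu>_on[OF m(1)] m(2) by (simp add: mult.assoc)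
  then show ?thesis using W_pos by simp
qed

text \<open>
  Here w is concentrated on the excited sites, where v is close to \<open>- 2 w\<close>; the pairing is negative.
\<close>

lemma small_mode_real: "Im \<mu> = 0"
proof -
  obtain m where m: "m = 1 \<or> m = -1" "cmod (w m) = W" by (rule small_peak)
  have mr: "m \<in> ring_sites N" using m N by (auto simp: ring_sites_def)
  have WW: "e * W * W \<ge> 0" "e * W * W \<le> W ^ 2 / 1000000"
    using small_powers W_pos mult_right_mono[OF small_powers(2), of W] by (auto simp: power2_eq_square)
  have "Re (\<Sum>j\<in>ring_sites N. cnj (v j) * w j) \<le> 21 * (29 * (e * W * W)) - 2 * W ^ 2"
  proof (rule Re_sum_le_with_peak[OF _ mr])
    fix j assume j: "j \<in> ring_sites N"
    show "Re (cnj (v j) * w j) \<le> 29 * (e * W * W) - (if j = m then 2 * W\<^sup>2 else 0)"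
    proof (cases "j = 1 \<or> j = -1")
      case True
      have "Re (cnj (v j + 2 * w j) * w j) \<le> (13 * (e * W)) * W"
        by (intro Re_cnj_mult_le v_on True w_le j)
      moreover have "Re (cnj (v j) * w j) = Re (cnj (v j + 2 * w j) * w j) - 2 * cmod (w j) ^ 2"
        unfolding Re_cnj_self[symmetric] by (simp add: algebra_simps)
      ultimately have "Re (cnj (v j) * w j) \<le> 13 * (e * W * W) - 2 * cmod (w j) ^ 2"
        by (simp only: mult.assoc)
      moreover have "(if j = m then 2 * W\<^sup>2 else 0) \<le> 2 * cmod (w j) ^ 2" using m(2) by auto
      ultimately show ?thesis using WW by linarith
    next
      case False
      then have j': "j \<in> ring_sites N" "j \<noteq> 1" "j \<noteq> -1" using j by auto
      have "Re (cnj (v j) * w j) \<le> (29 * (e * W)) * W"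
        by (intro Re_cnj_mult_le v_off_small j' w_le)
      then show ?thesis using False m by (auto simp: mult.assoc)
    qed
  qed (use WW in simp)
  then have "Re (\<Sum>j\<in>ring_sites N. cnj (v j) * w j) < 0"
    using WW W_pos zero_less_power[OF W_pos, of 2] by linarith
  then show ?thesis using \<mu>_real_if by simp
qed

text \<open>
  Since \<open>\<phi>\<close> spans the kernel of the symmetric operator \<open>L-\<close>, the vector \<open>\<mu> w\<close> in its range is
  orthogonal to \<open>\<phi>\<close>. This selects the mode in which \<open>w (-1)\<close> is close to \<open>- s * w 1\<close>.
\<close>

lemma small_orthogonal:
  assumes "\<mu> \<noteq> 0"
  shows "cmod (w (-1) + of_real s * w 1) \<le> 5 * (e * W)"
proof -
  note ns = near_sites[OF N(1)]
  have "\<mu> * (\<Sum>j\<in>ring_sites N. of_real (\<phi> j) * w j) = (\<Sum>j\<in>ring_sites N. of_real (\<phi> j) * Lm v j)"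
    by (simp add: Lm_v sum_distrib_left ac_simps)
  also have "\<dots> = 0" unfolding ring_op_symmetric ring_op_of_real using wave by simp
  finally have "(\<Sum>j\<in>ring_sites N. of_real (\<phi> j) * w j) = 0" using assms by simp
  moreover have "(\<Sum>j\<in>ring_sites N. of_real (\<phi> j) * w j)
      = of_real (\<phi> 1) * w 1 + (of_real (\<phi> (-1)) * w (-1)
        + (\<Sum>j\<in>ring_sites N - {1} - {-1}. of_real (\<phi> j) * w j))"
    using ns by (subst sum.remove[of _ 1], simp_all, subst sum.remove[of _ "-1"], simp_all)
  ultimately have split: "of_real (\<phi> 1) * w 1 + of_real (\<phi> (-1)) * w (-1)
      = - (\<Sum>j\<in>ring_sites N - {1} - {-1}. of_real (\<phi> j) * w j)"
    by (simp add: eq_neg_iff_add_eq_0 add.assoc)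
  have "cmod (\<Sum>j\<in>ring_sites N - {1} - {-1}. of_real (\<phi> j) * w j)
      \<le> of_nat (card (ring_sites N - {1} - {-1})) * ((3 * e) * (24 * (e * W)))"
  proof (rule sum_norm_bound)
    fix j assume "j \<in> ring_sites N - {1} - {-1}"
    then have j: "j \<in> ring_sites N" "j \<noteq> 1" "j \<noteq> -1" by auto
    show "norm (of_real (\<phi> j) * w j) \<le> (3 * e) * (24 * (e * W))"
      unfolding norm_mult norm_of_real using \<phi>_off[OF j] w_off_small[OF j] e by (intro mult_mono) auto
  qed
  also have "\<dots> \<le> 21 * ((3 * e) * (24 * (e * W)))"
  proof (rule mult_right_mono)
    have "card (ring_sites N - {1} - {-1}) \<le> card (ring_sites N)" by (intro card_mono) auto
    then show "real (card (ring_sites N - {1} - {-1})) \<le> 21" using card_ring by linarith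
  qed (use e W_pos in \<open>auto intro!: mult_nonneg_nonneg\<close>)
  also have "\<dots> \<le> e * W" using small_powers by simp
  finally have off: "cmod (of_real (\<phi> 1) * w 1 + of_real (\<phi> (-1)) * w (-1)) \<le> e * W"
    unfolding split by simp
  have on1: "cmod (of_real (\<phi> 1 - 1) * w 1) \<le> (2 * e) * W"
    unfolding norm_mult norm_of_real using \<phi>_on[of 1] w_le[OF ns(10)] e
    by (intro mult_mono) (auto simp: anchor_def)
  have on2: "cmod (of_real (\<phi> (-1) - s) * w (-1)) \<le> (2 * e) * W"
    unfolding norm_mult norm_of_real using \<phi>_on[of "-1"] w_le[OF ns(14)] e
    by (intro mult_mono) (auto simp: anchor_def)
  have "w (-1) + of_real s * w 1 = of_real s * ((of_real (\<phi> 1) * w 1 + of_real (\<phi> (-1)) * w (-1))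
      - of_real (\<phi> 1 - 1) * w 1 - of_real (\<phi> (-1) - s) * w (-1))"
    using s by (auto simp: algebra_simps)
  then have "cmod (w (-1) + of_real s * w 1) = cmod ((of_real (\<phi> 1) * w 1 + of_real (\<phi> (-1)) * w (-1))
      - of_real (\<phi> 1 - 1) * w 1 - of_real (\<phi> (-1) - s) * w (-1))"
    using s by (auto simp: norm_mult)
  also have "\<dots> \<le> e * W + (2 * e) * W + (2 * e) * W"
    by (intro order_trans[OF norm_triangle_ineq4] add_mono off on1 on2)
  finally show ?thesis by simp
qed

text \<open>
  After elimination of the empty sites, \<open>L-\<close> acts on the excited sites at order \<open>e^2\<close>, although its
  entries there are of order e, so a direct estimate loses the leading term. The Wronskian \<open>K j = \<phi> j * v (j + 1) - v j * \<phi> (j + 1)\<close>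
  removes the cancelling part: \<open>e * (K j - K (j - 1)) = - \<mu> * \<phi> j * w j\<close>. To the right of the site 1 it
  is negligible, and the row at the site 0 evaluates \<open>K 0\<close> as e times \<open>\<phi> 1 * v (-1) - \<phi> (-1) * v 1\<close>,
  which is close to \<open>4 s w 1\<close>. The difference at the site 1 gives \<open>\<mu>\<close>.
\<close>

theorem small_mode_value:
  assumes "\<mu> \<noteq> 0"
  shows "cmod (\<mu> - of_real (4 * s * e ^ 2)) \<le> e ^ 2"
proof -
  note ns = near_sites[OF N(1)]
  define K where "K j = of_real (\<phi> j) * v (nxt N j) - v j * of_real (\<phi> (nxt N j))" for j
  have wron: "of_real e * (K j - K (prv N j)) = - \<mu> * of_real (\<phi> j) * w j" if j: "j \<in> ring_sites N" for j
  proof -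
    have "of_real (\<phi> j) * Lm v j - v j * Lm (\<lambda>j. complex_of_real (\<phi> j)) j
        = - of_real e * (K j - K (prv N j))"
      unfolding K_def nxt_prv[OF j] ring_op_def lap_def by (simp add: algebra_simps)
    moreover have "Lm (\<lambda>j. complex_of_real (\<phi> j)) j = 0" unfolding ring_op_of_real using wave[OF j] by simp
    ultimately show ?thesis using Lm_v[OF j] by (simp add: algebra_simps)
  qed
  \<comment> \<open>Two steps to the right the Wronskian involves empty sites only.\<close>
  have K1: "of_real e * K 1 = of_real e * K 3 + (\<mu> * (of_real (\<phi> 2) * w 2) + \<mu> * (of_real (\<phi> 3) * w 3))"
  proof -
    have "of_real e * K 1 = of_real e * K 3 - of_real e * (K 3 - K 2) - of_real e * (K 2 - K 1)"
      by (simp add: algebra_simps)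
    then show ?thesis using wron[OF ns(11)] wron[OF ns(12)] ns by (simp add: mult.assoc)
  qed
  have pw: "cmod (\<mu> * (of_real (\<phi> j) * w j)) \<le> 1512 * (e * (e * (e * W)))"
    if j: "j \<in> ring_sites N" "j \<noteq> 1" "j \<noteq> -1" for j
  proof -
    have "cmod (\<mu> * (of_real (\<phi> j) * w j)) \<le> (21 * e) * ((3 * e) * (24 * (e * W)))"
      unfolding norm_mult norm_of_real using \<mu>_le \<phi>_off[OF j] w_off_small[OF j] e by (intro mult_mono) auto
    then show ?thesis by (simp add: ac_simps)
  qed
  have pv: "cmod (of_real e * (of_real (\<phi> i) * v j)) \<le> 87 * (e * (e * (e * W)))"
    if i: "i \<in> ring_sites N" "i \<noteq> 1" "i \<noteq> -1" and j: "j \<in> ring_sites N" "j \<noteq> 1" "j \<noteq> -1" for i j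
  proof -
    have "cmod (of_real e * (of_real (\<phi> i) * v j)) \<le> e * ((3 * e) * (29 * (e * W)))"
      unfolding norm_mult norm_of_real using \<phi>_off[OF i] v_off_small[OF j] e by (intro mult_mono) auto
    then show ?thesis by (simp add: ac_simps)
  qed
  have K3: "of_real e * K 3 = of_real e * (of_real (\<phi> 3) * v 4) - of_real e * (of_real (\<phi> 4) * v 3)"
    by (simp add: K_def ns algebra_simps)
  have "cmod (of_real e * (of_real (\<phi> 3) * v 4)) \<le> 87 * (e * (e * (e * W)))"
    "cmod (of_real e * (of_real (\<phi> 4) * v 3)) \<le> 87 * (e * (e * (e * W)))"
    using ns by (auto intro!: pv)
  then have K3b: "cmod (of_real e * K 3) \<le> 174 * (e * (e * (e * W)))"
    unfolding K3 using norm_triangle_ineq4[of "of_real e * (of_real (\<phi> 3) * v 4)" "of_real e * (of_real (\<phi> 4) * v 3)"]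
    by linarith
  have "cmod (\<mu> * (of_real (\<phi> 2) * w 2)) \<le> 1512 * (e * (e * (e * W)))"
    "cmod (\<mu> * (of_real (\<phi> 3) * w 3)) \<le> 1512 * (e * (e * (e * W)))"
    using ns by (auto intro!: pw)
  then have K1b: "cmod (of_real e * K 1) \<le> 3198 * (e * (e * (e * W)))"
    unfolding K1 using K3b norm_triangle_ineq[of "of_real e * K 3" "\<mu> * (of_real (\<phi> 2) * w 2) + \<mu> * (of_real (\<phi> 3) * w 3)"]
      norm_triangle_ineq[of "\<mu> * (of_real (\<phi> 2) * w 2)" "\<mu> * (of_real (\<phi> 3) * w 3)"]
    by linarith
  define D where "D = 1 - 2 * e - \<phi> 0 ^ 2"
  have D: "\<bar>1 - D\<bar> \<le> 3 * e" using sq_off[OF ns(9)] e unfolding D_def by simp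
  define X where "X = of_real (\<phi> 1) * v (-1) - of_real (\<phi> (-1)) * v 1"
  define Y where "Y = \<mu> * w 0 * of_real (\<phi> 1)"
  have DK: "of_real D * K 0 = of_real e * X + Y"
  proof -
    have a: "complex_of_real D * of_real (\<phi> 0) = - of_real e * (of_real (\<phi> 1) + of_real (\<phi> (-1)))"
      using arg_cong[OF stationary_row[OF ns(9)], of complex_of_real] ns by (simp add: D_def)
    have b: "of_real D * v 0 = - of_real e * (v 1 + v (-1)) - \<mu> * w 0"
      using Lm_v[OF ns(9)] ns unfolding ring_op_def lap_def D_def by (simp add: algebra_simps)
    have "of_real D * K 0 = (of_real D * of_real (\<phi> 0)) * v 1 - (of_real D * v 0) * of_real (\<phi> 1)"
      by (simp add: K_def ns algebra_simps)
    then show ?thesis unfolding a b X_def Y_def by (simp add: algebra_simps)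
  qed
  have Y: "cmod Y \<le> 555 * (e * (e * W))"
  proof -
    have "cmod Y \<le> (21 * e) * (24 * (e * W)) * (11 / 10)"
      unfolding Y_def norm_mult norm_of_real
      using \<mu>_le w_off_small[OF ns(9)] \<phi>_le[OF ns(10)] W_pos e
      by (intro mult_mono) (auto intro!: mult_nonneg_nonneg)
    then show ?thesis using small_powers by (simp add: ac_simps)
  qed
  have f1: "cmod (of_real (\<phi> 1 - 1) * v (-1)) \<le> (2 * e) * (3 * W)"
    unfolding norm_mult norm_of_real using \<phi>_on[of 1] v_le[OF ns(14)] e
    by (intro mult_mono) (auto simp: anchor_def)
  have f2: "cmod (of_real (\<phi> (-1) - s) * v 1) \<le> (2 * e) * (3 * W)"
    unfolding norm_mult norm_of_real using \<phi>_on[of "-1"] v_le[OF ns(10)] e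
    by (intro mult_mono) (auto simp: anchor_def)
  have f3: "cmod (of_real s * (v 1 + 2 * w 1)) \<le> 13 * (e * W)"
    using v_on[of 1] s by (auto simp: norm_mult)
  have "X - 4 * of_real s * w 1 = of_real (\<phi> 1 - 1) * v (-1) + (v (-1) + 2 * w (-1))
      - of_real (\<phi> (-1) - s) * v 1 - of_real s * (v 1 + 2 * w 1) - 2 * (w (-1) + of_real s * w 1)"
    by (simp add: X_def algebra_simps)
  then have "cmod (X - 4 * of_real s * w 1) \<le> (2 * e) * (3 * W) + 13 * (e * W) + (2 * e) * (3 * W)
      + 13 * (e * W) + 2 * (5 * (e * W))"
  proof (elim ssubst)
    have last: "cmod (2 * (w (-1) + of_real s * w 1)) \<le> 2 * (5 * (e * W))"
      using small_orthogonal[OF assms] by (simp only: norm_mult norm_numeral)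
    have tri: "cmod (a + b - c - d - f) \<le> A + B + C + D + F"
      if "cmod a \<le> A" "cmod b \<le> B" "cmod c \<le> C" "cmod d \<le> D" "cmod f \<le> F" for a b c d f A B C D F
      using that norm_triangle_ineq4[of "a + b - c - d" f] norm_triangle_ineq4[of "a + b - c" d]
        norm_triangle_ineq4[of "a + b" c] norm_triangle_ineq[of a b] by linarith
    show "cmod (of_real (\<phi> 1 - 1) * v (-1) + (v (-1) + 2 * w (-1))
      - of_real (\<phi> (-1) - s) * v 1 - of_real s * (v 1 + 2 * w 1) - 2 * (w (-1) + of_real s * w 1))
      \<le> (2 * e) * (3 * W) + 13 * (e * W) + (2 * e) * (3 * W) + 13 * (e * W) + 2 * (5 * (e * W))"
      by (rule tri[OF f1 v_on f2 f3 last]) simp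
  qed
  then have Xw: "cmod (X - 4 * of_real s * w 1) \<le> 48 * (e * W)" by simp
  have Xb: "cmod X \<le> 5 * W"
  proof -
    have "cmod (4 * of_real s * w 1) \<le> 4 * W" using s w_le[OF ns(10)] by (auto simp: norm_mult)
    then show ?thesis using Xw norm_triangle_sub[of X "4 * of_real s * w 1"] small_powers by simp
  qed
  have K0b: "cmod (K 0) \<le> 8 * (e * W)"
  proof -
    have "cmod (of_real D * K 0) \<le> e * (5 * W) + 555 * (e * (e * W))"
    proof -
      have "cmod (of_real e * X) \<le> e * (5 * W)"
        unfolding norm_mult norm_of_real using Xb e by (simp add: mult_left_mono)
      then show ?thesis unfolding DK using norm_triangle_ineq[of "of_real e * X" Y] Y by linarith
    qed
    moreover have "9 / 10 * cmod (K 0) \<le> \<bar>D\<bar> * cmod (K 0)" using D e by (intro mult_right_mono) auto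
    ultimately show ?thesis using small_powers by (simp add: norm_mult)
  qed
  have K0X: "cmod (K 0 - of_real e * X) \<le> 579 * (e * (e * W))"
  proof -
    have "K 0 - of_real e * X = of_real (1 - D) * K 0 + Y" using DK by (simp add: algebra_simps)
    moreover have "cmod (of_real (1 - D) * K 0) \<le> (3 * e) * (8 * (e * W))"
      unfolding norm_mult norm_of_real using D K0b e by (intro mult_mono) auto
    ultimately show ?thesis using Y norm_triangle_ineq[of "of_real (1 - D) * K 0" Y] by simp
  qed
  define R where "R = \<mu> * of_real (\<phi> 1) * w 1 - 4 * of_real s * of_real e ^ 2 * w 1"
  have R: "cmod R \<le> 3825 * (e * (e * (e * W)))"
  proof -
    define a where "a = of_real e * (K 0 - of_real e * X)"
    define b where "b = of_real e * (of_real e * (X - 4 * of_real s * w 1))"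
    have Rab: "R = a + b - of_real e * K 1"
      using wron[OF ns(10)] ns unfolding R_def a_def b_def by (simp add: algebra_simps power2_eq_square)
    have "cmod a \<le> 579 * (e * (e * (e * W)))"
      unfolding a_def norm_mult norm_of_real using mult_left_mono[OF K0X, of e] e by (simp add: mult.left_commute)
    moreover have "cmod b \<le> 48 * (e * (e * (e * W)))"
      unfolding b_def norm_mult norm_of_real
      using mult_left_mono[OF mult_left_mono[OF Xw, of e], of e] e by (simp add: mult.left_commute)
    ultimately show ?thesis
      unfolding Rab using K1b norm_triangle_ineq4[of "a + b" "of_real e * K 1"] norm_triangle_ineq[of a b]
      by linarith
  qed
  have half: "W / 2 \<le> cmod (w 1)"
  proof -
    obtain m where m: "m = 1 \<or> m = -1" "cmod (w m) = W" by (rule small_peak)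
    have "cmod (w (-1)) \<le> cmod (w (-1) + of_real s * w 1) + cmod (w 1)"
      using norm_triangle_sub[of "w (-1)" "- (of_real s * w 1)"] s by (auto simp: norm_mult add.commute)
    note tri = this
    from m(1) show ?thesis
    proof
      assume "m = 1" then show ?thesis using m(2) W_pos by simp
    next
      assume "m = -1"
      then have "cmod (w (-1)) = W" using m(2) by simp
      then show ?thesis using tri small_orthogonal[OF assms] small_powers(2) W_pos by linarith
    qed
  qed
  \<comment> \<open>A first bound on \<mu>, fed back below to replace \<phi> 1 by 1 without losing an order.\<close>
  have first: "cmod \<mu> \<le> 12 * e ^ 2"
  proof -
    have "cmod (\<mu> * of_real (\<phi> 1) * w 1) \<le> cmod R + cmod (4 * of_real s * of_real e ^ 2 * w 1)"
      using norm_triangle_sub[of "\<mu> * of_real (\<phi> 1) * w 1" "4 * of_real s * of_real e ^ 2 * w 1"]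
      unfolding R_def by (simp add: add.commute)
    also have "cmod (4 * of_real s * of_real e ^ 2 * w 1) = 4 * (e ^ 2 * cmod (w 1))"
      using s by (auto simp: norm_mult norm_power)
    also have "\<dots> \<le> 4 * (e * (e * W))"
      using w_le[OF ns(10)] by (simp add: power2_eq_square mult.assoc mult_left_mono e(1) less_imp_le)
    finally have "cmod (\<mu> * of_real (\<phi> 1) * w 1) \<le> 5 * (e * (e * W))" using R small_powers by simp
    moreover have "cmod \<mu> * (9 / 10) * (W / 2) \<le> cmod (\<mu> * of_real (\<phi> 1) * w 1)"
    proof -
      have "9 / 10 \<le> \<bar>\<phi> 1\<bar>" using near[OF ns(10)] by (simp add: anchor_def abs_if split: if_splits)
      then show ?thesis unfolding norm_mult norm_of_real using half W_pos by (intro mult_mono) auto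
    qed
    ultimately have "cmod \<mu> * W \<le> 12 * (e * (e * W))" using small_powers(3) by linarith
    also have "\<dots> = (12 * e ^ 2) * W" by (simp add: power2_eq_square)
    finally have "cmod \<mu> * W \<le> (12 * e ^ 2) * W" .
    then show ?thesis using W_pos by simp
  qed
  have "cmod ((\<mu> - of_real (4 * s * e ^ 2)) * w 1) \<le> 3849 * (e * (e * (e * W)))"
  proof -
    have "(\<mu> - of_real (4 * s * e ^ 2)) * w 1 = R - \<mu> * of_real (\<phi> 1 - 1) * w 1"
      unfolding R_def by (simp add: algebra_simps)
    moreover have "cmod (\<mu> * of_real (\<phi> 1 - 1) * w 1) \<le> (12 * e ^ 2) * (2 * e) * W"
      unfolding norm_mult norm_of_real using first \<phi>_on[of 1] w_le[OF ns(10)] e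
      by (intro mult_mono) (auto simp: anchor_def)
    ultimately show ?thesis using R norm_triangle_ineq4[of R "\<mu> * of_real (\<phi> 1 - 1) * w 1"]
      by (simp add: power2_eq_square mult.assoc mult.left_commute)
  qed
  also have "\<dots> \<le> (e * (e * W)) / 2" using small_powers by simp
  finally have "cmod (\<mu> - of_real (4 * s * e ^ 2)) * cmod (w 1) \<le> (e * (e * W)) / 2" by (simp only: norm_mult)
  moreover have "cmod (\<mu> - of_real (4 * s * e ^ 2)) * (W / 2) \<le> cmod (\<mu> - of_real (4 * s * e ^ 2)) * cmod (w 1)"
    using half by (intro mult_left_mono) auto
  ultimately have "cmod (\<mu> - of_real (4 * s * e ^ 2)) * W \<le> e * (e * W)" by linarith
  then have "cmod (\<mu> - of_real (4 * s * e ^ 2)) * W \<le> e ^ 2 * W"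
    by (simp only: power2_eq_square mult.assoc)
  then show ?thesis using W_pos by (simp only: mult_le_cancel_right_pos)
qed

end

end

lemma ring_op_odd:
  assumes "\<And>j. j \<in> ring_sites N \<Longrightarrow> a (- j) = a j" "\<And>j. j \<in> ring_sites N \<Longrightarrow> f (- j) = - f j"
    "j \<in> ring_sites N"
  shows "ring_op N e a f (- j) = - ring_op N e a f j"
proof -
  have "f (nxt N (- j)) = - f (prv N j)" "f (prv N (- j)) = - f (nxt N j)"
    using assms(2)[of "prv N j"] assms(2)[of "nxt N j"] nxt_uminus[OF assms(3)] prv_uminus[OF assms(3)] by auto
  then show ?thesis using assms by (simp add: ring_op_def lap_def algebra_simps)
qed

context standing_wave
begin

text \<open>
  Subtracting the right multiple of \<open>\<phi>\<close> makes a kernel element vanish at the site 1.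
\<close>

lemma Lm_kernel:
  fixes f :: "int \<Rightarrow> real"
  assumes "\<And>j. j \<in> ring_sites N \<Longrightarrow> Lm f j = 0" "j \<in> ring_sites N"
  shows "f j = f 1 / \<phi> 1 * \<phi> j"
proof -
  note ns = near_sites[OF N(1)]
  have \<phi>1: "\<phi> 1 \<noteq> 0" using near[OF ns(10)] by (auto simp: anchor_def)
  have "f j - f 1 / \<phi> 1 * \<phi> j = 0"
  proof (rule ring_op_kernel_trivial[OF N(1) e(1) _ _ _ _ assms(2), where a = "\<lambda>j. \<phi> j ^ 2"])
    show "\<bar>\<phi> i ^ 2\<bar> \<le> 1 / 100" if "i \<in> ring_sites N" "i \<noteq> 1" "i \<noteq> -1" for i
      using sq_off[OF that] e by simp
    show "Lm (\<lambda>j. f j - f 1 / \<phi> 1 * \<phi> j) i = 0" if "i \<in> ring_sites N" for i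
      unfolding ring_op_diff ring_op_scale using assms(1)[OF that] wave[OF that] by simp
  qed (use e \<phi>1 in auto)
  then show ?thesis by simp
qed

text \<open>
  For \<open>s = 1\<close> the profile is even, so \<open>B = L- L+\<close> preserves odd sequences. There only one degree of
  freedom sits on the excited sites, which separates the mode from the kernel \<open>\<phi>\<close>. Normalising
  \<open>w 1 = 1\<close>, the eigenvalue equation \<open>B w = (B w 1) w\<close> at the empty sites, where B is close to the
  identity, is a fixed point problem for a contraction. The eigenvalue is nonzero because the kernel of
  \<open>L-\<close> is even.
\<close>

lemma unstable_mode_exists:
  assumes s1: "s = 1"
  obtains v w :: "int \<Rightarrow> real" and \<mu> :: real where
    "\<And>j. j \<in> ring_sites N \<Longrightarrow> Lm v j = \<mu> * w j" "\<And>j. j \<in> ring_sites N \<Longrightarrow> Lp w j = - v j"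
    "w 1 = 1" "\<mu> \<noteq> 0" "\<bar>\<mu>\<bar> < 1 / 4"
proof -
  note ns = near_sites[OF N(1)]
  define B where "B f = (Lm (Lp f) :: int \<Rightarrow> real)" for f
  have B_diff: "B (\<lambda>i. f i - g i) j = B f j - B g j" for f g j
  proof -
    have "Lp (\<lambda>i. f i - g i) = (\<lambda>j. Lp f j - Lp g j)" by (rule ext) (rule ring_op_diff)
    then show ?thesis unfolding B_def by (simp only: ring_op_diff)
  qed
  have B_off: "\<bar>B f j - f j\<bar> \<le> 18 * (e * D)"
    if j: "j \<in> ring_sites N" "j \<noteq> 1" "j \<noteq> -1" and f: "\<And>i. \<bar>f i\<bar> \<le> D" for f j D
  proof -
    have fn: "norm (f i) \<le> D" for i using f by simp
    have a: "norm (Lm (Lp f) j + Lp f j) \<le> 13 * e * D"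
      by (rule Lm_off[OF j]) (rule Lp_le[OF _ fn])
    have b: "norm (Lp f j + f j) \<le> 5 * e * D" by (rule Lp_off[OF j fn])
    have "B f j - f j = (Lm (Lp f) j + Lp f j) - (Lp f j + f j)" by (simp add: B_def)
    then have "norm (B f j - f j) \<le> norm (Lm (Lp f) j + Lp f j) + norm (Lp f j + f j)"
      by (simp only: norm_triangle_ineq4)
    also have "\<dots> \<le> 13 * e * D + 5 * e * D" by (rule add_mono[OF a b])
    also have "\<dots> = 18 * (e * D)" by (simp add: algebra_simps)
    finally show ?thesis by simp
  qed
  have B_on: "\<bar>B f 1\<bar> \<le> 21 * (e * D)" if f: "\<And>i. \<bar>f i\<bar> \<le> D" for f D
  proof -
    have fn: "norm (f i) \<le> D" for i using f by simp
    have "norm (Lm (Lp f) 1) \<le> 21 * e * D"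
      by (rule Lm_on, simp, rule Lp_le[OF _ fn])
    then show ?thesis by (simp add: B_def)
  qed
  have B_odd: "B f (- j) = - B f j" if "\<And>i. i \<in> ring_sites N \<Longrightarrow> f (- i) = - f i" "j \<in> ring_sites N" for f j
    unfolding B_def by (intro ring_op_odd that) (auto simp: \<phi>_even[OF s1])
  define F where "F f j = (if j = 1 then 1 else if j = -1 then -1 else
    if j \<in> ring_sites N then f j - (B f j - B f 1 * f j) else 0)" for f :: "int \<Rightarrow> real" and j
  define X where "X = {f :: int \<Rightarrow> real. f 1 = 1 \<and> f (-1) = -1 \<and> (\<forall>j. \<bar>f j\<bar> \<le> 1)
    \<and> (\<forall>j\<in>ring_sites N. f (- j) = - f j)}"
  have start: "(\<lambda>j. if j = 1 then 1 else if j = -1 then -1 else 0) \<in> X"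
    by (auto simp: X_def)
  have maps: "F f \<in> X" if f: "f \<in> X" for f
  proof -
    have fb: "\<And>i. \<bar>f i\<bar> \<le> 1" and odd: "\<And>i. i \<in> ring_sites N \<Longrightarrow> f (- i) = - f i"
      using f by (auto simp: X_def)
    have "\<bar>F f j\<bar> \<le> 1" for j
    proof (cases "j \<in> ring_sites N \<and> j \<noteq> 1 \<and> j \<noteq> -1")
      case True
      have "\<bar>B f 1 * f j\<bar> \<le> 21 * (e * 1) * 1"
        unfolding abs_mult using B_on[of f 1, OF fb] fb[of j] e by (intro mult_mono) auto
      moreover have "\<bar>- (B f j - f j)\<bar> \<le> 18 * (e * 1)"
        unfolding abs_minus_cancel using True by (intro B_off fb) auto
      ultimately have "\<bar>B f 1 * f j + (- (B f j - f j))\<bar> \<le> 21 * (e * 1) * 1 + 18 * (e * 1)"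
        by (rule abs_add_le)
      moreover have "F f j = B f 1 * f j + (- (B f j - f j))" using True by (simp add: F_def)
      ultimately show ?thesis using e by simp
    qed (auto simp: F_def)
    moreover have "F f (- j) = - F f j" if j: "j \<in> ring_sites N" for j
      using odd[OF j] B_odd[of f j, OF odd j] j by (auto simp: F_def algebra_simps)
    ultimately show ?thesis by (auto simp: X_def F_def)
  qed
  have contr: "\<bar>F f j - F g j\<bar> \<le> D / 2"
    if f: "f \<in> X" and g: "g \<in> X" and D: "\<And>i. \<bar>f i - g i\<bar> \<le> D" for f g D j
  proof (cases "j \<in> ring_sites N \<and> j \<noteq> 1 \<and> j \<noteq> -1")
    case True
    have fb: "\<And>i. \<bar>f i\<bar> \<le> 1" and gb: "\<And>i. \<bar>g i\<bar> \<le> 1" using f g by (auto simp: X_def)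
    have D0: "D \<ge> 0" using D[of 0] by linarith
    have "F f j - F g j = (- (B f j - B g j - (f j - g j)) + (B f 1 - B g 1) * f j) + B g 1 * (f j - g j)"
      using True by (simp add: F_def algebra_simps)
    also have "\<bar>\<dots>\<bar> \<le> (18 * (e * D) + 21 * (e * D) * 1) + 21 * (e * 1) * D"
    proof (intro abs_add_le)
      show "\<bar>- (B f j - B g j - (f j - g j))\<bar> \<le> 18 * (e * D)"
        using B_off[of j "\<lambda>i. f i - g i" D] True D unfolding B_diff abs_minus_cancel by blast
      show "\<bar>(B f 1 - B g 1) * f j\<bar> \<le> 21 * (e * D) * 1"
        unfolding abs_mult using B_on[of "\<lambda>i. f i - g i" D, OF D] fb[of j] e D0
        unfolding B_diff by (intro mult_mono) auto
      show "\<bar>B g 1 * (f j - g j)\<bar> \<le> 21 * (e * 1) * D"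
        unfolding abs_mult using B_on[of g 1, OF gb] D[of j] e by (intro mult_mono) auto
    qed
    also have "\<dots> = (60 * e) * D" by simp
    also have "\<dots> \<le> (1 / 2) * D" using e D0 by (intro mult_right_mono) auto
    finally show ?thesis by simp
  next
    case False
    have "D \<ge> 0" using D[of 0] by linarith
    then show ?thesis using False by (auto simp: F_def)
  qed
  have "\<exists>w\<in>X. F w = w"
  proof (rule contraction_fixpoint[OF start, of F 1])
    show "f \<in> X" if u: "\<And>n::nat. u n \<in> X" and lim: "\<And>j. (\<lambda>n. u n j) \<longlonglongrightarrow> f j" for u f
    proof -
      have "f 1 = 1" using LIMSEQ_unique[OF lim[of 1], of 1] u by (simp add: X_def)
      moreover have "f (-1) = -1" using LIMSEQ_unique[OF lim[of "-1"], of "-1"] u by (simp add: X_def)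
      moreover have "\<bar>f j\<bar> \<le> 1" for j
      proof (rule LIMSEQ_le_const2)
        show "(\<lambda>n. \<bar>u n j\<bar>) \<longlonglongrightarrow> \<bar>f j\<bar>" by (intro tendsto_intros lim)
      qed (use u in \<open>auto simp: X_def\<close>)
      moreover have "f (- j) = - f j" if "j \<in> ring_sites N" for j
      proof (rule LIMSEQ_unique[OF lim])
        have "(\<lambda>n. - u n j) \<longlonglongrightarrow> - f j" by (intro tendsto_intros lim)
        then show "(\<lambda>n. u n (- j)) \<longlonglongrightarrow> - f j" using u that by (simp add: X_def)
      qed
      ultimately show ?thesis by (auto simp: X_def)
    qed
    show "\<bar>f j\<bar> \<le> 1" if "f \<in> X" for f j using that by (simp add: X_def)
  qed (use maps contr in auto)
  then obtain w where w: "w \<in> X" "F w = w" by blast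
  have w1: "w 1 = 1" "w (-1) = -1" and wb: "\<And>i. \<bar>w i\<bar> \<le> 1"
    and odd: "\<And>i. i \<in> ring_sites N \<Longrightarrow> w (- i) = - w i" using w(1) by (auto simp: X_def)
  have Bw: "B w j = B w 1 * w j" if j: "j \<in> ring_sites N" for j
  proof -
    consider "j = 1" | "j = -1" | "j \<noteq> 1" "j \<noteq> -1" by blast
    then show ?thesis
    proof cases
      case 2
      then show ?thesis using B_odd[of w 1, OF odd ns(10)] w1 by simp
    next
      case 3
      then show ?thesis using fun_cong[OF w(2), of j] j by (simp add: F_def)
    qed (simp add: w1)
  qed
  define v where "v j = - Lp w j" for j
  have Lmv: "Lm v j = - B w j" for j
  proof -
    have "v = (\<lambda>j. -1 * Lp w j)" by (auto simp: v_def)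
    then show ?thesis unfolding B_def by (simp only: ring_op_scale)
  qed
  show thesis
  proof (rule that[of v "- B w 1" w])
    show "Lm v j = - B w 1 * w j" if "j \<in> ring_sites N" for j using Lmv Bw[OF that] by simp
    show "Lp w j = - v j" for j by (simp add: v_def)
    show "\<bar>- B w 1\<bar> < 1 / 4" using B_on[of w 1, OF wb] e by simp
    show "- B w 1 \<noteq> 0"
    proof
      assume z: "- B w 1 = 0"
      have "v j = v 1 / \<phi> 1 * \<phi> j" if "j \<in> ring_sites N" for j
        by (rule Lm_kernel[OF _ that]) (use z Bw Lmv in simp)
      from this[OF ns(14)] have "v (-1) = v 1 / \<phi> 1 * \<phi> 1" using \<phi>_even[OF s1 ns(10)] by simp
      moreover have "\<phi> 1 \<noteq> 0" using near[OF ns(10)] by (auto simp: anchor_def)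
      moreover have "v (-1) = - v 1"
        unfolding v_def using ring_op_odd[of N "\<lambda>j. 3 * \<phi> j ^ 2" w 1 e, OF _ odd ns(10)] \<phi>_even[OF s1] by simp
      ultimately have v1: "v 1 = 0" by simp
      have "norm (Lp w 1 - 2 * w 1) \<le> 13 * e * 1"
        by (rule Lp_on) (use wb in auto)
      then show False using v1 w1 e by (simp add: v_def)
    qed
  qed (rule w1)
qed

section \<open>Floquet multipliers of the standing wave\<close>

text \<open>
  Coordinates adapted to the phase of the wave: for real U and V this is, up to the factor \<open>sqrt 2\<close>,
  the configuration \<open>exp (- \<i> \<alpha>) (U + \<i> V)\<close>. The explicit form is linear over the complex numbers as well,
  which is what the eigenvalue problem for the complexified matrix needs.
\<close>

definition phase_vec :: "real \<Rightarrow> (int \<Rightarrow> 'a::real_normed_field) \<Rightarrow> (int \<Rightarrow> 'a) \<Rightarrow> 'a vec" where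
  "phase_vec \<alpha> U V = Matrix.vec (phase_dim N) (\<lambda>k. if k < 2 * N + 1
     then of_real (cos \<alpha>) * U (coord_site N k) + of_real (sin \<alpha>) * V (coord_site N k)
     else of_real (cos \<alpha>) * V (coord_site N k) - of_real (sin \<alpha>) * U (coord_site N k))"

lemma phase_vec_carrier [simp]: "phase_vec \<alpha> U V \<in> carrier_vec (phase_dim N)"
  unfolding phase_vec_def by (rule vec_carrier)

lemma dim_phase_vec [simp]: "dim_vec (phase_vec \<alpha> U V) = phase_dim N"
  by (simp add: phase_vec_def)

lemma phase_vec_cong:
  assumes "\<And>j. j \<in> ring_sites N \<Longrightarrow> U j = U' j" "\<And>j. j \<in> ring_sites N \<Longrightarrow> V j = V' j"
  shows "phase_vec \<alpha> U V = phase_vec \<alpha> U' V'"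
  by (rule eq_vecI) (use assms in \<open>auto simp: phase_vec_def coord_site_in_ring\<close>)

lemma phase_vec_real:
  "phase_vec \<alpha> U V = real_coords N (\<lambda>j. exp (- \<i> * of_real \<alpha>) * (of_real (U j) + \<i> * of_real (V j)) / of_real (sqrt 2))"
proof (rule eq_vecI)
  have ex: "exp (- \<i> * of_real \<alpha>) = Complex (cos \<alpha>) (- sin \<alpha>)" for \<alpha>
    by (simp add: complex_eq_iff Re_exp Im_exp)
  have r: "sqrt 2 * (x / sqrt 2) = x" for x :: real by simp
  fix k assume "k < dim_vec (real_coords N (\<lambda>j. exp (- \<i> * of_real \<alpha>) * (of_real (U j) + \<i> * of_real (V j)) / of_real (sqrt 2)))"
  then have k: "k < phase_dim N" by simp
  show "phase_vec \<alpha> U V $ k = real_coords N (\<lambda>j. exp (- \<i> * of_real \<alpha>) * (of_real (U j) + \<i> * of_real (V j)) / of_real (sqrt 2)) $ k"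
    unfolding real_coords_index[OF k] ex times_divide_eq_right Re_divide_of_real r
    using k by (simp add: phase_vec_def coord_dir_def)
qed simp

lemma phase_vec_at_site:
  assumes "j \<in> ring_sites N"
  shows "phase_vec \<alpha> U V $ nat (j + int N) = of_real (cos \<alpha>) * U j + of_real (sin \<alpha>) * V j"
    "phase_vec \<alpha> U V $ (2 * N + 1 + nat (j + int N)) = of_real (cos \<alpha>) * V j - of_real (sin \<alpha>) * U j"
proof -
  have p: "nat (j + int N) < 2 * N + 1" "int (nat (j + int N)) - int N = j"
    using assms by (auto simp: ring_sites_def)
  then have "coord_site N (nat (j + int N)) = j" "coord_site N (2 * N + 1 + nat (j + int N)) = j"
    "nat (j + int N) < phase_dim N" "2 * N + 1 + nat (j + int N) < phase_dim N"
    by (auto simp: coord_site_def phase_dim_def)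
  then show "phase_vec \<alpha> U V $ nat (j + int N) = of_real (cos \<alpha>) * U j + of_real (sin \<alpha>) * V j"
    "phase_vec \<alpha> U V $ (2 * N + 1 + nat (j + int N)) = of_real (cos \<alpha>) * V j - of_real (sin \<alpha>) * U j"
    using p by (simp_all add: phase_vec_def)
qed

lemma rotation_inverse:
  fixes a b :: "'a::real_normed_field"
  shows "of_real (cos \<alpha>) * (of_real (cos \<alpha>) * a + of_real (sin \<alpha>) * b)
      - of_real (sin \<alpha>) * (of_real (cos \<alpha>) * b - of_real (sin \<alpha>) * a) = a"
    "of_real (sin \<alpha>) * (of_real (cos \<alpha>) * a + of_real (sin \<alpha>) * b)
      + of_real (cos \<alpha>) * (of_real (cos \<alpha>) * b - of_real (sin \<alpha>) * a) = b"
proof -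
  have c: "(of_real (cos \<alpha>) :: 'a) * of_real (cos \<alpha>) + of_real (sin \<alpha>) * of_real (sin \<alpha>) = 1"
    unfolding of_real_mult[symmetric] of_real_add[symmetric]
    using sin_cos_squared_add3[of \<alpha>] by simp
  have "of_real (cos \<alpha>) * (of_real (cos \<alpha>) * a + of_real (sin \<alpha>) * b)
      - of_real (sin \<alpha>) * (of_real (cos \<alpha>) * b - of_real (sin \<alpha>) * a)
      = (of_real (cos \<alpha>) * of_real (cos \<alpha>) + of_real (sin \<alpha>) * of_real (sin \<alpha>)) * a"
    by (simp add: algebra_simps)
  then show "of_real (cos \<alpha>) * (of_real (cos \<alpha>) * a + of_real (sin \<alpha>) * b)
      - of_real (sin \<alpha>) * (of_real (cos \<alpha>) * b - of_real (sin \<alpha>) * a) = a" unfolding c by simp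
  have "of_real (sin \<alpha>) * (of_real (cos \<alpha>) * a + of_real (sin \<alpha>) * b)
      + of_real (cos \<alpha>) * (of_real (cos \<alpha>) * b - of_real (sin \<alpha>) * a)
      = (of_real (cos \<alpha>) * of_real (cos \<alpha>) + of_real (sin \<alpha>) * of_real (sin \<alpha>)) * b"
    by (simp add: algebra_simps)
  then show "of_real (sin \<alpha>) * (of_real (cos \<alpha>) * a + of_real (sin \<alpha>) * b)
      + of_real (cos \<alpha>) * (of_real (cos \<alpha>) * b - of_real (sin \<alpha>) * a) = b" unfolding c by simp
qed

lemma phase_vec_inverse:
  assumes "j \<in> ring_sites N"
  shows "U j = of_real (cos \<alpha>) * phase_vec \<alpha> U V $ nat (j + int N)
      - of_real (sin \<alpha>) * phase_vec \<alpha> U V $ (2 * N + 1 + nat (j + int N))"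
    "V j = of_real (sin \<alpha>) * phase_vec \<alpha> U V $ nat (j + int N)
      + of_real (cos \<alpha>) * phase_vec \<alpha> U V $ (2 * N + 1 + nat (j + int N))"
  by (simp_all only: phase_vec_at_site[OF assms] rotation_inverse)

lemma phase_vec_inject:
  assumes "phase_vec \<alpha> U V = phase_vec \<alpha> U' V'" "j \<in> ring_sites N"
  shows "U j = U' j" "V j = V' j"
  using phase_vec_inverse(1)[OF assms(2), of U \<alpha> V] phase_vec_inverse(1)[OF assms(2), of U' \<alpha> V']
    phase_vec_inverse(2)[OF assms(2), of V \<alpha> U] phase_vec_inverse(2)[OF assms(2), of V' \<alpha> U']
  unfolding assms(1) by simp_all

lemma phase_vec_surj:
  fixes z :: "'a::real_normed_field vec"
  assumes "z \<in> carrier_vec (phase_dim N)"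
  obtains U V where "z = phase_vec \<alpha> U V"
proof
  define x where "x j = z $ nat (j + int N)" for j
  define y where "y j = z $ (2 * N + 1 + nat (j + int N))" for j
  define U where "U j = of_real (cos (- \<alpha>)) * x j + of_real (sin (- \<alpha>)) * y j" for j
  define V where "V j = of_real (cos (- \<alpha>)) * y j - of_real (sin (- \<alpha>)) * x j" for j
  have inv: "of_real (cos \<alpha>) * U j + of_real (sin \<alpha>) * V j = x j"
    "of_real (cos \<alpha>) * V j - of_real (sin \<alpha>) * U j = y j" for j
    using rotation_inverse[of "- \<alpha>" "x j" "y j"] unfolding U_def V_def
    by (simp_all add: algebra_simps)
  show "z = phase_vec \<alpha> U V"
  proof (rule eq_vecI)
    fix k assume "k < dim_vec (phase_vec \<alpha> U V)"
    then have k: "k < phase_dim N" by simp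
    show "z $ k = phase_vec \<alpha> U V $ k"
    proof (cases "k < 2 * N + 1")
      case True
      then show ?thesis using k by (simp add: phase_vec_def inv x_def coord_site_def)
    next
      case False
      define p where "p = k - (2 * N + 1)"
      have kp: "k = 2 * N + 1 + p" using False by (simp add: p_def)
      show ?thesis using k unfolding kp by (simp add: phase_vec_def inv y_def coord_site_def)
    qed
  qed (use assms in simp)
qed

lemma smult_phase_vec: "c \<cdot>\<^sub>v phase_vec \<alpha> U V = phase_vec \<alpha> (\<lambda>j. c * U j) (\<lambda>j. c * V j)"
  by (rule eq_vecI) (auto simp: phase_vec_def algebra_simps)

lemma zero_phase_vec: "0\<^sub>v (phase_dim N) = phase_vec \<alpha> (\<lambda>j. 0) (\<lambda>j. 0)"
  by (rule eq_vecI) (auto simp: phase_vec_def)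

lemma phase_vec_Re_Im:
  "phase_vec \<alpha> U V = map_vec complex_of_real (phase_vec \<alpha> (\<lambda>j. Re (U j)) (\<lambda>j. Re (V j)))
     + \<i> \<cdot>\<^sub>v map_vec complex_of_real (phase_vec \<alpha> (\<lambda>j. Im (U j)) (\<lambda>j. Im (V j)))"
  by (rule eq_vecI) (auto simp: phase_vec_def complex_eq_iff)

context
  fixes I \<omega> \<alpha> \<epsilon> :: real and \<phi>c :: "int \<Rightarrow> complex"
  assumes I: "I > 0" and \<omega>: "\<omega> = 1 + I" and \<epsilon>: "\<epsilon> = I * e"
    and \<phi>c: "\<And>j. j \<in> ring_sites N \<Longrightarrow> \<phi>c j = exp (- \<i> * of_real \<alpha>) * of_real (sqrt I * \<phi> j)"
begin

lemma rotating_mat_real: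
  fixes U V :: "int \<Rightarrow> real"
  shows "rotating_mat N \<epsilon> \<omega> \<phi>c *\<^sub>v phase_vec \<alpha> U V
    = phase_vec \<alpha> (\<lambda>j. I * Lm V j) (\<lambda>j. - I * Lp U j)"
proof -
  define x where "x = exp (- \<i> * complex_of_real \<alpha>)"
  have x1: "cmod x = 1" by (simp add: x_def norm_exp_eq_Re)
  define h where "h j = (of_real (U j) + \<i> * of_real (V j)) / complex_of_real (sqrt 2)" for j
  have pv: "phase_vec \<alpha> U V = real_coords N (\<lambda>j. x * h j)"
    unfolding phase_vec_real x_def h_def by simp
  have "rotating_mat N \<epsilon> \<omega> \<phi>c *\<^sub>v phase_vec \<alpha> U V = real_coords N (\<lambda>j. - \<i> *
      (dnls_field_deriv N \<epsilon> \<phi>c (of_real_coords N (phase_vec \<alpha> U V)) j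
        - of_real \<omega> * of_real_coords N (phase_vec \<alpha> U V) j))"
    by (rule rotating_mat_action) simp
  also have "\<dots> = real_coords N (\<lambda>j. x * (of_real (I * Lm V j) + \<i> * of_real (- I * Lp U j)) / of_real (sqrt 2))"
  proof (rule real_coords_cong)
    fix j assume j: "j \<in> ring_sites N"
    have "dnls_field_deriv N \<epsilon> \<phi>c (of_real_coords N (phase_vec \<alpha> U V)) j
        = dnls_field_deriv N \<epsilon> (\<lambda>j. x * of_real (sqrt I * \<phi> j)) (\<lambda>j. x * h j) j"
      by (rule dnls_field_deriv_cong[OF j]) (simp_all only: \<phi>c x_def[symmetric] pv of_real_coords_real_coords)
    also have "\<dots> = x * dnls_field_deriv N \<epsilon> (\<lambda>j. of_real (sqrt I * \<phi> j)) h j"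
      by (rule dnls_field_deriv_rotate[OF x1])
    finally have a: "dnls_field_deriv N \<epsilon> \<phi>c (of_real_coords N (phase_vec \<alpha> U V)) j
        - of_real \<omega> * of_real_coords N (phase_vec \<alpha> U V) j
        = x * (dnls_field_deriv N \<epsilon> (\<lambda>j. of_real (sqrt I * \<phi> j)) h j - of_real \<omega> * h j)"
      using j by (simp add: pv algebra_simps)
    have r: "sqrt I * sqrt I = I" using I by simp
    have sq: "(sqrt I * \<phi> j) ^ 2 = I * \<phi> j ^ 2" using I by (simp add: power_mult_distrib)
    have "- \<i> * (dnls_field_deriv N \<epsilon> (\<lambda>j. of_real (sqrt I * \<phi> j)) h j - of_real \<omega> * h j)
        = (of_real (I * Lm V j) + \<i> * of_real (- I * Lp U j)) / of_real (sqrt 2)"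
    proof -
      have hj: "h j = (of_real (U j) + \<i> * of_real (V j)) / complex_of_real (sqrt 2)"
        by (simp add: h_def)
      have hc: "cnj (h j) = (of_real (U j) - \<i> * of_real (V j)) / complex_of_real (sqrt 2)"
        by (simp add: h_def)
      have hl: "lap N h j = (of_real (lap N U j) + \<i> * of_real (lap N V j)) / complex_of_real (sqrt 2)"
        by (simp add: h_def lap_def field_simps)
      have q1: "cmod (of_real (sqrt I * \<phi> j)) ^ 2 = I * \<phi> j ^ 2"
        unfolding norm_of_real power2_abs by (rule sq)
      have q2: "complex_of_real (sqrt I * \<phi> j) ^ 2 = of_real (I * \<phi> j ^ 2)"
        unfolding of_real_power[symmetric] sq ..
      have "dnls_field_deriv N \<epsilon> (\<lambda>j. of_real (sqrt I * \<phi> j)) h j - of_real \<omega> * h j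
        = (of_real (I * Lp U j) + \<i> * of_real (I * Lm V j)) / complex_of_real (sqrt 2)"
        unfolding dnls_field_deriv_def q1 q2 hc hl unfolding hj
        by (simp add: \<omega> \<epsilon> ring_op_def add_divide_distrib diff_divide_distrib algebra_simps)
      then show ?thesis by (simp add: algebra_simps)
    qed
    note core = this
    show "- \<i> * (dnls_field_deriv N \<epsilon> \<phi>c (of_real_coords N (phase_vec \<alpha> U V)) j
        - of_real \<omega> * of_real_coords N (phase_vec \<alpha> U V) j)
        = x * (of_real (I * Lm V j) + \<i> * of_real (- I * Lp U j)) / of_real (sqrt 2)"
      unfolding a mult.left_commute[of "- \<i>" x] core times_divide_eq_right ..
  qed
  finally show ?thesis unfolding phase_vec_real x_def .
qed

text \<open>
  Both sides are complex linear in the pair of U and V, so the real case suffices.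
\<close>

lemma rotating_mat_complex:
  fixes U V :: "int \<Rightarrow> complex"
  shows "map_mat complex_of_real (rotating_mat N \<epsilon> \<omega> \<phi>c) *\<^sub>v phase_vec \<alpha> U V
    = phase_vec \<alpha> (\<lambda>j. of_real I * Lm V j) (\<lambda>j. - of_real I * Lp U j)"
proof -
  let ?A = "rotating_mat N \<epsilon> \<omega> \<phi>c"
  have A: "?A \<in> carrier_mat (phase_dim N) (phase_dim N)" by simp
  have Ac: "map_mat complex_of_real ?A \<in> carrier_mat (phase_dim N) (phase_dim N)" by simp
  have m: "map_mat complex_of_real ?A *\<^sub>v map_vec complex_of_real w = map_vec complex_of_real (?A *\<^sub>v w)"
    if "w \<in> carrier_vec (phase_dim N)" for w
    by (rule of_real_hom.mult_mat_vec_hom[OF A that, symmetric])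
  have "map_mat complex_of_real ?A *\<^sub>v phase_vec \<alpha> U V
      = map_vec complex_of_real (?A *\<^sub>v phase_vec \<alpha> (\<lambda>j. Re (U j)) (\<lambda>j. Re (V j)))
      + \<i> \<cdot>\<^sub>v map_vec complex_of_real (?A *\<^sub>v phase_vec \<alpha> (\<lambda>j. Im (U j)) (\<lambda>j. Im (V j)))"
    unfolding phase_vec_Re_Im[of \<alpha> U V]
    by (subst mult_add_distrib_mat_vec[OF Ac]) (auto simp: mult_mat_vec[OF Ac] m)
  also have "\<dots> = phase_vec \<alpha> (\<lambda>j. of_real I * Lm V j) (\<lambda>j. - of_real I * Lp U j)"
    unfolding rotating_mat_real phase_vec_Re_Im[of \<alpha> "\<lambda>j. of_real I * Lm V j"]
    by (simp add: ring_op_def lap_def)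
  finally show ?thesis .
qed

lemma eigenvalue_rotating_mat:
  "eigenvalue (map_mat complex_of_real (rotating_mat N \<epsilon> \<omega> \<phi>c)) \<nu> \<longleftrightarrow>
    (\<exists>U V. (\<exists>j\<in>ring_sites N. U j \<noteq> 0 \<or> V j \<noteq> 0) \<and>
      (\<forall>j\<in>ring_sites N. of_real I * Lm V j = \<nu> * U j \<and> - of_real I * Lp U j = \<nu> * V j))"
  (is "?L \<longleftrightarrow> ?R")
proof
  let ?A = "map_mat complex_of_real (rotating_mat N \<epsilon> \<omega> \<phi>c)"
  have dim: "dim_row ?A = phase_dim N" using carrier_matD[OF rotating_mat_carrier[of N \<epsilon> \<omega> \<phi>c]] by simp
  {
    assume ?L
    then obtain z where z: "z \<in> carrier_vec (phase_dim N)" "z \<noteq> 0\<^sub>v (phase_dim N)" "?A *\<^sub>v z = \<nu> \<cdot>\<^sub>v z"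
      unfolding eigenvalue_def eigenvector_def dim by blast
    obtain U V where uv: "z = phase_vec \<alpha> U V" using phase_vec_surj[OF z(1)] .
    have "\<exists>j\<in>ring_sites N. U j \<noteq> 0 \<or> V j \<noteq> 0"
    proof (rule ccontr)
      assume "\<not> ?thesis"
      then have "phase_vec \<alpha> U V = phase_vec \<alpha> (\<lambda>j. 0) (\<lambda>j. 0)" by (intro phase_vec_cong) auto
      then show False using z(2) unfolding uv zero_phase_vec[of \<alpha>] by simp
    qed
    moreover have "of_real I * Lm V j = \<nu> * U j \<and> - of_real I * Lp U j = \<nu> * V j" if "j \<in> ring_sites N" for j
      using z(3) phase_vec_inject[OF _ that] unfolding uv rotating_mat_complex smult_phase_vec by blast
    ultimately show ?R by blast
  next
    assume ?R
    then obtain U V where nz: "\<exists>j\<in>ring_sites N. U j \<noteq> 0 \<or> V j \<noteq> 0"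
      and eq: "\<And>j. j \<in> ring_sites N \<Longrightarrow> of_real I * Lm V j = \<nu> * U j \<and> - of_real I * Lp U j = \<nu> * V j" by blast
    have "?A *\<^sub>v phase_vec \<alpha> U V = \<nu> \<cdot>\<^sub>v phase_vec \<alpha> U V"
      unfolding rotating_mat_complex smult_phase_vec by (rule phase_vec_cong) (use eq in auto)
    moreover have "phase_vec \<alpha> U V \<noteq> 0\<^sub>v (phase_dim N)"
      using nz phase_vec_inject[of \<alpha> U V "\<lambda>j. 0" "\<lambda>j. 0"] unfolding zero_phase_vec[of \<alpha>] by blast
    ultimately show ?L unfolding eigenvalue_def eigenvector_def dim using phase_vec_carrier by blast
  }
qed

text \<open>
  Up to the factor \<open>I^2\<close>, the square of a nonzero eigenvalue is one of the numbers \<open>\<mu>\<close>, and these are negative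
  in both ranges.
\<close>

lemma antisymmetric_spectrum:
  assumes s: "s = -1" and ev: "eigenvalue (map_mat complex_of_real (rotating_mat N \<epsilon> \<omega> \<phi>c)) \<nu>"
  shows "Re \<nu> = 0"
proof (cases "\<nu> = 0")
  case False
  obtain U V where nz: "\<exists>j\<in>ring_sites N. U j \<noteq> 0 \<or> V j \<noteq> 0"
    and eq: "\<And>j. j \<in> ring_sites N \<Longrightarrow> of_real I * Lm V j = \<nu> * U j \<and> - of_real I * Lp U j = \<nu> * V j"
    using ev unfolding eigenvalue_rotating_mat by blast
  define x where "x = \<nu> / of_real I"
  have x0: "x \<noteq> 0" using False I by (simp add: x_def)
  have LmV: "Lm V j = x * U j" and LpU: "Lp U j = - x * V j" if "j \<in> ring_sites N" for j
  proof -
    have I0: "complex_of_real I \<noteq> 0" using I by simp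
    have "of_real I * Lm V j = of_real I * (x * U j)" "of_real I * Lp U j = of_real I * (- x * V j)"
      using eq[OF that] I0 by (auto simp: x_def minus_equation_iff)
    then show "Lm V j = x * U j" "Lp U j = - x * V j" using I0 by (simp_all only: mult_cancel_left) auto
  qed
  interpret m: wave_mode N e s \<phi> V "\<lambda>j. 1 / x * U j" "x ^ 2"
  proof
    show "Lm V j = x\<^sup>2 * (1 / x * U j)" if "j \<in> ring_sites N" for j
      using LmV[OF that] x0 by (simp add: power2_eq_square)
    show "Lp (\<lambda>j. 1 / x * U j) j = - V j" if "j \<in> ring_sites N" for j
      unfolding ring_op_scale using LpU[OF that] x0 by simp
    show "\<exists>j\<in>ring_sites N. 1 / x * U j \<noteq> 0"
    proof (rule ccontr)
      assume "\<not> ?thesis"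
      then have U0: "U j = 0" if "j \<in> ring_sites N" for j using x0 that by auto
      then have "Lp U j = 0" if "j \<in> ring_sites N" for j
        using that by (simp add: ring_op_def lap_def)
      then have "V j = 0" if "j \<in> ring_sites N" for j using LpU[OF that] x0 that by simp
      then show False using nz U0 by blast
    qed
  qed
  have neg: "Re (x ^ 2) < 0 \<and> Im (x ^ 2) = 0"
  proof (cases "cmod (x ^ 2) < 1 / 4")
    case True
    have "cmod (x ^ 2 - of_real (4 * s * e ^ 2)) \<le> e ^ 2"
      by (rule m.small_mode_value[OF True]) (use x0 in simp)
    then have "\<bar>Re (x ^ 2 - of_real (4 * s * e ^ 2))\<bar> \<le> e ^ 2"
      using abs_Re_le_cmod order_trans by blast
    then have "\<bar>Re (x ^ 2) + 4 * e ^ 2\<bar> \<le> e ^ 2" using s by simp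
    moreover have "e ^ 2 > 0" using e by simp
    ultimately show ?thesis using m.small_mode_real[OF True] by linarith
  next
    case False
    then show ?thesis using m.large_mode by simp
  qed
  have "Re x = 0"
  proof (rule ccontr)
    assume "Re x \<noteq> 0"
    then have "Im x = 0" using neg by (auto simp: power2_eq_square)
    then have "Re x * Re x < 0" using neg by (simp add: power2_eq_square)
    then show False using zero_le_square[of "Re x"] by linarith
  qed
  then show ?thesis using I by (simp add: x_def)
qed simp

lemma symmetric_spectrum:
  assumes s: "s = 1"
  shows "\<exists>\<nu>. eigenvalue (map_mat complex_of_real (rotating_mat N \<epsilon> \<omega> \<phi>c)) \<nu> \<and> Re \<nu> > 0"
proof -
  note ns = near_sites[OF N(1)]
  obtain v w :: "int \<Rightarrow> real" and \<mu> :: real where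
    m: "\<And>j. j \<in> ring_sites N \<Longrightarrow> Lm v j = \<mu> * w j" "\<And>j. j \<in> ring_sites N \<Longrightarrow> Lp w j = - v j"
    "w 1 = 1" "\<mu> \<noteq> 0" "\<bar>\<mu>\<bar> < 1 / 4" by (rule unstable_mode_exists[OF s], rule that)
  interpret m: wave_mode N e s \<phi> "\<lambda>j. of_real (v j)" "\<lambda>j. of_real (w j)" "of_real \<mu>"
  proof
    show "Lm (\<lambda>j. complex_of_real (v j)) j = of_real \<mu> * of_real (w j)" if "j \<in> ring_sites N" for j
      unfolding ring_op_of_real m(1)[OF that] by simp
    show "Lp (\<lambda>j. complex_of_real (w j)) j = - of_real (v j)" if "j \<in> ring_sites N" for j
      unfolding ring_op_of_real m(2)[OF that] by simp
    show "\<exists>j\<in>ring_sites N. complex_of_real (w j) \<noteq> 0" using m(3) ns(10) by (intro bexI[of _ 1]) auto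
  qed
  have "cmod (of_real \<mu> - of_real (4 * s * e ^ 2)) \<le> e ^ 2"
    by (rule m.small_mode_value) (use m in auto)
  then have "\<bar>\<mu> - 4 * e ^ 2\<bar> \<le> e ^ 2"
    unfolding of_real_diff[symmetric] norm_of_real using s by simp
  moreover have "e ^ 2 > 0" using e by simp
  ultimately have \<mu>: "\<mu> > 0" by linarith
  define r where "r = sqrt \<mu>"
  have r: "r > 0" "r * r = \<mu>" using \<mu> by (auto simp: r_def)
  have "eigenvalue (map_mat complex_of_real (rotating_mat N \<epsilon> \<omega> \<phi>c)) (of_real (I * r))"
    unfolding eigenvalue_rotating_mat
  proof (intro exI conjI ballI)
    show "\<exists>j\<in>ring_sites N. of_real r * complex_of_real (w j) \<noteq> 0 \<or> complex_of_real (v j) \<noteq> 0"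
      using m(3) ns(10) r by (intro bexI[of _ 1]) auto
    fix j assume j: "j \<in> ring_sites N"
    show "of_real I * Lm (\<lambda>j. complex_of_real (v j)) j = of_real (I * r) * (of_real r * of_real (w j))"
      unfolding ring_op_of_real m(1)[OF j] r(2)[symmetric] by simp
    show "- of_real I * Lp (\<lambda>j. of_real r * complex_of_real (w j)) j = of_real (I * r) * of_real (v j)"
      unfolding ring_op_scale ring_op_of_real m(2)[OF j] by simp
  qed
  then show ?thesis using I r by (intro exI[of _ "of_real (I * r)"]) auto
qed

end

end

section \<open>From periodic solutions to standing waves\<close>

lemma stationary_iff:
  "dnls_field N \<epsilon> u j = of_real (1 + I) * u j \<longleftrightarrow>
    of_real (cmod (u j) ^ 2 - I) * u j + of_real \<epsilon> * lap N u j = 0"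
  by (simp add: dnls_field_def algebra_simps)

text \<open>
  The function in question solves the stationary equation with \<open>|u|^2\<close> as a given real potential,
  and it vanishes at the site 1.
\<close>

lemma phase_locked:
  fixes u :: "int \<Rightarrow> complex"
  assumes N: "6 \<le> N" and I: "I > 0" and \<epsilon>: "0 < \<epsilon>" "\<epsilon> \<le> I / 100"
    and stat: "\<And>j. j \<in> ring_sites N \<Longrightarrow> dnls_field N \<epsilon> u j = of_real (1 + I) * u j"
    and off: "\<And>j. j \<in> ring_sites N \<Longrightarrow> j \<noteq> 1 \<Longrightarrow> j \<noteq> -1 \<Longrightarrow> cmod (u j) \<le> sqrt I / 10"
    and j: "j \<in> ring_sites N"
  shows "Im (cnj (u 1) * u j) = 0"
proof -
  define y where "y j = Im (cnj (u 1) * u j)" for j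
  have "y j = 0"
  proof (rule ring_op_kernel_trivial[OF N _ _ _ _ _ j, where e = "\<epsilon> / I" and a = "\<lambda>j. cmod (u j) ^ 2 / I"])
    show "0 < \<epsilon> / I" "\<epsilon> / I \<le> 1 / 100" using \<epsilon> I by (auto simp: field_simps)
    show "\<bar>cmod (u i) ^ 2 / I\<bar> \<le> 1 / 100" if "i \<in> ring_sites N" "i \<noteq> 1" "i \<noteq> -1" for i
    proof -
      have "cmod (u i) ^ 2 \<le> (sqrt I / 10) ^ 2" using off[OF that] by (intro power_mono) auto
      then show ?thesis using I by (simp add: power_divide field_simps)
    qed
    show "y 1 = 0" by (simp add: y_def)
    show "ring_op N (\<epsilon> / I) (\<lambda>j. cmod (u j) ^ 2 / I) y i = 0" if i: "i \<in> ring_sites N" for i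
    proof -
      have l: "lap N y i = Im (cnj (u 1) * lap N u i)" by (simp add: y_def lap_def algebra_simps)
      have "I * ring_op N (\<epsilon> / I) (\<lambda>j. cmod (u j) ^ 2 / I) y i
          = Im (cnj (u 1) * (of_real (cmod (u i) ^ 2 - I) * u i + of_real \<epsilon> * lap N u i))"
        using I by (simp add: ring_op_def l y_def algebra_simps)
      also have "\<dots> = 0" using stat[OF i] unfolding stationary_iff by simp
      finally show ?thesis using I by simp
    qed
  qed
  then show ?thesis by (simp add: y_def)
qed

text \<open>
  Dividing by the phase of \<open>u 1\<close> makes u real; dividing by \<open>sqrt I\<close> scales the action to 1.
\<close>

lemma standing_wave_of_stationary:
  fixes u :: "int \<Rightarrow> complex"
  assumes N: "6 \<le> N" "N \<le> 10" and I: "I > 0" and \<epsilon>: "0 < \<epsilon>" "\<epsilon> \<le> I / 1000000" and s: "s = 1 \<or> s = -1"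
    and stat: "\<And>j. j \<in> ring_sites N \<Longrightarrow> dnls_field N \<epsilon> u j = of_real (1 + I) * u j"
    and near: "\<And>j. j \<in> ring_sites N \<Longrightarrow> cmod (u j - orbit_profile I \<theta> j) \<le> sqrt I / 100"
    and phases: "orbit_profile I \<theta> (-1) = of_real s * orbit_profile I \<theta> 1"
  shows "\<exists>\<alpha> \<phi>. standing_wave N (\<epsilon> / I) s \<phi> \<and>
    (\<forall>j\<in>ring_sites N. u j = exp (- \<i> * of_real \<alpha>) * of_real (sqrt I * \<phi> j))"
proof -
  note ns = near_sites[OF N(1)]
  define r where "r = sqrt I"
  have r: "r > 0" "r * r = I" using I by (auto simp: r_def)
  have p1: "cmod (orbit_profile I \<theta> 1) = r"
    using I by (simp add: orbit_profile_def norm_mult norm_exp_eq_Re r_def)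
  have u1: "\<bar>cmod (u 1) - r\<bar> \<le> r / 100"
    using near[OF ns(10)] norm_triangle_ineq3[of "u 1" "orbit_profile I \<theta> 1"] unfolding p1 r_def by linarith
  then have u10: "cmod (u 1) > 0" using r by linarith
  have off: "cmod (u j) \<le> r / 100" if "j \<in> ring_sites N" "j \<noteq> 1" "j \<noteq> -1" for j
    using near[OF that(1)] that by (simp add: orbit_profile_def r_def)
  define x where "x = sgn (u 1)"
  define \<alpha> where "\<alpha> = - Arg (u 1)"
  have x: "x = exp (- \<i> * of_real \<alpha>)"
    using cis_Arg[of "u 1"] u10 by (simp add: x_def \<alpha>_def cis_conv_exp)
  have x1: "cmod x = 1" using u10 by (simp add: x_def norm_sgn)
  define \<rho> where "\<rho> j = Re (cnj (u 1) * u j) / cmod (u 1)" for j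
  have u: "u j = x * of_real (\<rho> j)" if j: "j \<in> ring_sites N" for j
  proof -
    have "Im (cnj (u 1) * u j) = 0"
    proof (rule phase_locked[of N I \<epsilon> u j, OF N(1) I \<epsilon>(1) _ stat _ j])
      show "\<epsilon> \<le> I / 100" using \<epsilon> I by simp
      show "cmod (u j) \<le> sqrt I / 10" if "j \<in> ring_sites N" "j \<noteq> 1" "j \<noteq> -1" for j
        using off[OF that] r unfolding r_def by linarith
    qed
    then have re: "of_real (Re (cnj (u 1) * u j)) = cnj (u 1) * u j" by (simp add: complex_eq_iff)
    have "x * of_real (\<rho> j) = u 1 * (cnj (u 1) * u j) / (of_real (cmod (u 1)) * of_real (cmod (u 1)))"
      unfolding \<rho>_def x_def sgn_div_norm of_real_divide re scaleR_conv_of_real of_real_inverse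
      by (simp add: field_simps)
    also have "u 1 * (cnj (u 1) * u j) = (of_real (cmod (u 1)) * of_real (cmod (u 1))) * u j"
      using complex_norm_square[of "u 1"] by (simp add: power2_eq_square)
    finally show ?thesis using u10 by simp
  qed
  have \<rho>_abs: "cmod (u j) = \<bar>\<rho> j\<bar>" if "j \<in> ring_sites N" for j
    unfolding u[OF that] norm_mult x1 by simp
  have \<rho>1: "\<rho> 1 = cmod (u 1)"
    using u10 by (simp add: \<rho>_def cmod_power2[symmetric] power2_eq_square[symmetric]) (simp add: power2_eq_square)
  define \<phi> where "\<phi> j = \<rho> j / r" for j
  have "standing_wave N (\<epsilon> / I) s \<phi>"
  proof
    show "0 < \<epsilon> / I" "\<epsilon> / I \<le> 1 / 1000000" using \<epsilon> I by (auto simp: field_simps)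
    fix j assume j: "j \<in> ring_sites N"
    have "lap N u j = x * of_real (lap N \<rho> j)"
    proof -
      have "lap N u j = lap N (\<lambda>j. x * of_real (\<rho> j)) j" by (rule lap_cong[OF j]) (rule u)
      then show ?thesis by (simp add: lap_def algebra_simps)
    qed
    then have "x * of_real ((\<rho> j ^ 2 - I) * \<rho> j + \<epsilon> * lap N \<rho> j)
        = of_real (cmod (u j) ^ 2 - I) * u j + of_real \<epsilon> * lap N u j"
      unfolding \<rho>_abs[OF j] power2_abs by (simp add: u[OF j] algebra_simps)
    also have "\<dots> = 0" using stat[OF j] unfolding stationary_iff .
    finally have z: "(\<rho> j ^ 2 - I) * \<rho> j + \<epsilon> * lap N \<rho> j = 0"
      using x1 by (simp only: mult_eq_0_iff of_real_eq_0_iff) auto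
    have "lap N \<phi> j = lap N \<rho> j / r" by (simp add: \<phi>_def lap_def diff_divide_distrib)
    then have "I * r * ring_op N (\<epsilon> / I) (\<lambda>j. \<phi> j ^ 2) \<phi> j = (\<rho> j ^ 2 - I) * \<rho> j + \<epsilon> * lap N \<rho> j"
      using r I by (simp add: ring_op_def \<phi>_def power2_eq_square field_simps r(2)[symmetric])
    then show "ring_op N (\<epsilon> / I) (\<lambda>j. \<phi> j ^ 2) \<phi> j = 0" using z r I by simp
    have scale: "\<bar>\<phi> j - a\<bar> \<le> 1 / 10" if "\<bar>\<rho> j - a * r\<bar> \<le> r / 10" for a
    proof -
      have "\<rho> j - a * r = (\<phi> j - a) * r" using r by (simp add: \<phi>_def field_simps)
      then have "\<bar>\<phi> j - a\<bar> * r \<le> 1 / 10 * r" using that r by (simp add: abs_mult)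
      then show ?thesis using r by simp
    qed
    consider "j = 1" | "j = -1" | "j \<noteq> 1" "j \<noteq> -1" by blast
    then show "\<bar>\<phi> j - anchor s j\<bar> \<le> 1 / 10"
    proof cases
      case 1
      then show ?thesis using u1 r by (intro scale) (simp add: anchor_def \<rho>1)
    next
      case 2
      have "x * of_real (\<rho> (-1) - s * \<rho> 1) = (u (-1) - orbit_profile I \<theta> (-1))
          - of_real s * (u 1 - orbit_profile I \<theta> 1)"
        unfolding phases by (simp add: u ns algebra_simps)
      then have "\<bar>\<rho> (-1) - s * \<rho> 1\<bar> = cmod ((u (-1) - orbit_profile I \<theta> (-1))
          - of_real s * (u 1 - orbit_profile I \<theta> 1))"
        using x1 by (metis mult_1 norm_mult norm_of_real)
      also have "\<dots> \<le> r / 100 + r / 100"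
      proof (rule order_trans[OF norm_triangle_ineq4], rule add_mono)
        show "cmod (u (-1) - orbit_profile I \<theta> (-1)) \<le> r / 100" using near[OF ns(14)] by (simp add: r_def)
        show "cmod (of_real s * (u 1 - orbit_profile I \<theta> 1)) \<le> r / 100"
          using near[OF ns(10)] s by (auto simp: norm_mult r_def)
      qed
      finally have "\<bar>\<rho> (-1) - s * \<rho> 1\<bar> \<le> r / 50" by simp
      moreover have "\<bar>s * \<rho> 1 - s * r\<bar> \<le> r / 100"
        using u1 s unfolding \<rho>1 by (auto simp: abs_minus_commute)
      ultimately have "\<bar>\<rho> (-1) - s * r\<bar> \<le> r / 50 + r / 100"
        using abs_add_le[of "\<rho> (-1) - s * \<rho> 1" "r / 50" "s * \<rho> 1 - s * r" "r / 100"] by simp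
      then show ?thesis using 2 r by (intro scale) (simp add: anchor_def)
    next
      case 3
      then show ?thesis using off[OF j 3] r unfolding \<rho>_abs[OF j] by (intro scale) (simp add: anchor_def)
    qed
  qed (use N s in auto)
  moreover have "u j = exp (- \<i> * of_real \<alpha>) * of_real (sqrt I * \<phi> j)" if "j \<in> ring_sites N" for j
  proof -
    have "r * \<phi> j = \<rho> j" using r by (simp add: \<phi>_def)
    then show ?thesis unfolding x[symmetric] r_def[symmetric] by (simp only: u[OF that])
  qed
  ultimately show ?thesis by blast
qed

section \<open>Continuations and their phase differences\<close>

lemma phases_cong:
  assumes "([\<theta> 1 - \<theta> (-1) = 0] (rmod (2 * pi)) \<and> s = 1) \<or> ([\<theta> 1 - \<theta> (-1) = pi] (rmod (2 * pi)) \<and> s = -1)"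
  shows "exp (- \<i> * of_real (\<theta> (-1))) = of_real s * exp (- \<i> * complex_of_real (\<theta> 1))"
proof -
  have "cos (\<theta> 1 - \<theta> (-1)) = s \<and> sin (\<theta> 1 - \<theta> (-1)) = 0"
    using assms
  proof (elim disjE conjE)
    assume "[\<theta> 1 - \<theta> (-1) = 0] (rmod (2 * pi))" and s: "s = 1"
    then obtain n :: int where "0 = \<theta> 1 - \<theta> (-1) + of_int n * (2 * pi)" unfolding rcong_altdef by blast
    then have "\<theta> 1 - \<theta> (-1) = - (of_int n * (2 * pi))" by linarith
    then have "\<theta> 1 - \<theta> (-1) = (2 * pi) * of_int (- n)" by simp
    then show ?thesis unfolding s by (simp only: cos_int_2pin sin_int_2pin)
  next
    assume "[\<theta> 1 - \<theta> (-1) = pi] (rmod (2 * pi))" and s: "s = -1"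
    then obtain n :: int where "pi = \<theta> 1 - \<theta> (-1) + of_int n * (2 * pi)" unfolding rcong_altdef by blast
    then have "\<theta> 1 - \<theta> (-1) = pi + - (of_int n * (2 * pi))" by linarith
    then have "\<theta> 1 - \<theta> (-1) = pi + (2 * pi) * of_int (- n)" by simp
    then show ?thesis unfolding s by (simp only: cos_add sin_add cos_int_2pin sin_int_2pin) simp
  qed
  then have "exp (\<i> * of_real (\<theta> 1 - \<theta> (-1))) = of_real s"
    unfolding cis_conv_exp[symmetric] by (simp add: complex_eq_iff)
  moreover have "exp (- \<i> * of_real (\<theta> (-1))) = exp (\<i> * of_real (\<theta> 1 - \<theta> (-1))) * exp (- \<i> * complex_of_real (\<theta> 1))"
    unfolding exp_add[symmetric] by (simp add: algebra_simps)
  ultimately show ?thesis by simp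
qed

lemma orbit_profile_anchor:
  assumes "exp (- \<i> * of_real (\<theta> (-1))) = of_real s * exp (- \<i> * complex_of_real (\<theta> 1))"
  shows "orbit_profile I \<theta> j = exp (- \<i> * of_real (\<theta> 1)) * of_real (sqrt I * anchor s j)"
  using assms by (auto simp: orbit_profile_def anchor_def)

lemma sin_phase_zero:
  assumes "sin (q :: real) = 0"
  shows "[q = 0] (rmod (2 * pi)) \<or> [q = pi] (rmod (2 * pi))"
proof -
  obtain i :: int where i: "q = of_int i * pi" using assms unfolding sin_zero_iff_int2 by blast
  show ?thesis
  proof (cases "even i")
    case True
    then obtain k where "i = 2 * k" by blast
    then have "0 = q + of_int (- k) * (2 * pi)" using i by simp
    then show ?thesis unfolding rcong_altdef by blast
  next
    case False
    then obtain k where "i = 2 * k + 1" using oddE by blast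
    then have "pi = q + of_int (- k) * (2 * pi)" using i by (simp add: algebra_simps)
    then show ?thesis unfolding rcong_altdef by blast
  qed
qed

lemma converges_eventually_near:
  assumes "converges_to_orbit N \<Psi> \<psi>0 F" "\<delta> > 0"
  shows "\<forall>\<^sub>F a in F. \<forall>j\<in>ring_sites N. \<forall>t. cmod (\<Psi> a t j - \<psi>0 t j) \<le> \<delta>"
proof (rule eventually_ball_finite)
  show "\<forall>j\<in>ring_sites N. \<forall>\<^sub>F a in F. \<forall>t. cmod (\<Psi> a t j - \<psi>0 t j) \<le> \<delta>"
  proof
    fix j assume "j \<in> ring_sites N"
    then have "uniform_limit UNIV (\<lambda>a t. \<Psi> a t j) (\<lambda>t. \<psi>0 t j) F"
      using assms(1) by (simp add: converges_to_orbit_def)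
    from uniform_limitD[OF this assms(2)] show "\<forall>\<^sub>F a in F. \<forall>t. cmod (\<Psi> a t j - \<psi>0 t j) \<le> \<delta>"
      by eventually_elim (auto simp: dist_norm less_imp_le)
  qed
qed simp

lemma floquet_multiplier_mat_exp:
  assumes "A \<in> carrier_mat d d"
  shows "floquet_multiplier (mat_exp A T) \<mu> \<longleftrightarrow>
    (\<exists>x. eigenvalue (map_mat complex_of_real A) x \<and> \<mu> = exp (of_real T * x))"
  unfolding floquet_multiplier_def map_mat_mat_exp[OF assms]
  by (rule eigenvalue_mat_exp) (use assms in auto)

lemma continuation_exists:
  fixes I T \<omega> :: real
  assumes I: "I > 0" and \<omega>: "\<omega> = 1 + I" and T: "exp (- \<i> * of_real (\<omega> * T)) = 1"
    and s: "s = 1 \<or> s = -1"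
    and phases: "exp (- \<i> * of_real (\<theta> (-1))) = of_real s * exp (- \<i> * complex_of_real (\<theta> 1))"
  shows "can_be_continued N T (unperturbed_orbit {-1, 1} I \<theta>)"
proof -
  have "\<forall>e. \<exists>\<phi>. 0 < e \<and> e \<le> 1 / 1000 \<longrightarrow>
    (\<forall>j. ring_op N e (\<lambda>j. \<phi> j ^ 2) \<phi> j = 0) \<and> (\<forall>j. \<bar>\<phi> j - anchor s j\<bar> \<le> 10 * e)"
    using standing_wave_exists[OF _ _ s] by blast
  then obtain P where P: "\<And>e. 0 < e \<Longrightarrow> e \<le> 1 / 1000 \<Longrightarrow>
      (\<forall>j. ring_op N e (\<lambda>j. P e j ^ 2) (P e) j = 0) \<and> (\<forall>j. \<bar>P e j - anchor s j\<bar> \<le> 10 * e)"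
    by metis
  define c where "c \<epsilon> j = exp (- \<i> * of_real (\<theta> 1)) * complex_of_real (sqrt I * P (\<epsilon> / I) j)" for \<epsilon> j
  define \<Psi> where "\<Psi> \<epsilon> t j = exp (- \<i> * of_real (\<omega> * t)) * c \<epsilon> j" for \<epsilon> t j
  have small: "0 < \<epsilon> / I" "\<epsilon> / I \<le> 1 / 1000" if "0 < \<epsilon>" "\<epsilon> < I / 1000" for \<epsilon>
    using that I by (auto simp: field_simps)
  have stat: "dnls_field N \<epsilon> (c \<epsilon>) j = of_real \<omega> * c \<epsilon> j" if "0 < \<epsilon>" "\<epsilon> < I / 1000" for \<epsilon> j
  proof -
    define x where "x = exp (- \<i> * complex_of_real (\<theta> 1))"
    have x1: "cmod x = 1" by (simp add: x_def norm_exp_eq_Re)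
    define p where "p = P (\<epsilon> / I)"
    have c: "c \<epsilon> = (\<lambda>j. x * of_real (sqrt I * p j))" by (simp add: c_def[abs_def] x_def p_def)
    have "ring_op N (\<epsilon> / I) (\<lambda>j. p j ^ 2) p j = 0" using P[OF small[OF that]] by (simp add: p_def)
    then have "I * ((p j ^ 2 - 1) * p j + \<epsilon> / I * lap N p j) = 0" by (simp add: ring_op_def)
    then have z: "(I * p j ^ 2 - I) * p j + \<epsilon> * lap N p j = 0" using I by (simp add: algebra_simps)
    have "cmod (of_real (sqrt I * p j)) ^ 2 = I * p j ^ 2"
      using I by (simp only: norm_of_real power2_abs power_mult_distrib real_sqrt_pow2 less_imp_le)
    then have "of_real (cmod (of_real (sqrt I * p j)) ^ 2 - I) * of_real (sqrt I * p j)
        + of_real \<epsilon> * lap N (\<lambda>j. complex_of_real (sqrt I * p j)) j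
        = of_real (sqrt I * ((I * p j ^ 2 - I) * p j + \<epsilon> * lap N p j))"
      by (simp add: lap_def algebra_simps)
    also have "\<dots> = 0" unfolding z by simp
    finally have "dnls_field N \<epsilon> (\<lambda>j. complex_of_real (sqrt I * p j)) j = of_real \<omega> * of_real (sqrt I * p j)"
      using stationary_iff[of N \<epsilon> "\<lambda>j. complex_of_real (sqrt I * p j)" j I] unfolding \<omega> by blast
    then show ?thesis unfolding c dnls_field_rotate[OF x1] by (simp add: ac_simps)
  qed
  have periodic: "dnls_periodic_solution N \<epsilon> T (\<Psi> \<epsilon>)" if \<epsilon>: "0 < \<epsilon>" "\<epsilon> < I / 1000" for \<epsilon>
    unfolding dnls_periodic_solution_def dnls_solution_iff
  proof (intro conjI allI ballI)
    fix t j
    have "((\<lambda>s. \<Psi> \<epsilon> s j) has_vector_derivative (- \<i> * of_real \<omega> * exp (- \<i> * of_real (\<omega> * t))) * c \<epsilon> j) (at t)"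
      unfolding \<Psi>_def by (intro has_vector_derivative_mult_left exp_rotation_derivative)
    moreover have "dnls_field N \<epsilon> (\<Psi> \<epsilon> t) j = exp (- \<i> * of_real (\<omega> * t)) * (of_real \<omega> * c \<epsilon> j)"
    proof -
      have "cmod (exp (- \<i> * of_real (\<omega> * t))) = 1" by (simp add: norm_exp_eq_Re)
      from dnls_field_rotate[OF this] show ?thesis
        unfolding \<Psi>_def[abs_def] by (simp add: stat[OF \<epsilon>])
    qed
    ultimately show "((\<lambda>s. \<Psi> \<epsilon> s j) has_vector_derivative - \<i> * dnls_field N \<epsilon> (\<Psi> \<epsilon> t) j) (at t)"
      by (simp add: ac_simps)
    have "exp (- \<i> * of_real (\<omega> * (t + T))) = exp (- \<i> * of_real (\<omega> * t)) * exp (- \<i> * of_real (\<omega> * T))"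
      unfolding exp_add[symmetric] by (simp add: algebra_simps)
    then show "\<Psi> \<epsilon> (t + T) j = \<Psi> \<epsilon> t j" unfolding \<Psi>_def T by simp
  qed
  have close: "cmod (\<Psi> \<epsilon> t j - unperturbed_orbit {-1, 1} I \<theta> t j) \<le> sqrt I * (10 * (\<epsilon> / I))"
    if \<epsilon>: "0 < \<epsilon>" "\<epsilon> < I / 1000" for \<epsilon> t j
  proof -
    have "\<Psi> \<epsilon> t j - unperturbed_orbit {-1, 1} I \<theta> t j = exp (- \<i> * of_real (\<omega> * t)) *
        (exp (- \<i> * of_real (\<theta> 1)) * of_real (sqrt I * (P (\<epsilon> / I) j - anchor s j)))"
      unfolding unperturbed_orbit_eq orbit_profile_anchor[OF phases] \<Psi>_def c_def \<omega>
      by (simp add: algebra_simps)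
    then have "cmod (\<Psi> \<epsilon> t j - unperturbed_orbit {-1, 1} I \<theta> t j) = sqrt I * \<bar>P (\<epsilon> / I) j - anchor s j\<bar>"
      using I by (simp add: norm_mult norm_exp_eq_Re abs_mult del: of_real_mult of_real_diff)
    also have "\<dots> \<le> sqrt I * (10 * (\<epsilon> / I))"
      using P[OF small[OF \<epsilon>]] I by (intro mult_left_mono) auto
    finally show ?thesis .
  qed
  have "converges_to_orbit N \<Psi> (unperturbed_orbit {-1, 1} I \<theta>) (at_right 0)"
    unfolding converges_to_orbit_def
  proof (intro ballI uniform_limitI)
    fix j and d :: real assume d: "d > 0"
    have "((\<lambda>\<epsilon>. sqrt I * (10 * (\<epsilon> / I))) \<longlongrightarrow> sqrt I * (10 * (0 / I))) (at_right 0)"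
      using I by (intro tendsto_intros) auto
    then have "\<forall>\<^sub>F \<epsilon> in at_right 0. sqrt I * (10 * (\<epsilon> / I)) < d"
      by (rule order_tendstoD) (use d in simp)
    moreover have "\<forall>\<^sub>F \<epsilon> in at_right 0. 0 < \<epsilon> \<and> \<epsilon> < I / 1000"
      unfolding eventually_at_right_field by (rule exI[of _ "I / 1000"]) (use I in auto)
    ultimately show "\<forall>\<^sub>F \<epsilon> in at_right 0. \<forall>t\<in>UNIV. dist (\<Psi> \<epsilon> t j) (unperturbed_orbit {-1, 1} I \<theta> t j) < d"
      by eventually_elim (use close in \<open>auto simp: dist_norm intro: order_le_less_trans\<close>)
  qed
  moreover have "\<exists>\<epsilon>0>0. \<forall>\<epsilon>. 0 < \<epsilon> \<and> \<epsilon> < \<epsilon>0 \<longrightarrow> dnls_periodic_solution N \<epsilon> T (\<Psi> \<epsilon>)"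
    using periodic I by (intro exI[of _ "I / 1000"]) auto
  ultimately show ?thesis unfolding can_be_continued_def is_continuation_def by blast
qed

text \<open>
  The statement concerns an arbitrary continuation, not a particular one: rigidity turns each of its
  members into a rotating wave with a real profile, whose spectrum is known.
\<close>

lemma continuation_multipliers:
  fixes I T \<omega> :: real
  assumes N: "6 \<le> N" "N \<le> 10" and I: "I > 0" and \<omega>: "\<omega> = 1 + I" and T: "T = 2 * pi / \<omega>"
    and period: "exp (- \<i> * of_real (\<omega> * T)) = 1" and s: "s = 1 \<or> s = -1"
    and phases: "exp (- \<i> * of_real (\<theta> (-1))) = of_real s * exp (- \<i> * complex_of_real (\<theta> 1))"
    and cont: "is_continuation N T (unperturbed_orbit {-1, 1} I \<theta>) \<Psi>"
  shows "\<exists>\<epsilon>1>0. \<forall>\<epsilon>. 0 < \<epsilon> \<and> \<epsilon> < \<epsilon>1 \<longrightarrow>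
    (if s = 1 then linearly_unstable N \<epsilon> T (\<Psi> \<epsilon>) else linearly_stable N \<epsilon> T (\<Psi> \<epsilon>))"
proof -
  have T': "T = 2 * pi / (1 + I)" using T \<omega> by simp
  obtain \<delta> \<epsilon>r where rot: "\<delta> > 0" "\<epsilon>r > 0"
    "\<forall>N \<theta> \<epsilon> \<psi>. 0 < \<epsilon> \<longrightarrow> \<epsilon> < \<epsilon>r \<longrightarrow> dnls_periodic_solution N \<epsilon> T \<psi> \<longrightarrow>
    (\<forall>j\<in>ring_sites N. \<forall>t. cmod (\<psi> t j - unperturbed_orbit {-1, 1} I \<theta> t j) \<le> \<delta>) \<longrightarrow>
    (\<forall>j\<in>ring_sites N. dnls_field N \<epsilon> (\<psi> 0) j = of_real (1 + I) * \<psi> 0 j \<and>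
      (\<forall>t. \<psi> t j = exp (- \<i> * of_real ((1 + I) * t)) * \<psi> 0 j))"
    using periodic_solution_is_rotating_wave[OF I T'] by (elim exE conjE)
  define d where "d = min \<delta> (sqrt I / 100)"
  have d: "d > 0" using rot(1) I by (simp add: d_def)
  obtain \<epsilon>0 where \<epsilon>0: "\<epsilon>0 > 0" "\<And>\<epsilon>. 0 < \<epsilon> \<Longrightarrow> \<epsilon> < \<epsilon>0 \<Longrightarrow> dnls_periodic_solution N \<epsilon> T (\<Psi> \<epsilon>)"
    using cont unfolding is_continuation_def by blast
  have "\<forall>\<^sub>F \<epsilon> in at_right 0. \<forall>j\<in>ring_sites N. \<forall>t. cmod (\<Psi> \<epsilon> t j - unperturbed_orbit {-1, 1} I \<theta> t j) \<le> d"
    using cont d unfolding is_continuation_def by (intro converges_eventually_near) auto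
  then obtain b where b: "b > 0" "\<And>\<epsilon> j t. 0 < \<epsilon> \<Longrightarrow> \<epsilon> < b \<Longrightarrow> j \<in> ring_sites N \<Longrightarrow>
      cmod (\<Psi> \<epsilon> t j - unperturbed_orbit {-1, 1} I \<theta> t j) \<le> d"
    unfolding eventually_at_right_field by blast
  define \<epsilon>1 where "\<epsilon>1 = min (min \<epsilon>0 b) (min \<epsilon>r (I / 1000000))"
  have "if s = 1 then linearly_unstable N \<epsilon> T (\<Psi> \<epsilon>) else linearly_stable N \<epsilon> T (\<Psi> \<epsilon>)"
    if \<epsilon>: "0 < \<epsilon>" "\<epsilon> < \<epsilon>1" for \<epsilon>
  proof -
    have lt: "\<epsilon> < \<epsilon>0" "\<epsilon> < b" "\<epsilon> < \<epsilon>r" "\<epsilon> \<le> I / 1000000" using \<epsilon> by (auto simp: \<epsilon>1_def)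
    have near: "cmod (\<Psi> \<epsilon> t j - unperturbed_orbit {-1, 1} I \<theta> t j) \<le> \<delta>"
      "cmod (\<Psi> \<epsilon> t j - unperturbed_orbit {-1, 1} I \<theta> t j) \<le> sqrt I / 100"
      if "j \<in> ring_sites N" for t j
      using b(2)[OF \<epsilon>(1) lt(2) that, of t] by (auto simp: d_def)
    have rotating: "\<Psi> \<epsilon> t j = exp (- \<i> * of_real (\<omega> * t)) * \<Psi> \<epsilon> 0 j"
      "dnls_field N \<epsilon> (\<Psi> \<epsilon> 0) j = of_real (1 + I) * \<Psi> \<epsilon> 0 j" if "j \<in> ring_sites N" for t j
      using rot(3)[rule_format, OF \<epsilon>(1) lt(3) \<epsilon>0(2)[OF \<epsilon>(1) lt(1)], of \<theta> j] near(1) that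
      unfolding \<omega> by blast+
    have near0: "cmod (\<Psi> \<epsilon> 0 j - orbit_profile I \<theta> j) \<le> sqrt I / 100" if "j \<in> ring_sites N" for j
      using near(2)[OF that, of 0] by (simp add: unperturbed_orbit_eq)
    have op: "orbit_profile I \<theta> (-1) = of_real s * orbit_profile I \<theta> 1"
      unfolding orbit_profile_anchor[OF phases] by (simp add: anchor_def)
    obtain \<alpha> \<phi> where sw: "standing_wave N (\<epsilon> / I) s \<phi>"
      and \<phi>: "\<And>j. j \<in> ring_sites N \<Longrightarrow> \<Psi> \<epsilon> 0 j = exp (- \<i> * of_real \<alpha>) * of_real (sqrt I * \<phi> j)"
      using standing_wave_of_stationary[of N I \<epsilon> s "\<Psi> \<epsilon> 0" \<theta>, OF N I \<epsilon>(1) lt(4) s rotating(2) near0 op] by blast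
    interpret standing_wave N "\<epsilon> / I" s \<phi> by (rule sw)
    have e: "\<epsilon> = I * (\<epsilon> / I)" using I by simp
    let ?A = "rotating_mat N \<epsilon> \<omega> (\<Psi> \<epsilon> 0)"
    have mono: "monodromy_mat N \<epsilon> T (\<Psi> \<epsilon>) (mat_exp ?A T)"
      by (rule monodromy_rotating_wave[OF rotating(1) period])
    have mult: "floquet_multiplier (mat_exp ?A T) \<mu> \<longleftrightarrow>
      (\<exists>x. eigenvalue (map_mat complex_of_real ?A) x \<and> \<mu> = exp (of_real T * x))" for \<mu>
      by (rule floquet_multiplier_mat_exp[OF rotating_mat_carrier])
    have T0: "T > 0" using T' I by simp
    show ?thesis
    proof (cases "s = 1")
      case True
      obtain x where x: "eigenvalue (map_mat complex_of_real ?A) x" "Re x > 0"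
        using symmetric_spectrum[OF I \<omega> e \<phi> True] by blast
      have "cmod (exp (of_real T * x)) > 1" using x(2) T0 by (simp add: norm_exp_eq_Re)
      moreover have "floquet_multiplier (mat_exp ?A T) (exp (of_real T * x))" using mult x(1) by blast
      ultimately have "linearly_unstable N \<epsilon> T (\<Psi> \<epsilon>)"
        using mono unfolding linearly_unstable_def by blast
      then show ?thesis using True by simp
    next
      case False
      then have s': "s = -1" using s by simp
      have "cmod \<mu> = 1" if fm: "floquet_multiplier (mat_exp ?A T) \<mu>" for \<mu>
      proof -
        obtain x where x: "eigenvalue (map_mat complex_of_real ?A) x" "\<mu> = exp (of_real T * x)"
          using mult fm by blast
        have "Re x = 0" by (rule antisymmetric_spectrum[OF I \<omega> e \<phi> s' x(1)])
        then show ?thesis using x(2) by (simp add: norm_exp_eq_Re)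
      qed
      then have "linearly_stable N \<epsilon> T (\<Psi> \<epsilon>)" using mono unfolding linearly_stable_def by blast
      then show ?thesis using False by simp
    qed
  qed
  moreover have "\<epsilon>1 > 0" using \<epsilon>0(1) b(1) rot(2) I by (simp add: \<epsilon>1_def)
  ultimately show ?thesis by blast
qed

text \<open>
  The imaginary part of \<open>cnj (u 1) * u (-1)\<close> vanishes exactly along the sequence; in the limit it
  is I times the sine of the phase difference.
\<close>

lemma limit_phase_difference:
  fixes I T :: real
  assumes N: "6 \<le> N" and I: "I > 0" and T: "T = 2 * pi / (1 + I)"
    and e: "\<And>n. e n > 0" "e \<longlonglongrightarrow> 0"
    and sol: "\<And>n. dnls_periodic_solution N (e n) T (\<Psi> n)"
    and conv: "converges_to_orbit N \<Psi> (unperturbed_orbit {-1, 1} I \<theta>) sequentially"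
  shows "sin (\<theta> 1 - \<theta> (-1)) = 0"
proof -
  note ns = near_sites[OF N]
  obtain \<delta> \<epsilon>r where rot: "\<delta> > 0" "\<epsilon>r > 0"
    "\<forall>N \<theta> \<epsilon> \<psi>. 0 < \<epsilon> \<longrightarrow> \<epsilon> < \<epsilon>r \<longrightarrow> dnls_periodic_solution N \<epsilon> T \<psi> \<longrightarrow>
    (\<forall>j\<in>ring_sites N. \<forall>t. cmod (\<psi> t j - unperturbed_orbit {-1, 1} I \<theta> t j) \<le> \<delta>) \<longrightarrow>
    (\<forall>j\<in>ring_sites N. dnls_field N \<epsilon> (\<psi> 0) j = of_real (1 + I) * \<psi> 0 j \<and>
      (\<forall>t. \<psi> t j = exp (- \<i> * of_real ((1 + I) * t)) * \<psi> 0 j))"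
    using periodic_solution_is_rotating_wave[OF I T] by (elim exE conjE)
  define d where "d = min \<delta> (sqrt I / 10)"
  have d: "d > 0" using rot(1) I by (simp add: d_def)
  have "\<forall>\<^sub>F n in sequentially. e n < min \<epsilon>r (I / 100)"
    using e(2) by (rule order_tendstoD) (use rot(2) I in simp)
  then have "\<forall>\<^sub>F n in sequentially. Im (cnj (\<Psi> n 0 1) * \<Psi> n 0 (-1)) = 0"
    using converges_eventually_near[OF conv d]
  proof eventually_elim
    case (elim n)
    have near: "cmod (\<Psi> n t j - unperturbed_orbit {-1, 1} I \<theta> t j) \<le> \<delta>"
      "cmod (\<Psi> n t j - unperturbed_orbit {-1, 1} I \<theta> t j) \<le> sqrt I / 10"
      if "j \<in> ring_sites N" for t j
      using elim(2) that by (auto simp: d_def)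
    have lt: "e n < \<epsilon>r" "e n \<le> I / 100" using elim(1) by auto
    show ?case
    proof (rule phase_locked[of N I "e n" "\<Psi> n 0" "-1", OF N I e(1) lt(2) _ _ ns(14)])
      show "dnls_field N (e n) (\<Psi> n 0) j = of_real (1 + I) * \<Psi> n 0 j" if "j \<in> ring_sites N" for j
        using rot(3)[rule_format, OF e(1) lt(1) sol, of \<theta> j] near(1) that by blast
      show "cmod (\<Psi> n 0 j) \<le> sqrt I / 10" if "j \<in> ring_sites N" "j \<noteq> 1" "j \<noteq> -1" for j
        using near(2)[OF that(1), of 0] that by (simp add: unperturbed_orbit_def)
    qed
  qed
  then have zero: "(\<lambda>n. Im (cnj (\<Psi> n 0 1) * \<Psi> n 0 (-1))) \<longlonglongrightarrow> 0"
    by (rule tendsto_eventually)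
  have pt: "(\<lambda>n. \<Psi> n 0 j) \<longlonglongrightarrow> orbit_profile I \<theta> j" if "j \<in> ring_sites N" for j
  proof -
    have "uniform_limit UNIV (\<lambda>n t. \<Psi> n t j) (\<lambda>t. unperturbed_orbit {-1, 1} I \<theta> t j) sequentially"
      using conv that by (simp add: converges_to_orbit_def)
    from tendsto_uniform_limitI[OF this UNIV_I, of 0] show ?thesis by (simp add: unperturbed_orbit_eq)
  qed
  have "(\<lambda>n. Im (cnj (\<Psi> n 0 1) * \<Psi> n 0 (-1))) \<longlonglongrightarrow>
      Im (cnj (orbit_profile I \<theta> 1) * orbit_profile I \<theta> (-1))"
    by (intro tendsto_intros pt ns)
  from LIMSEQ_unique[OF this zero]
  have "Im (cnj (orbit_profile I \<theta> 1) * orbit_profile I \<theta> (-1)) = 0" .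
  moreover have "cnj (orbit_profile I \<theta> 1) * orbit_profile I \<theta> (-1)
      = of_real I * exp (\<i> * of_real (\<theta> 1 - \<theta> (-1)))"
  proof -
    have "of_real (sqrt I) * of_real (sqrt I) = complex_of_real I"
      using I by (simp only: of_real_mult[symmetric] real_sqrt_mult_self) simp
    then have r: "of_real (sqrt I) * a * (of_real (sqrt I) * b) = complex_of_real I * (a * b)" for a b
      by (metis mult.assoc mult.left_commute)
    show ?thesis
      by (simp only: orbit_profile_def insert_iff simp_thms if_True complex_cnj_mult complex_cnj_complex_of_real
          exp_cnj r exp_add[symmetric]) (simp add: algebra_simps)
  qed
  ultimately show ?thesis using I by (simp add: Im_exp)
qed

theorem mainTheorem1:
  fixes N :: nat and I \<omega> T :: real and S :: "int set"
  assumes "6 \<le> N" and "N \<le> 10"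
    and "S = {-1, 1}"
    and "I > 0"
    and "\<omega> = 1 + I"
    and "\<And>k::int. k \<noteq> 0 \<Longrightarrow> of_int k * \<omega> + 1 \<noteq> 0 \<and> of_int k * \<omega> - 1 \<noteq> 0"
    and "\<And>k::int. k \<noteq> 0 \<Longrightarrow> of_int k * \<omega> + 2 \<noteq> 0 \<and> of_int k * \<omega> - 2 \<noteq> 0"
    and "T = 2 * pi / \<omega>"
  shows
    "(\<forall>\<theta>::int \<Rightarrow> real.
        [\<theta> 1 - \<theta> (-1) = 0] (rmod (2 * pi)) \<or> [\<theta> 1 - \<theta> (-1) = pi] (rmod (2 * pi)) \<longrightarrow>
        can_be_continued N T (unperturbed_orbit S I \<theta>))
     \<and>
     (\<forall>(\<theta>::int \<Rightarrow> real) \<Psi>.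
        is_continuation N T (unperturbed_orbit S I \<theta>) \<Psi> \<longrightarrow>
        ([\<theta> 1 - \<theta> (-1) = 0] (rmod (2 * pi)) \<longrightarrow>
           (\<exists>\<epsilon>1>0. \<forall>\<epsilon>. 0 < \<epsilon> \<and> \<epsilon> < \<epsilon>1 \<longrightarrow> linearly_unstable N \<epsilon> T (\<Psi> \<epsilon>))) \<and>
        ([\<theta> 1 - \<theta> (-1) = pi] (rmod (2 * pi)) \<longrightarrow>
           (\<exists>\<epsilon>1>0. \<forall>\<epsilon>. 0 < \<epsilon> \<and> \<epsilon> < \<epsilon>1 \<longrightarrow> linearly_stable N \<epsilon> T (\<Psi> \<epsilon>))))
     \<and>
     (\<forall>(\<theta>::int \<Rightarrow> real) (e::nat \<Rightarrow> real) \<Psi>.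
        (\<forall>n. e n > 0) \<and> e \<longlonglongrightarrow> 0 \<and>
        (\<forall>n. dnls_periodic_solution N (e n) T (\<Psi> n)) \<and>
        converges_to_orbit N \<Psi> (unperturbed_orbit S I \<theta>) sequentially \<longrightarrow>
        [\<theta> 1 - \<theta> (-1) = 0] (rmod (2 * pi)) \<or> [\<theta> 1 - \<theta> (-1) = pi] (rmod (2 * pi)))"
proof -
  have T: "T = 2 * pi / (1 + I)" using assms by simp
  have "\<omega> > 0" using assms by simp
  then have "\<omega> * T = 2 * pi" using assms(8) by simp
  then have period: "exp (- \<i> * of_real (\<omega> * T)) = 1"
    by (simp add: exp_minus mult.commute)
  have phases: "\<exists>s. (s = 1 \<or> s = -1) \<and> exp (- \<i> * of_real (\<theta> (-1))) = of_real s * exp (- \<i> * complex_of_real (\<theta> 1))"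
    if "[\<theta> 1 - \<theta> (-1) = 0] (rmod (2 * pi)) \<or> [\<theta> 1 - \<theta> (-1) = pi] (rmod (2 * pi))" for \<theta> :: "int \<Rightarrow> real"
    using that phases_cong[of \<theta> 1] phases_cong[of \<theta> "-1"] by blast
  show ?thesis
    unfolding assms(3)
  proof (intro conjI allI impI)
    show "can_be_continued N T (unperturbed_orbit {-1, 1} I \<theta>)"
      if "[\<theta> 1 - \<theta> (-1) = 0] (rmod (2 * pi)) \<or> [\<theta> 1 - \<theta> (-1) = pi] (rmod (2 * pi))" for \<theta>
      using phases[OF that] continuation_exists[OF assms(4,5) period] by blast
    show "\<exists>\<epsilon>1>0. \<forall>\<epsilon>. 0 < \<epsilon> \<and> \<epsilon> < \<epsilon>1 \<longrightarrow> linearly_unstable N \<epsilon> T (\<Psi> \<epsilon>)"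
      if "is_continuation N T (unperturbed_orbit {-1, 1} I \<theta>) \<Psi>" "[\<theta> 1 - \<theta> (-1) = 0] (rmod (2 * pi))"
      for \<theta> \<Psi>
      using continuation_multipliers[OF assms(1,2,4,5,8) period _ phases_cong[of \<theta> 1] that(1)] that(2) by simp
    show "\<exists>\<epsilon>1>0. \<forall>\<epsilon>. 0 < \<epsilon> \<and> \<epsilon> < \<epsilon>1 \<longrightarrow> linearly_stable N \<epsilon> T (\<Psi> \<epsilon>)"
      if "is_continuation N T (unperturbed_orbit {-1, 1} I \<theta>) \<Psi>" "[\<theta> 1 - \<theta> (-1) = pi] (rmod (2 * pi))"
      for \<theta> \<Psi>
      using continuation_multipliers[OF assms(1,2,4,5,8) period _ phases_cong[of \<theta> "-1"] that(1)] that(2) by simp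
    show "[\<theta> 1 - \<theta> (-1) = 0] (rmod (2 * pi)) \<or> [\<theta> 1 - \<theta> (-1) = pi] (rmod (2 * pi))"
      if "(\<forall>n. e n > 0) \<and> e \<longlonglongrightarrow> 0 \<and> (\<forall>n. dnls_periodic_solution N (e n) T (\<Psi> n)) \<and>
        converges_to_orbit N \<Psi> (unperturbed_orbit {-1, 1} I \<theta>) sequentially" for \<theta> :: "int \<Rightarrow> real" and e \<Psi>
      using limit_phase_difference[OF assms(1,4) T] that by (intro sin_phase_zero) blast
  qed
qed

end
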